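(* Let $\underline{\mathcal C}$ be a $G$-$A$-coring. The functors $F_1:\mathcal M^{G,\underline{\mathcal C}}\to\mathcal M^{\underline{\mathcal C}}$ and $G_1:\mathcal M^{\underline{\mathcal C}}\to\mathcal M^{G,\underline{\mathcal C}}$ form a pair of adjoint functors $(F_1,G_1)$ ($F_1$ is left adjoint to $G_1$). Moreover, if $G$ is a finite group, then $(F_1,G_1)$ is a Frobenius pair of functors, i.e. $F_1$ is also a right adjoint of $G_1$.
   Context: $G$ is a group with unit $e$, $A$ is a ring with unit. A $G$-$A$-coring (group coring) $\underline{\mathcal C}$ is a family $(\mathcal C_\alpha)_{\alpha\in G}$ of $A$-bimodules with $A$-bimodule maps $\Delta_{\alpha,\beta}:\mathcal C_{\alpha\beta}\to\mathcal C_\alpha\otimes_A\mathcal C_\beta$ and $\varepsilon:\mathcal C_e\to A$ such that, for all $\alpha,\beta,\gamma\in G$, $(\Delta_{\alpha,\beta}\otimes_A\mathcal C_\gamma)\circ\Delta_{\alpha\beta,\gamma}=(\mathcal C_\alpha\otimes_A\Delta_{\beta,\gamma})\circ\Delta_{\alpha,\beta\gamma}$ and $(\mathcal C_\alpha\otimes_A\varepsilon)\circ\Delta_{\alpha,e}=\mathcal C_\alpha=(\varepsilon\otimes_A\mathcal C_\alpha)\circ\Delta_{e,\alpha}$ (an object also denotes its identity map). A right $\underline{\mathcal C}$-comodule is a right $A$-module $M$ with right $A$-linear maps $\rho_\alpha:M\to M\otimes_A\mathcal C_\alpha$, written $\rho_\alpha(m)=m_{[0]}\otimes_Am_{[1,\alpha]}$,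 such that $(M\otimes_A\Delta_{\alpha,\beta})\circ\rho_{\alpha\beta}=(\rho_\alpha\otimes_A\mathcal C_\beta)\circ\rho_\beta$ and $(M\otimes_A\varepsilon)\circ\rho_e=M$. Morphisms are right $A$-linear maps $f$ with $(f\otimes_A\mathcal C_\alpha)\circ\rho_\alpha=\rho_\alpha\circ f$ for all $\alpha$. The category is $\mathcal M^{\underline{\mathcal C}}$. A right $G$-$\underline{\mathcal C}$-comodule is a family $\underline M=(M_\alpha)_{\alpha\in G}$ of right $A$-modules with right $A$-linear maps $\rho_{\alpha,\beta}:M_{\alpha\beta}\to M_\alpha\otimes_A\mathcal C_\beta$ such that $(M_\alpha\otimes_A\Delta_{\beta,\gamma})\circ\rho_{\alpha,\beta\gamma}=(\rho_{\alpha,\beta}\otimes_A\mathcal C_\gamma)\circ\rho_{\alpha\beta,\gamma}$ and $(M_\alpha\otimes_A\varepsilon)\circ\rho_{\alpha,e}=M_\alpha$. Morphisms are families of right $A$-linear maps $f_\alpha:M_\alpha\to N_\alpha$ with $(f_\alpha\otimes_A\mathcal C_\beta)\circ\rho_{\alpha,\beta}=\rho_{\alpha,\beta}\circ f_{\alpha\beta}$. The category is $\mathcal M^{G,\underline{\mathcal C}}$. $F_1(\underline M)=\bigoplus_{\alpha\in G}M_\alpha$ with $\rho_\alpha=\bigoplus_{\beta\in G}\rho_{\beta\alpha^{-1},\alpha}$ (so on $M_\beta$ the map $\rho_\alpha$ is $\rho_{\beta\alpha^{-1},\alpha}$), and $F_1(\underline f)=\bigoplus_\alpha f_\alpha$.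 $G_1(M)=(\mu_\alpha(M))_{\alpha\in G}$, where $\mu_\alpha(M)=\{\mu_\alpha(m)\mid m\in M\}$ is an isomorphic copy of $M$ indexed by $\alpha$, with $\rho_{\alpha,\beta}(\mu_{\alpha\beta}(m))=\mu_\alpha(m_{[0]})\otimes_Am_{[1,\beta]}$; on morphisms $G_1(f)_\alpha(\mu_\alpha(m))=\mu_\alpha(f(m))$. *)

theory Defs
  imports "HOL-Algebra.Ring" "HOL-Algebra.Free_Abelian_Groups"
begin

section \<open>Categories, functors, adjunctions\<close>

text \<open>
  Arrows do not carry their source and target, so identities, composition and the action of a
  functor on arrows take the objects involved as arguments: \<open>Cmp \<C> X Y Z g f\<close> is \<open>g \<circ> f\<close>
  for \<open>f : X \<rightarrow> Y\<close> and \<open>g : Y \<rightarrow> Z\<close>.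
\<close>

record ('o, 'a) cat =
  Obj :: "'o set"
  Hom :: "'o \<Rightarrow> 'o \<Rightarrow> 'a set"
  Idn :: "'o \<Rightarrow> 'a"
  Cmp :: "'o \<Rightarrow> 'o \<Rightarrow> 'o \<Rightarrow> 'a \<Rightarrow> 'a \<Rightarrow> 'a"

locale category =
  fixes \<C> :: "('o, 'a) cat"
  assumes Idn_in: "X \<in> Obj \<C> \<Longrightarrow> Idn \<C> X \<in> Hom \<C> X X"
    and Cmp_in: "\<lbrakk>X \<in> Obj \<C>; Y \<in> Obj \<C>; Z \<in> Obj \<C>; f \<in> Hom \<C> X Y; g \<in> Hom \<C> Y Z\<rbrakk>
      \<Longrightarrow> Cmp \<C> X Y Z g f \<in> Hom \<C> X Z"
    and Cmp_Idn_right: "\<lbrakk>X \<in> Obj \<C>; Y \<in> Obj \<C>; f \<in> Hom \<C> X Y\<rbrakk>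
      \<Longrightarrow> Cmp \<C> X X Y f (Idn \<C> X) = f"
    and Cmp_Idn_left: "\<lbrakk>X \<in> Obj \<C>; Y \<in> Obj \<C>; f \<in> Hom \<C> X Y\<rbrakk>
      \<Longrightarrow> Cmp \<C> X Y Y (Idn \<C> Y) f = f"
    and Cmp_assoc: "\<lbrakk>W \<in> Obj \<C>; X \<in> Obj \<C>; Y \<in> Obj \<C>; Z \<in> Obj \<C>;
        f \<in> Hom \<C> W X; g \<in> Hom \<C> X Y; h \<in> Hom \<C> Y Z\<rbrakk>
      \<Longrightarrow> Cmp \<C> W Y Z h (Cmp \<C> W X Y g f) = Cmp \<C> W X Z (Cmp \<C> X Y Z h g) f"

record ('o1, 'a1, 'o2, 'a2) functr =
  omap :: "'o1 \<Rightarrow> 'o2"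
  amap :: "'o1 \<Rightarrow> 'o1 \<Rightarrow> 'a1 \<Rightarrow> 'a2"

locale is_functor = source: category \<C> + target: category \<D>
  for \<C> :: "('o1, 'a1) cat" and \<D> :: "('o2, 'a2) cat" +
  fixes F :: "('o1, 'a1, 'o2, 'a2) functr"
  assumes omap_in: "X \<in> Obj \<C> \<Longrightarrow> omap F X \<in> Obj \<D>"
    and amap_in: "\<lbrakk>X \<in> Obj \<C>; Y \<in> Obj \<C>; f \<in> Hom \<C> X Y\<rbrakk>
      \<Longrightarrow> amap F X Y f \<in> Hom \<D> (omap F X) (omap F Y)"
    and amap_Idn: "X \<in> Obj \<C> \<Longrightarrow> amap F X X (Idn \<C> X) = Idn \<D> (omap F X)"
    and amap_Cmp: "\<lbrakk>X \<in> Obj \<C>; Y \<in> Obj \<C>; Z \<in> Obj \<C>; f \<in> Hom \<C> X Y; g \<in> Hom \<C> Y Z\<rbrakk>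
      \<Longrightarrow> amap F X Z (Cmp \<C> X Y Z g f)
        = Cmp \<D> (omap F X) (omap F Y) (omap F Z) (amap F Y Z g) (amap F X Y f)"

text \<open>\<open>F : \<C> \<rightarrow> \<D>\<close> is left adjoint to \<open>G : \<D> \<rightarrow> \<C>\<close>.\<close>

definition adjoint_pair ::
  "('o1, 'a1) cat \<Rightarrow> ('o2, 'a2) cat \<Rightarrow> ('o1, 'a1, 'o2, 'a2) functr \<Rightarrow> ('o2, 'a2, 'o1, 'a1) functr \<Rightarrow> bool"
where
  "adjoint_pair \<C> \<D> F G \<longleftrightarrow> is_functor \<C> \<D> F \<and> is_functor \<D> \<C> G \<and>
    (\<exists>\<phi>. (\<forall>X\<in>Obj \<C>. \<forall>Y\<in>Obj \<D>. bij_betw (\<phi> X Y) (Hom \<D> (omap F X) Y) (Hom \<C> X (omap G Y))) \<and>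
      (\<forall>X\<in>Obj \<C>. \<forall>X'\<in>Obj \<C>. \<forall>Y\<in>Obj \<D>. \<forall>Y'\<in>Obj \<D>.
        \<forall>f\<in>Hom \<C> X' X. \<forall>g\<in>Hom \<D> Y Y'. \<forall>h\<in>Hom \<D> (omap F X) Y.
          \<phi> X' Y' (Cmp \<D> (omap F X') Y Y' g (Cmp \<D> (omap F X') (omap F X) Y h (amap F X' X f)))
          = Cmp \<C> X' (omap G Y) (omap G Y') (amap G Y Y' g)
              (Cmp \<C> X' X (omap G Y) (\<phi> X Y h) f)))"

definition frobenius_pair ::
  "('o1, 'a1) cat \<Rightarrow> ('o2, 'a2) cat \<Rightarrow> ('o1, 'a1, 'o2, 'a2) functr \<Rightarrow> ('o2, 'a2, 'o1, 'a1) functr \<Rightarrow> bool"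
where
  "frobenius_pair \<C> \<D> F G \<longleftrightarrow> adjoint_pair \<C> \<D> F G \<and> adjoint_pair \<D> \<C> G F"

section \<open>Modules and bimodules over a noncommutative ring\<close>

text \<open>
  As for \<open>free_Abelian_group\<close> and \<open>sum_group\<close>, the additive group of a module is a
  \<open>comm_group\<close> written multiplicatively: \<open>\<otimes>\<^bsub>M\<^esub>\<close> is the addition and \<open>\<one>\<^bsub>M\<^esub>\<close> the zero of \<open>M\<close>.
\<close>

record ('r, 'm) rmod = "'m monoid" +
  ract :: "'m \<Rightarrow> 'r \<Rightarrow> 'm"  (infixl \<open>\<triangleleft>\<index>\<close> 75)

record ('r, 'm) bimod = "('r, 'm) rmod" +
  lact :: "'r \<Rightarrow> 'm \<Rightarrow> 'm"  (infixr \<open>\<triangleright>\<index>\<close> 75)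

locale right_module = ring A + module: comm_group M
  for A :: "('r, 's) ring_scheme" and M :: "('r, 'm, 'z) rmod_scheme" +
  assumes ract_closed: "\<lbrakk>x \<in> carrier M; r \<in> carrier A\<rbrakk> \<Longrightarrow> x \<triangleleft>\<^bsub>M\<^esub> r \<in> carrier M"
    and ract_add_left: "\<lbrakk>x \<in> carrier M; y \<in> carrier M; r \<in> carrier A\<rbrakk>
      \<Longrightarrow> (x \<otimes>\<^bsub>M\<^esub> y) \<triangleleft>\<^bsub>M\<^esub> r = (x \<triangleleft>\<^bsub>M\<^esub> r) \<otimes>\<^bsub>M\<^esub> (y \<triangleleft>\<^bsub>M\<^esub> r)"
    and ract_add_right: "\<lbrakk>x \<in> carrier M; r \<in> carrier A; s \<in> carrier A\<rbrakk>
      \<Longrightarrow> x \<triangleleft>\<^bsub>M\<^esub> (r \<oplus>\<^bsub>A\<^esub> s) = (x \<triangleleft>\<^bsub>M\<^esub> r) \<otimes>\<^bsub>M\<^esub> (x \<triangleleft>\<^bsub>M\<^esub> s)"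
    and ract_mult: "\<lbrakk>x \<in> carrier M; r \<in> carrier A; s \<in> carrier A\<rbrakk>
      \<Longrightarrow> x \<triangleleft>\<^bsub>M\<^esub> (r \<otimes>\<^bsub>A\<^esub> s) = (x \<triangleleft>\<^bsub>M\<^esub> r) \<triangleleft>\<^bsub>M\<^esub> s"
    and ract_one: "x \<in> carrier M \<Longrightarrow> x \<triangleleft>\<^bsub>M\<^esub> \<one>\<^bsub>A\<^esub> = x"

locale bimodule = right_module A M
  for A :: "('r, 's) ring_scheme" and M :: "('r, 'm, 'z) bimod_scheme" +
  assumes lact_closed: "\<lbrakk>r \<in> carrier A; x \<in> carrier M\<rbrakk> \<Longrightarrow> r \<triangleright>\<^bsub>M\<^esub> x \<in> carrier M"
    and lact_add_right: "\<lbrakk>r \<in> carrier A; x \<in> carrier M; y \<in> carrier M\<rbrakk>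
      \<Longrightarrow> r \<triangleright>\<^bsub>M\<^esub> (x \<otimes>\<^bsub>M\<^esub> y) = (r \<triangleright>\<^bsub>M\<^esub> x) \<otimes>\<^bsub>M\<^esub> (r \<triangleright>\<^bsub>M\<^esub> y)"
    and lact_add_left: "\<lbrakk>r \<in> carrier A; s \<in> carrier A; x \<in> carrier M\<rbrakk>
      \<Longrightarrow> (r \<oplus>\<^bsub>A\<^esub> s) \<triangleright>\<^bsub>M\<^esub> x = (r \<triangleright>\<^bsub>M\<^esub> x) \<otimes>\<^bsub>M\<^esub> (s \<triangleright>\<^bsub>M\<^esub> x)"
    and lact_mult: "\<lbrakk>r \<in> carrier A; s \<in> carrier A; x \<in> carrier M\<rbrakk>
      \<Longrightarrow> (r \<otimes>\<^bsub>A\<^esub> s) \<triangleright>\<^bsub>M\<^esub> x = r \<triangleright>\<^bsub>M\<^esub> (s \<triangleright>\<^bsub>M\<^esub> x)"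
    and lact_one: "x \<in> carrier M \<Longrightarrow> \<one>\<^bsub>A\<^esub> \<triangleright>\<^bsub>M\<^esub> x = x"
    and lact_ract: "\<lbrakk>r \<in> carrier A; x \<in> carrier M; s \<in> carrier A\<rbrakk>
      \<Longrightarrow> (r \<triangleright>\<^bsub>M\<^esub> x) \<triangleleft>\<^bsub>M\<^esub> s = r \<triangleright>\<^bsub>M\<^esub> (x \<triangleleft>\<^bsub>M\<^esub> s)"

definition ring_bimod :: "('r, 's) ring_scheme \<Rightarrow> ('r, 'r) bimod" where
  "ring_bimod A = \<lparr>carrier = carrier A, monoid.mult = (\<oplus>\<^bsub>A\<^esub>), one = \<zero>\<^bsub>A\<^esub>,
     ract = (\<otimes>\<^bsub>A\<^esub>), lact = (\<otimes>\<^bsub>A\<^esub>)\<rparr>"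

definition rlinear ::
  "('r, 's) ring_scheme \<Rightarrow> ('r, 'm, 'y) rmod_scheme \<Rightarrow> ('r, 'n, 'z) rmod_scheme \<Rightarrow> ('m \<Rightarrow> 'n) \<Rightarrow> bool"
where
  "rlinear A M N f \<longleftrightarrow> f \<in> hom M N \<and>
     (\<forall>x\<in>carrier M. \<forall>r\<in>carrier A. f (x \<triangleleft>\<^bsub>M\<^esub> r) = f x \<triangleleft>\<^bsub>N\<^esub> r)"

definition bilinear ::
  "('r, 's) ring_scheme \<Rightarrow> ('r, 'm, 'y) bimod_scheme \<Rightarrow> ('r, 'n, 'z) bimod_scheme \<Rightarrow> ('m \<Rightarrow> 'n) \<Rightarrow> bool"
where
  "bilinear A M N f \<longleftrightarrow> rlinear A M N f \<and>
     (\<forall>x\<in>carrier M. \<forall>r\<in>carrier A. f (r \<triangleright>\<^bsub>M\<^esub> x) = r \<triangleright>\<^bsub>N\<^esub> f x)"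

section \<open>Tensor products\<close>

text \<open>
  \<open>M \<otimes>\<^sub>A N\<close> is the free abelian group on \<open>carrier M \<times> carrier N\<close> modulo the subgroup generated
  by the usual relations, so that its elements are cosets.
\<close>

type_synonym ('m, 'n) tens = "(('m \<times> 'n) \<Rightarrow>\<^sub>0 int) set"

definition tensor_relators ::
  "('r, 's) ring_scheme \<Rightarrow> ('r, 'm, 'y) rmod_scheme \<Rightarrow> ('r, 'n, 'z) bimod_scheme \<Rightarrow> (('m \<times> 'n) \<Rightarrow>\<^sub>0 int) set"
where
  "tensor_relators A M N =
     {frag_of (x \<otimes>\<^bsub>M\<^esub> x', y) - frag_of (x, y) - frag_of (x', y) | x x' y.
        x \<in> carrier M \<and> x' \<in> carrier M \<and> y \<in> carrier N}
   \<union> {frag_of (x, y \<otimes>\<^bsub>N\<^esub> y') - frag_of (x, y) - frag_of (x, y') | x y y'.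
        x \<in> carrier M \<and> y \<in> carrier N \<and> y' \<in> carrier N}
   \<union> {frag_of (x \<triangleleft>\<^bsub>M\<^esub> r, y) - frag_of (x, r \<triangleright>\<^bsub>N\<^esub> y) | x r y.
        x \<in> carrier M \<and> r \<in> carrier A \<and> y \<in> carrier N}"

definition tensor_kernel ::
  "('r, 's) ring_scheme \<Rightarrow> ('r, 'm, 'y) rmod_scheme \<Rightarrow> ('r, 'n, 'z) bimod_scheme \<Rightarrow> (('m \<times> 'n) \<Rightarrow>\<^sub>0 int) set"
where
  "tensor_kernel A M N =
     generate (free_Abelian_group (carrier M \<times> carrier N)) (tensor_relators A M N)"

definition tensor_group ::
  "('r, 's) ring_scheme \<Rightarrow> ('r, 'm, 'y) rmod_scheme \<Rightarrow> ('r, 'n, 'z) bimod_scheme \<Rightarrow> ('m, 'n) tens monoid"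
where
  "tensor_group A M N = free_Abelian_group (carrier M \<times> carrier N) Mod tensor_kernel A M N"

definition pure ::
  "('r, 's) ring_scheme \<Rightarrow> ('r, 'm, 'y) rmod_scheme \<Rightarrow> ('r, 'n, 'z) bimod_scheme \<Rightarrow> 'm \<Rightarrow> 'n \<Rightarrow> ('m, 'n) tens"
where
  "pure A M N x y =
     tensor_kernel A M N #>\<^bsub>free_Abelian_group (carrier M \<times> carrier N)\<^esub> frag_of (x, y)"

text \<open>
  The homomorphism \<open>M \<otimes>\<^sub>A N \<rightarrow> H\<close> induced by a biadditive and \<open>A\<close>-balanced map \<open>b\<close>. Any
  representative \<open>c\<close> of the coset \<open>t\<close> gives the same value \<open>\<Sum>\<^sub>(\<^sub>x\<^sub>,\<^sub>y\<^sub>) c(x,y) \<cdot> b x y\<close>.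
\<close>

definition tensor_lift :: "('h, 'z) monoid_scheme \<Rightarrow> ('m \<Rightarrow> 'n \<Rightarrow> 'h) \<Rightarrow> ('m, 'n) tens \<Rightarrow> 'h" where
  "tensor_lift H b t = the_elem
     ((\<lambda>c. \<Otimes>\<^bsub>H\<^esub>p\<in>Poly_Mapping.keys c. b (fst p) (snd p) [^]\<^bsub>H\<^esub> Poly_Mapping.lookup c p) ` t)"

definition rtensor ::
  "('r, 's) ring_scheme \<Rightarrow> ('r, 'm, 'y) rmod_scheme \<Rightarrow> ('r, 'n, 'z) bimod_scheme \<Rightarrow> ('r, ('m, 'n) tens) rmod"
where
  "rtensor A M N = (let T = tensor_group A M N in
     \<lparr>carrier = carrier T, monoid.mult = (\<otimes>\<^bsub>T\<^esub>), one = \<one>\<^bsub>T\<^esub>,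
      ract = (\<lambda>t r. tensor_lift T (\<lambda>x y. pure A M N x (y \<triangleleft>\<^bsub>N\<^esub> r)) t)\<rparr>)"

definition bitensor ::
  "('r, 's) ring_scheme \<Rightarrow> ('r, 'm, 'y) bimod_scheme \<Rightarrow> ('r, 'n, 'z) bimod_scheme \<Rightarrow> ('r, ('m, 'n) tens) bimod"
where
  "bitensor A M N = rmod.extend (rtensor A M N)
     (bimod.fields (\<lambda>r t. tensor_lift (tensor_group A M N) (\<lambda>x y. pure A M N (r \<triangleright>\<^bsub>M\<^esub> x) y) t))"

text \<open>The map \<open>f \<otimes>\<^sub>A g\<close> with target \<open>M' \<otimes>\<^sub>A N'\<close>.\<close>

definition tensor_map ::
  "('r, 's) ring_scheme \<Rightarrow> ('r, 'm2, 'y) rmod_scheme \<Rightarrow> ('r, 'n2, 'z) bimod_scheme \<Rightarrow>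
   ('m1 \<Rightarrow> 'm2) \<Rightarrow> ('n1 \<Rightarrow> 'n2) \<Rightarrow> ('m1, 'n1) tens \<Rightarrow> ('m2, 'n2) tens"
where
  "tensor_map A M' N' f g =
     tensor_lift (tensor_group A M' N') (\<lambda>x y. pure A M' N' (f x) (g y))"

text \<open>The canonical isomorphisms \<open>(M \<otimes> N) \<otimes> P \<cong> M \<otimes> (N \<otimes> P)\<close>, \<open>M \<otimes> A \<cong> M\<close> and \<open>A \<otimes> N \<cong> N\<close>.\<close>

definition tensor_assoc ::
  "('r, 's) ring_scheme \<Rightarrow> ('r, 'm, 'x) rmod_scheme \<Rightarrow> ('r, 'n, 'y) bimod_scheme \<Rightarrow> ('r, 'p, 'z) bimod_scheme \<Rightarrow>
   (('m, 'n) tens, 'p) tens \<Rightarrow> ('m, ('n, 'p) tens) tens"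
where
  "tensor_assoc A M N P =
     (let T = tensor_group A M (bitensor A N P) in
      tensor_lift T (\<lambda>t z. tensor_lift T (\<lambda>x y. pure A M (bitensor A N P) x (pure A N P y z)) t))"

definition right_unitor :: "('r, 'm, 'z) rmod_scheme \<Rightarrow> ('m, 'r) tens \<Rightarrow> 'm" where
  "right_unitor M = tensor_lift M (\<lambda>x r. x \<triangleleft>\<^bsub>M\<^esub> r)"

definition left_unitor :: "('r, 'n, 'z) bimod_scheme \<Rightarrow> ('r, 'n) tens \<Rightarrow> 'n" where
  "left_unitor N = tensor_lift N (\<lambda>r y. r \<triangleright>\<^bsub>N\<^esub> y)"

section \<open>Group corings\<close>

record ('g, 'r, 'c) coring_data =
  part :: "'g \<Rightarrow> ('r, 'c) bimod"
  comult :: "'g \<Rightarrow> 'g \<Rightarrow> 'c \<Rightarrow> ('c, 'c) tens"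
  counit :: "'c \<Rightarrow> 'r"

locale group_coring = group G + base: ring A
  for G :: "('g, 'gz) monoid_scheme" and A :: "('r, 's) ring_scheme" +
  fixes C :: "('g, 'r, 'c) coring_data"
  assumes part_bimodule: "\<alpha> \<in> carrier G \<Longrightarrow> bimodule A (part C \<alpha>)"
    and comult_bilinear: "\<lbrakk>\<alpha> \<in> carrier G; \<beta> \<in> carrier G\<rbrakk> \<Longrightarrow>
      bilinear A (part C (\<alpha> \<otimes>\<^bsub>G\<^esub> \<beta>)) (bitensor A (part C \<alpha>) (part C \<beta>)) (comult C \<alpha> \<beta>)"
    and counit_bilinear: "bilinear A (part C \<one>\<^bsub>G\<^esub>) (ring_bimod A) (counit C)"
    and coassoc: "\<lbrakk>\<alpha> \<in> carrier G; \<beta> \<in> carrier G; \<gamma> \<in> carrier G;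
        c \<in> carrier (part C (\<alpha> \<otimes>\<^bsub>G\<^esub> \<beta> \<otimes>\<^bsub>G\<^esub> \<gamma>))\<rbrakk> \<Longrightarrow>
      tensor_assoc A (part C \<alpha>) (part C \<beta>) (part C \<gamma>)
        (tensor_map A (bitensor A (part C \<alpha>) (part C \<beta>)) (part C \<gamma>) (comult C \<alpha> \<beta>) (\<lambda>d. d)
          (comult C (\<alpha> \<otimes>\<^bsub>G\<^esub> \<beta>) \<gamma> c))
      = tensor_map A (part C \<alpha>) (bitensor A (part C \<beta>) (part C \<gamma>)) (\<lambda>d. d) (comult C \<beta> \<gamma>)
          (comult C \<alpha> (\<beta> \<otimes>\<^bsub>G\<^esub> \<gamma>) c)"
    and counit_right: "\<lbrakk>\<alpha> \<in> carrier G; c \<in> carrier (part C \<alpha>)\<rbrakk> \<Longrightarrow>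
      right_unitor (part C \<alpha>)
        (tensor_map A (part C \<alpha>) (ring_bimod A) (\<lambda>d. d) (counit C) (comult C \<alpha> \<one>\<^bsub>G\<^esub> c)) = c"
    and counit_left: "\<lbrakk>\<alpha> \<in> carrier G; c \<in> carrier (part C \<alpha>)\<rbrakk> \<Longrightarrow>
      left_unitor (part C \<alpha>)
        (tensor_map A (ring_bimod A) (part C \<alpha>) (counit C) (\<lambda>d. d) (comult C \<one>\<^bsub>G\<^esub> \<alpha> c)) = c"

section \<open>The category of right comodules\<close>

record ('g, 'r, 'c, 'm) comod_data =
  cmod :: "('r, 'm) rmod"
  coact :: "'g \<Rightarrow> 'm \<Rightarrow> ('m, 'c) tens"

locale right_comodule = group_coring G A C + right_module A "cmod M"
  for G :: "('g, 'gz) monoid_scheme" and A :: "('r, 's) ring_scheme"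
    and C :: "('g, 'r, 'c) coring_data" and M :: "('g, 'r, 'c, 'm) comod_data" +
  assumes coact_linear: "\<alpha> \<in> carrier G \<Longrightarrow>
      rlinear A (cmod M) (rtensor A (cmod M) (part C \<alpha>)) (coact M \<alpha>)"
    and coact_coassoc: "\<lbrakk>\<alpha> \<in> carrier G; \<beta> \<in> carrier G; m \<in> carrier (cmod M)\<rbrakk> \<Longrightarrow>
      tensor_map A (cmod M) (bitensor A (part C \<alpha>) (part C \<beta>)) (\<lambda>x. x) (comult C \<alpha> \<beta>)
        (coact M (\<alpha> \<otimes>\<^bsub>G\<^esub> \<beta>) m)
      = tensor_assoc A (cmod M) (part C \<alpha>) (part C \<beta>)
          (tensor_map A (rtensor A (cmod M) (part C \<alpha>)) (part C \<beta>) (coact M \<alpha>) (\<lambda>d. d)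
            (coact M \<beta> m))"
    and coact_counit: "m \<in> carrier (cmod M) \<Longrightarrow>
      right_unitor (cmod M)
        (tensor_map A (cmod M) (ring_bimod A) (\<lambda>x. x) (counit C) (coact M \<one>\<^bsub>G\<^esub> m)) = m"

text \<open>
  Morphisms are extensional functions (\<open>undefined\<close> outside the carrier), so that equality of
  functions is equality of morphisms.
\<close>

definition comodules ::
  "('g, 'gz) monoid_scheme \<Rightarrow> ('r, 's) ring_scheme \<Rightarrow> ('g, 'r, 'c) coring_data \<Rightarrow>
   (('g, 'r, 'c, 'm) comod_data, 'm \<Rightarrow> 'm) cat"
where
  "comodules G A C =
     \<lparr>Obj = {M. right_comodule G A C M},
      Hom = (\<lambda>M N. {f \<in> carrier (cmod M) \<rightarrow>\<^sub>E carrier (cmod N). rlinear A (cmod M) (cmod N) f \<and>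
        (\<forall>\<alpha>\<in>carrier G. \<forall>m\<in>carrier (cmod M).
          tensor_map A (cmod N) (part C \<alpha>) f (\<lambda>d. d) (coact M \<alpha> m) = coact N \<alpha> (f m))}),
      Idn = (\<lambda>M. \<lambda>m\<in>carrier (cmod M). m),
      Cmp = (\<lambda>M N P g f. compose (carrier (cmod M)) g f)\<rparr>"

section \<open>The category of graded right comodules\<close>

record ('g, 'r, 'c, 'm) gcomod_data =
  gmod :: "'g \<Rightarrow> ('r, 'm) rmod"
  gcoact :: "'g \<Rightarrow> 'g \<Rightarrow> 'm \<Rightarrow> ('m, 'c) tens"

locale right_gcomodule = group_coring G A C
  for G :: "('g, 'gz) monoid_scheme" and A :: "('r, 's) ring_scheme"
    and C :: "('g, 'r, 'c) coring_data" +
  fixes M :: "('g, 'r, 'c, 'm) gcomod_data"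
  assumes gmod_module: "\<alpha> \<in> carrier G \<Longrightarrow> right_module A (gmod M \<alpha>)"
    and gcoact_linear: "\<lbrakk>\<alpha> \<in> carrier G; \<beta> \<in> carrier G\<rbrakk> \<Longrightarrow>
      rlinear A (gmod M (\<alpha> \<otimes>\<^bsub>G\<^esub> \<beta>)) (rtensor A (gmod M \<alpha>) (part C \<beta>)) (gcoact M \<alpha> \<beta>)"
    and gcoact_coassoc: "\<lbrakk>\<alpha> \<in> carrier G; \<beta> \<in> carrier G; \<gamma> \<in> carrier G;
        m \<in> carrier (gmod M (\<alpha> \<otimes>\<^bsub>G\<^esub> \<beta> \<otimes>\<^bsub>G\<^esub> \<gamma>))\<rbrakk> \<Longrightarrow>
      tensor_map A (gmod M \<alpha>) (bitensor A (part C \<beta>) (part C \<gamma>)) (\<lambda>x. x) (comult C \<beta> \<gamma>)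
        (gcoact M \<alpha> (\<beta> \<otimes>\<^bsub>G\<^esub> \<gamma>) m)
      = tensor_assoc A (gmod M \<alpha>) (part C \<beta>) (part C \<gamma>)
          (tensor_map A (rtensor A (gmod M \<alpha>) (part C \<beta>)) (part C \<gamma>) (gcoact M \<alpha> \<beta>) (\<lambda>d. d)
            (gcoact M (\<alpha> \<otimes>\<^bsub>G\<^esub> \<beta>) \<gamma> m))"
    and gcoact_counit: "\<lbrakk>\<alpha> \<in> carrier G; m \<in> carrier (gmod M \<alpha>)\<rbrakk> \<Longrightarrow>
      right_unitor (gmod M \<alpha>)
        (tensor_map A (gmod M \<alpha>) (ring_bimod A) (\<lambda>x. x) (counit C) (gcoact M \<alpha> \<one>\<^bsub>G\<^esub> m)) = m"

definition gcomodules ::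
  "('g, 'gz) monoid_scheme \<Rightarrow> ('r, 's) ring_scheme \<Rightarrow> ('g, 'r, 'c) coring_data \<Rightarrow>
   (('g, 'r, 'c, 'm) gcomod_data, 'g \<Rightarrow> 'm \<Rightarrow> 'm) cat"
where
  "gcomodules G A C =
     \<lparr>Obj = {M. right_gcomodule G A C M},
      Hom = (\<lambda>M N. {f \<in> (\<Pi>\<^sub>E \<alpha>\<in>carrier G. carrier (gmod M \<alpha>) \<rightarrow>\<^sub>E carrier (gmod N \<alpha>)).
        (\<forall>\<alpha>\<in>carrier G. rlinear A (gmod M \<alpha>) (gmod N \<alpha>) (f \<alpha>)) \<and>
        (\<forall>\<alpha>\<in>carrier G. \<forall>\<beta>\<in>carrier G. \<forall>m\<in>carrier (gmod M (\<alpha> \<otimes>\<^bsub>G\<^esub> \<beta>)).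
          tensor_map A (gmod N \<alpha>) (part C \<beta>) (f \<alpha>) (\<lambda>d. d) (gcoact M \<alpha> \<beta> m)
          = gcoact N \<alpha> \<beta> (f (\<alpha> \<otimes>\<^bsub>G\<^esub> \<beta>) m))}),
      Idn = (\<lambda>M. \<lambda>\<alpha>\<in>carrier G. \<lambda>m\<in>carrier (gmod M \<alpha>). m),
      Cmp = (\<lambda>M N P g f. \<lambda>\<alpha>\<in>carrier G. compose (carrier (gmod M \<alpha>)) (g \<alpha>) (f \<alpha>))\<rparr>"

section \<open>The two functors\<close>

text \<open>
  A universe for the underlying sets of comodules: it contains an arbitrary type \<open>'v\<close> and is
  closed under families indexed by the type of \<open>G\<close> (the elements of direct sums) and under
  indexed copies \<open>\<mu>\<^sub>\<alpha>\<close>. Hence direct sums and copies of modules carried by subsets of the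
  universe are again of this kind, and every set of modules is isomorphic to a set of such
  modules, for a suitable \<open>'v\<close>.
\<close>

datatype ('g, 'v) univ = Atom 'v | Mu 'g "('g, 'v) univ" | Fam (unFam: "'g \<Rightarrow> ('g, 'v) univ")

text \<open>Transport of a module structure along a map that is injective on its carrier.\<close>

definition image_mod :: "('m \<Rightarrow> 'n) \<Rightarrow> ('r, 'm) rmod \<Rightarrow> ('r, 'n) rmod" where
  "image_mod h M = (let k = inv_into (carrier M) h in
     \<lparr>carrier = h ` carrier M, monoid.mult = (\<lambda>x y. h (k x \<otimes>\<^bsub>M\<^esub> k y)), one = h \<one>\<^bsub>M\<^esub>,
      ract = (\<lambda>x r. h (k x \<triangleleft>\<^bsub>M\<^esub> r))\<rparr>)"

definition direct_sum :: "'g set \<Rightarrow> ('g \<Rightarrow> ('r, 'm) rmod) \<Rightarrow> ('r, 'g \<Rightarrow> 'm) rmod" where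
  "direct_sum I M = monoid.extend (sum_group I M)
     (rmod.fields (\<lambda>x r. \<lambda>\<beta>\<in>I. x \<beta> \<triangleleft>\<^bsub>M \<beta>\<^esub> r))"

definition sum_mod :: "'g set \<Rightarrow> ('g \<Rightarrow> ('r, ('g, 'v) univ) rmod) \<Rightarrow> ('r, ('g, 'v) univ) rmod" where
  "sum_mod I M = image_mod Fam (direct_sum I M)"

definition sum_incl ::
  "'g set \<Rightarrow> ('g \<Rightarrow> ('r, ('g, 'v) univ) rmod) \<Rightarrow> 'g \<Rightarrow> ('g, 'v) univ \<Rightarrow> ('g, 'v) univ"
where
  "sum_incl I M \<gamma> m = Fam (\<lambda>\<beta>\<in>I. if \<beta> = \<gamma> then m else \<one>\<^bsub>M \<beta>\<^esub>)"

text \<open>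
  The coaction of \<open>F\<^sub>1(M)\<close> sums the maps
  \<open>\<rho>\<^sub>\<beta>\<^sub>\<alpha>\<^sub>-\<^sub>1\<^sub>,\<^sub>\<alpha> : M\<^sub>\<beta> \<rightarrow> M\<^sub>\<beta>\<^sub>\<alpha>\<^sub>-\<^sub>1 \<otimes> C\<^sub>\<alpha> \<rightarrow> F\<^sub>1(M) \<otimes> C\<^sub>\<alpha>\<close> over the support of the element.
  The restriction to the support matters: a \<open>finprod\<close> over an infinite set is trivial.
\<close>

definition F1_obj ::
  "('g, 'gz) monoid_scheme \<Rightarrow> ('r, 's) ring_scheme \<Rightarrow> ('g, 'r, 'c) coring_data \<Rightarrow>
   ('g, 'r, 'c, ('g, 'v) univ) gcomod_data \<Rightarrow> ('g, 'r, 'c, ('g, 'v) univ) comod_data"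
where
  "F1_obj G A C M = (let S = sum_mod (carrier G) (gmod M) in
     \<lparr>cmod = S,
      coact = (\<lambda>\<alpha> x. \<Otimes>\<^bsub>tensor_group A S (part C \<alpha>)\<^esub>\<beta>\<in>{\<beta> \<in> carrier G. unFam x \<beta> \<noteq> \<one>\<^bsub>gmod M \<beta>\<^esub>}.
        tensor_map A S (part C \<alpha>) (sum_incl (carrier G) (gmod M) (\<beta> \<otimes>\<^bsub>G\<^esub> inv\<^bsub>G\<^esub> \<alpha>)) (\<lambda>d. d)
          (gcoact M (\<beta> \<otimes>\<^bsub>G\<^esub> inv\<^bsub>G\<^esub> \<alpha>) \<alpha> (unFam x \<beta>)))\<rparr>)"

definition F1 ::
  "('g, 'gz) monoid_scheme \<Rightarrow> ('r, 's) ring_scheme \<Rightarrow> ('g, 'r, 'c) coring_data \<Rightarrow>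
   (('g, 'r, 'c, ('g, 'v) univ) gcomod_data, 'g \<Rightarrow> ('g, 'v) univ \<Rightarrow> ('g, 'v) univ,
    ('g, 'r, 'c, ('g, 'v) univ) comod_data, ('g, 'v) univ \<Rightarrow> ('g, 'v) univ) functr"
where
  "F1 G A C =
     \<lparr>omap = F1_obj G A C,
      amap = (\<lambda>M N f. \<lambda>x\<in>carrier (sum_mod (carrier G) (gmod M)).
        Fam (\<lambda>\<alpha>\<in>carrier G. f \<alpha> (unFam x \<alpha>)))\<rparr>"

definition G1_obj ::
  "('g, 'gz) monoid_scheme \<Rightarrow> ('r, 's) ring_scheme \<Rightarrow> ('g, 'r, 'c) coring_data \<Rightarrow>
   ('g, 'r, 'c, ('g, 'v) univ) comod_data \<Rightarrow> ('g, 'r, 'c, ('g, 'v) univ) gcomod_data"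
where
  "G1_obj G A C M =
     \<lparr>gmod = (\<lambda>\<alpha>. image_mod (Mu \<alpha>) (cmod M)),
      gcoact = (\<lambda>\<alpha> \<beta> x. tensor_map A (image_mod (Mu \<alpha>) (cmod M)) (part C \<beta>) (Mu \<alpha>) (\<lambda>d. d)
        (coact M \<beta> (inv_into (carrier (cmod M)) (Mu (\<alpha> \<otimes>\<^bsub>G\<^esub> \<beta>)) x)))\<rparr>"

definition G1 ::
  "('g, 'gz) monoid_scheme \<Rightarrow> ('r, 's) ring_scheme \<Rightarrow> ('g, 'r, 'c) coring_data \<Rightarrow>
   (('g, 'r, 'c, ('g, 'v) univ) comod_data, ('g, 'v) univ \<Rightarrow> ('g, 'v) univ,
    ('g, 'r, 'c, ('g, 'v) univ) gcomod_data, 'g \<Rightarrow> ('g, 'v) univ \<Rightarrow> ('g, 'v) univ) functr"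
where
  "G1 G A C =
     \<lparr>omap = G1_obj G A C,
      amap = (\<lambda>M N f. \<lambda>\<alpha>\<in>carrier G. \<lambda>x\<in>Mu \<alpha> ` carrier (cmod M).
        Mu \<alpha> (f (inv_into (carrier (cmod M)) (Mu \<alpha>) x)))\<rparr>"

end

theory Submission
  imports Defs
begin

text \<open>
  Write \<open>\<rho>\<close> for all coactions. A morphism of comodules, a morphism of graded comodules, a family
  \<open>k\<^sub>\<alpha> : M\<^sub>\<alpha> \<rightarrow> N\<close> and a family \<open>l\<^sub>\<alpha> : N \<rightarrow> M\<^sub>\<alpha>\<close> between a graded comodule \<open>M\<close> and a comodule \<open>N\<close> can
  be compatible with the coactions in one and the same sense: they consist of commutative squares
  \<open>(f\<^sub>1 \<otimes> C\<^sub>\<alpha>) \<circ> \<rho> = \<rho> \<circ> f\<^sub>0\<close>, called colinear here. Such squares can be pasted (\<open>colinear_comp\<close>), so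
  composites of the four kinds of maps are again compatible.

  The theorem compares both sides of each adjunction with families of this kind. Since \<open>G\<^sub>1(N)\<close> is \<open>N\<close>
  repeated in every degree, the isomorphisms \<open>\<mu>\<^sub>\<alpha>\<close> and their inverses form such families
  (\<open>Mu_family\<close>, \<open>unMu_family\<close>). Hence graded morphisms \<open>M \<rightarrow> G\<^sub>1(N)\<close> are the compatible families
  \<open>M\<^sub>\<alpha> \<rightarrow> N\<close>, and graded morphisms \<open>G\<^sub>1(N) \<rightarrow> M\<close> are the compatible families \<open>N \<rightarrow> M\<^sub>\<alpha>\<close>. On the other
  side, the inclusions \<open>M\<^sub>\<alpha> \<rightarrow> F\<^sub>1(M)\<close> are a compatible family (\<open>incl_family\<close>), and a homomorphism on a
  direct sum is determined by its restrictions to the summands; therefore comodule morphisms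
  \<open>F\<^sub>1(M) \<rightarrow> N\<close> are the compatible families \<open>M\<^sub>\<alpha> \<rightarrow> N\<close> as well (\<open>comod_map_from_F1I\<close>). This is the
  first adjunction.

  The projections \<open>F\<^sub>1(M) \<rightarrow> M\<^sub>\<alpha>\<close> are compatible for every group (\<open>proj_family\<close>). If \<open>G\<close> is finite,
  the direct sum is a product, and this remains so after tensoring with a bimodule: an element of
  \<open>F\<^sub>1(M) \<otimes> C\<^sub>\<alpha>\<close> is determined by its images in all \<open>M\<^sub>\<gamma> \<otimes> C\<^sub>\<alpha>\<close> (\<open>tensor_sum_eqI\<close>). Therefore comodule
  morphisms \<open>N \<rightarrow> F\<^sub>1(M)\<close> are the compatible families \<open>N \<rightarrow> M\<^sub>\<alpha>\<close> (\<open>comod_map_to_F1I\<close>), which is the second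
  adjunction.

  That \<open>F\<^sub>1(M)\<close> and \<open>G\<^sub>1(N)\<close> satisfy the axioms follows from the naturality of the associativity and
  unit isomorphisms: coassociativity and counitality at an element pass to its image under colinear
  squares (\<open>coassoc_transport\<close>, \<open>counit_transport\<close>). These are applied to the inclusions, whose images
  generate \<open>F\<^sub>1(M)\<close>, and to the bijections \<open>\<mu>\<^sub>\<alpha>\<close>. All identities between maps on tensor products are
  checked on pure tensors, which generate (\<open>tensor_hom_ext\<close>).
\<close>

section \<open>The universal property of the tensor product\<close>

definition balanced ::
  "('r, 's) ring_scheme \<Rightarrow> ('r, 'm, 'y) rmod_scheme \<Rightarrow> ('r, 'n, 'z) bimod_scheme \<Rightarrow>
   ('h, 'w) monoid_scheme \<Rightarrow> ('m \<Rightarrow> 'n \<Rightarrow> 'h) \<Rightarrow> bool"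
where
  "balanced A M N H b \<longleftrightarrow>
     (\<forall>x\<in>carrier M. \<forall>y\<in>carrier N. b x y \<in> carrier H) \<and>
     (\<forall>x\<in>carrier M. \<forall>x'\<in>carrier M. \<forall>y\<in>carrier N. b (x \<otimes>\<^bsub>M\<^esub> x') y = b x y \<otimes>\<^bsub>H\<^esub> b x' y) \<and>
     (\<forall>x\<in>carrier M. \<forall>y\<in>carrier N. \<forall>y'\<in>carrier N. b x (y \<otimes>\<^bsub>N\<^esub> y') = b x y \<otimes>\<^bsub>H\<^esub> b x y') \<and>
     (\<forall>x\<in>carrier M. \<forall>r\<in>carrier A. \<forall>y\<in>carrier N. b (x \<triangleleft>\<^bsub>M\<^esub> r) y = b x (r \<triangleright>\<^bsub>N\<^esub> y))"

lemma balancedI: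
  assumes "\<And>x y. \<lbrakk>x \<in> carrier M; y \<in> carrier N\<rbrakk> \<Longrightarrow> b x y \<in> carrier H"
    and "\<And>x x' y. \<lbrakk>x \<in> carrier M; x' \<in> carrier M; y \<in> carrier N\<rbrakk> \<Longrightarrow> b (x \<otimes>\<^bsub>M\<^esub> x') y = b x y \<otimes>\<^bsub>H\<^esub> b x' y"
    and "\<And>x y y'. \<lbrakk>x \<in> carrier M; y \<in> carrier N; y' \<in> carrier N\<rbrakk> \<Longrightarrow> b x (y \<otimes>\<^bsub>N\<^esub> y') = b x y \<otimes>\<^bsub>H\<^esub> b x y'"
    and "\<And>x r y. \<lbrakk>x \<in> carrier M; r \<in> carrier A; y \<in> carrier N\<rbrakk> \<Longrightarrow> b (x \<triangleleft>\<^bsub>M\<^esub> r) y = b x (r \<triangleright>\<^bsub>N\<^esub> y)"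
  shows "balanced A M N H b"
  using assms unfolding balanced_def by blast

lemma balanced_closed:
  "\<lbrakk>balanced A M N H b; x \<in> carrier M; y \<in> carrier N\<rbrakk> \<Longrightarrow> b x y \<in> carrier H"
  unfolding balanced_def by blast

lemma tensor_relators_subset:
  assumes "right_module A M" "bimodule A N"
  shows "tensor_relators A M N \<subseteq> carrier (free_Abelian_group (carrier M \<times> carrier N))"
proof -
  interpret M: right_module A M by fact
  interpret N: bimodule A N by fact
  show ?thesis
    unfolding tensor_relators_def
    by (auto simp: M.ract_closed N.lact_closed keys_frag_of
        dest!: subsetD [OF keys_diff])
qed

lemma tensor_kernel_subgroup:
  assumes "right_module A M" "bimodule A N"
  shows "subgroup (tensor_kernel A M N) (free_Abelian_group (carrier M \<times> carrier N))"
  unfolding tensor_kernel_def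
  by (rule group.generate_is_subgroup[OF group_free_Abelian_group tensor_relators_subset[OF assms]])

lemma tensor_kernel_normal:
  assumes "right_module A M" "bimodule A N"
  shows "tensor_kernel A M N \<lhd> free_Abelian_group (carrier M \<times> carrier N)"
  using tensor_kernel_subgroup[OF assms] comm_group.normal_iff_subgroup[OF abelian_free_Abelian_group]
  by blast

lemma tensor_group_comm_group:
  assumes "right_module A M" "bimodule A N"
  shows "comm_group (tensor_group A M N)"
  unfolding tensor_group_def
  by (rule comm_group.abelian_FactGroup[OF abelian_free_Abelian_group tensor_kernel_subgroup[OF assms]])

lemma tensor_group_group:
  assumes "right_module A M" "bimodule A N"
  shows "group (tensor_group A M N)"
  using tensor_group_comm_group[OF assms] by (simp add: comm_group_def)

text \<open>
  The extension of \<open>b\<close> from the free generators to the free abelian group; \<open>tensor_lift\<close> takes its value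
  at a representative of a coset.
\<close>

definition free_lift :: "('h, 'z) monoid_scheme \<Rightarrow> ('m \<Rightarrow> 'n \<Rightarrow> 'h) \<Rightarrow> (('m \<times> 'n) \<Rightarrow>\<^sub>0 int) \<Rightarrow> 'h" where
  "free_lift H b c =
     (\<Otimes>\<^bsub>H\<^esub>p\<in>Poly_Mapping.keys c. b (fst p) (snd p) [^]\<^bsub>H\<^esub> Poly_Mapping.lookup c p)"

text \<open>
  The sums over the supports of \<open>c\<close>, \<open>d\<close> and \<open>c + d\<close> may all be taken over the union of the
  supports of \<open>c\<close> and \<open>d\<close>, because absent generators contribute a zeroth power.
\<close>

lemma free_lift_hom:
  assumes "comm_group H" and b: "\<And>x y. \<lbrakk>x \<in> X; y \<in> Y\<rbrakk> \<Longrightarrow> b x y \<in> carrier H"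
  shows "free_lift H b \<in> hom (free_Abelian_group (X \<times> Y)) H"
proof (rule homI)
  interpret H: comm_group H by fact
  have cl: "b (fst p) (snd p) \<in> carrier H" if "p \<in> X \<times> Y" for p
    using that b by auto
  show "free_lift H b c \<in> carrier H" if "c \<in> carrier (free_Abelian_group (X \<times> Y))" for c
    unfolding free_lift_def
    by (rule H.finprod_closed) (use that cl in auto)
  show "free_lift H b (c \<otimes>\<^bsub>free_Abelian_group (X \<times> Y)\<^esub> d) = free_lift H b c \<otimes>\<^bsub>H\<^esub> free_lift H b d"
    if c: "c \<in> carrier (free_Abelian_group (X \<times> Y))" and d: "d \<in> carrier (free_Abelian_group (X \<times> Y))" for c d
  proof -
    let ?K = "Poly_Mapping.keys c \<union> Poly_Mapping.keys d"
    let ?f = "\<lambda>c p. b (fst p) (snd p) [^]\<^bsub>H\<^esub> Poly_Mapping.lookup c p"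
    have K: "?K \<subseteq> X \<times> Y"
      using c d by auto
    have *: "free_lift H b e = finprod H (?f e) ?K" if "Poly_Mapping.keys e \<subseteq> ?K" for e
      unfolding free_lift_def
      by (rule H.finprod_mono_neutral_cong_left)
        (use that K cl in \<open>auto simp: in_keys_iff\<close>)
    have "free_lift H b (c + d) = finprod H (\<lambda>p. ?f c p \<otimes>\<^bsub>H\<^esub> ?f d p) ?K"
      unfolding *[OF keys_add]
      by (rule H.finprod_cong') (use K cl in \<open>auto simp: lookup_add H.int_pow_mult\<close>)
    also have "\<dots> = finprod H (?f c) ?K \<otimes>\<^bsub>H\<^esub> finprod H (?f d) ?K"
      by (rule H.finprod_multf) (use K cl in auto)
    finally show ?thesis
      by (simp add: *)
  qed
qed

lemma free_lift_frag_of: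
  assumes "comm_group H" "b x y \<in> carrier H"
  shows "free_lift H b (frag_of (x, y)) = b x y"
proof -
  interpret H: comm_group H by fact
  show ?thesis
    using assms(2) by (simp add: free_lift_def keys_frag_of)
qed

lemma free_lift_kernel:
  assumes M: "right_module A M" and N: "bimodule A N" and H: "comm_group H"
    and b: "balanced A M N H b" and k: "k \<in> tensor_kernel A M N"
  shows "free_lift H b k = \<one>\<^bsub>H\<^esub>"
proof -
  let ?F = "free_Abelian_group (carrier M \<times> carrier N)"
  interpret M: right_module A M by fact
  interpret N: bimodule A N by fact
  interpret H: comm_group H by fact
  have hom: "free_lift H b \<in> hom ?F H"
    by (rule free_lift_hom[OF H balanced_closed[OF b]])
  interpret h: group_hom ?F H "free_lift H b"
    using hom by (simp add: group_hom_def group_hom_axioms_def H.is_group)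
  have diff: "free_lift H b (c - d) = free_lift H b c \<otimes>\<^bsub>H\<^esub> inv\<^bsub>H\<^esub> free_lift H b d"
    if "Poly_Mapping.keys c \<subseteq> carrier M \<times> carrier N" "Poly_Mapping.keys d \<subseteq> carrier M \<times> carrier N" for c d
    using h.hom_mult[of c "-d"] h.hom_inv[of d] that by simp
  have fr: "free_lift H b (frag_of (x, y)) = b x y" if "x \<in> carrier M" "y \<in> carrier N" for x y
    by (rule free_lift_frag_of[where b = b, OF H balanced_closed[OF b that]])
  have cl: "b x y \<in> carrier H" if "x \<in> carrier M" "y \<in> carrier N" for x y
    by (rule balanced_closed[OF b that])
  have cancel: "p \<otimes>\<^bsub>H\<^esub> q \<otimes>\<^bsub>H\<^esub> inv\<^bsub>H\<^esub> p \<otimes>\<^bsub>H\<^esub> inv\<^bsub>H\<^esub> q = \<one>\<^bsub>H\<^esub>" if "p \<in> carrier H" "q \<in> carrier H" for p q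
    using that by (metis H.inv_closed H.l_one H.m_assoc H.m_comm H.m_closed H.r_inv)
  have rel: "free_lift H b c = \<one>\<^bsub>H\<^esub>" if "c \<in> tensor_relators A M N" for c
    using that unfolding tensor_relators_def
  proof (elim UnE CollectE exE conjE)
    fix x x' y
    assume c: "c = frag_of (x \<otimes>\<^bsub>M\<^esub> x', y) - frag_of (x, y) - frag_of (x', y)"
      and in_carrier: "x \<in> carrier M" "x' \<in> carrier M" "y \<in> carrier N"
    have "Poly_Mapping.keys (frag_of (x \<otimes>\<^bsub>M\<^esub> x', y) - frag_of (x, y)) \<subseteq> carrier M \<times> carrier N"
      by (rule subset_trans[OF keys_diff]) (use in_carrier in \<open>auto simp: keys_frag_of\<close>)
    then show ?thesis
      using in_carrier b unfolding c
      by (simp add: diff fr keys_frag_of balanced_def cancel cl)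
  next
    fix x y y'
    assume c: "c = frag_of (x, y \<otimes>\<^bsub>N\<^esub> y') - frag_of (x, y) - frag_of (x, y')"
      and in_carrier: "x \<in> carrier M" "y \<in> carrier N" "y' \<in> carrier N"
    have "Poly_Mapping.keys (frag_of (x, y \<otimes>\<^bsub>N\<^esub> y') - frag_of (x, y)) \<subseteq> carrier M \<times> carrier N"
      by (rule subset_trans[OF keys_diff]) (use in_carrier in \<open>auto simp: keys_frag_of\<close>)
    then show ?thesis
      using in_carrier b unfolding c
      by (simp add: diff fr keys_frag_of balanced_def cancel cl)
  next
    fix x r y
    assume c: "c = frag_of (x \<triangleleft>\<^bsub>M\<^esub> r, y) - frag_of (x, r \<triangleright>\<^bsub>N\<^esub> y)"
      and in_carrier: "x \<in> carrier M" "r \<in> carrier A" "y \<in> carrier N"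
    then show ?thesis
      using b unfolding c
      by (simp add: diff fr keys_frag_of balanced_def M.ract_closed N.lact_closed cl)
  qed
  have sub: "tensor_relators A M N \<subseteq> carrier ?F"
    by (rule tensor_relators_subset[OF M N])
  from k show ?thesis
    unfolding tensor_kernel_def
  proof (induction rule: generate.induct)
    case one
    then show ?case by (metis h.hom_one)
  next
    case (incl c)
    then show ?case by (rule rel)
  next
    case (inv c)
    then show ?case
      using rel sub h.hom_inv[of c] by auto
  next
    case (eng c d)
    then show ?case
      using h.hom_mult[of c d] group.generate_in_carrier[OF group_free_Abelian_group sub]
      by (metis H.l_one H.one_closed)
  qed
qed

text \<open>
  A balanced map sends every relator to the neutral element, so its extension to the free group is
  constant on cosets, and the image in the definition of \<open>tensor_lift\<close> is a singleton.
\<close>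

lemma tensor_lift_coset:
  assumes M: "right_module A M" and N: "bimodule A N" and H: "comm_group H"
    and b: "balanced A M N H b" and c: "c \<in> carrier (free_Abelian_group (carrier M \<times> carrier N))"
  shows "tensor_lift H b (tensor_kernel A M N #>\<^bsub>free_Abelian_group (carrier M \<times> carrier N)\<^esub> c) = free_lift H b c"
proof -
  let ?F = "free_Abelian_group (carrier M \<times> carrier N)"
  interpret H: comm_group H by fact
  have hom: "free_lift H b \<in> hom ?F H"
    by (rule free_lift_hom[OF H balanced_closed[OF b]])
  have "free_lift H b (k \<otimes>\<^bsub>?F\<^esub> c) = free_lift H b c" if "k \<in> tensor_kernel A M N" for k
    using hom_mult[OF hom _ c, of k] that subgroup.mem_carrier[OF tensor_kernel_subgroup[OF M N] that]
      free_lift_kernel[OF M N H b that] hom_in_carrier[OF hom c] by simp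
  moreover have "tensor_kernel A M N \<noteq> {}"
    using subgroup.one_closed[OF tensor_kernel_subgroup[OF M N]] by blast
  ultimately have "free_lift H b ` (tensor_kernel A M N #>\<^bsub>?F\<^esub> c) = {free_lift H b c}"
    unfolding r_coset_def by (auto simp: image_UN)
  then show ?thesis
    by (simp add: tensor_lift_def free_lift_def[abs_def])
qed

lemma tensor_lift_hom:
  assumes M: "right_module A M" and N: "bimodule A N" and H: "comm_group H"
    and b: "balanced A M N H b"
  shows "tensor_lift H b \<in> hom (tensor_group A M N) H"
proof -
  let ?F = "free_Abelian_group (carrier M \<times> carrier N)"
  note lift = tensor_lift_coset[OF M N H b]
  have hom: "free_lift H b \<in> hom ?F H"
    by (rule free_lift_hom[OF H balanced_closed[OF b]])
  obtain g where g: "g \<in> hom (tensor_group A M N) H"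
    "\<And>c. c \<in> carrier ?F \<Longrightarrow> g (tensor_kernel A M N #>\<^bsub>?F\<^esub> c) = free_lift H b c"
    using FactGroup_universal[OF hom tensor_kernel_normal[OF M N]] lift
    unfolding tensor_group_def by metis
  have "g t = tensor_lift H b t" if "t \<in> carrier (tensor_group A M N)" for t
    using that unfolding tensor_group_def carrier_FactGroup by (auto simp: lift g(2))
  with g(1) show ?thesis
    using group.is_monoid[OF tensor_group_group[OF M N]]
    by (auto simp: hom_def Pi_iff monoid.m_closed)
qed

lemma pure_closed:
  assumes "x \<in> carrier M" "y \<in> carrier N"
  shows "pure A M N x y \<in> carrier (tensor_group A M N)"
  unfolding pure_def tensor_group_def carrier_FactGroup
  by (rule imageI) (use assms in \<open>simp add: keys_frag_of\<close>)

lemma tensor_lift_pure: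
  assumes M: "right_module A M" and N: "bimodule A N" and H: "comm_group H"
    and b: "balanced A M N H b" and xy: "x \<in> carrier M" "y \<in> carrier N"
  shows "tensor_lift H b (pure A M N x y) = b x y"
  unfolding pure_def
  using tensor_lift_coset[OF M N H b, of "frag_of (x, y)"] xy
    free_lift_frag_of[where b = b, OF H balanced_closed[OF b xy]]
  by (simp add: keys_frag_of)

text \<open>
  Pure tensors are the images of the free generators, hence generate. Nearly every identity below
  between maps on a tensor product is reduced to pure tensors by this rule.
\<close>

lemma tensor_hom_ext:
  assumes M: "right_module A M" and N: "bimodule A N" and H: "group H"
    and f: "f \<in> hom (tensor_group A M N) H" and g: "g \<in> hom (tensor_group A M N) H"
    and eq: "\<And>x y. \<lbrakk>x \<in> carrier M; y \<in> carrier N\<rbrakk> \<Longrightarrow> f (pure A M N x y) = g (pure A M N x y)"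
    and t: "t \<in> carrier (tensor_group A M N)"
  shows "f t = g t"
proof -
  let ?F = "free_Abelian_group (carrier M \<times> carrier N)"
  let ?q = "\<lambda>c. tensor_kernel A M N #>\<^bsub>?F\<^esub> c"
  have q: "?q \<in> hom ?F (tensor_group A M N)"
    unfolding tensor_group_def by (rule normal.r_coset_hom_Mod[OF tensor_kernel_normal[OF M N]])
  interpret f: group_hom ?F H "f \<circ> ?q"
    using hom_compose[OF q f] H by (simp add: group_hom_def group_hom_axioms_def)
  interpret g: group_hom ?F H "g \<circ> ?q"
    using hom_compose[OF q g] H by (simp add: group_hom_def group_hom_axioms_def)
  obtain c where c: "Poly_Mapping.keys c \<subseteq> carrier M \<times> carrier N" "t = ?q c"
    using t unfolding tensor_group_def carrier_FactGroup by auto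
  have "(f \<circ> ?q) c = (g \<circ> ?q) c"
    using c(1)
  proof (rule free_Abelian_group_induct)
    show "(f \<circ> ?q) 0 = (g \<circ> ?q) 0"
      by (metis f.hom_one g.hom_one one_free_Abelian_group)
    show "(f \<circ> ?q) (x - y) = (g \<circ> ?q) (x - y)"
      if "Poly_Mapping.keys x \<subseteq> carrier M \<times> carrier N" "Poly_Mapping.keys y \<subseteq> carrier M \<times> carrier N"
        "(f \<circ> ?q) x = (g \<circ> ?q) x" "(f \<circ> ?q) y = (g \<circ> ?q) y" for x y
    proof -
      have "x - y = x \<otimes>\<^bsub>?F\<^esub> inv\<^bsub>?F\<^esub> y"
        using that(2) by simp
      then show ?thesis
        using that f.hom_mult[of x "inv\<^bsub>?F\<^esub> y"] g.hom_mult[of x "inv\<^bsub>?F\<^esub> y"] f.hom_inv[of y] g.hom_inv[of y]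
        by (metis carrier_free_Abelian_group_iff f.G.inv_closed)
    qed
    show "(f \<circ> ?q) (frag_of p) = (g \<circ> ?q) (frag_of p)" if "p \<in> carrier M \<times> carrier N" for p
      using that eq by (auto simp: pure_def)
  qed
  then show ?thesis
    using c(2) by simp
qed

lemma pure_balanced:
  assumes M: "right_module A M" and N: "bimodule A N"
  shows "balanced A M N (tensor_group A M N) (pure A M N)"
proof -
  let ?F = "free_Abelian_group (carrier M \<times> carrier N)"
  let ?q = "\<lambda>c. tensor_kernel A M N #>\<^bsub>?F\<^esub> c"
  interpret M: right_module A M by fact
  interpret N: bimodule A N by fact
  interpret T: comm_group "tensor_group A M N"
    by (rule tensor_group_comm_group[OF M N])
  have q: "?q \<in> hom ?F (tensor_group A M N)"
    unfolding tensor_group_def by (rule normal.r_coset_hom_Mod[OF tensor_kernel_normal[OF M N]])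
  have rel: "?q c = ?q d" if "c - d \<in> tensor_relators A M N"
    "Poly_Mapping.keys c \<subseteq> carrier M \<times> carrier N" "Poly_Mapping.keys d \<subseteq> carrier M \<times> carrier N" for c d
  proof -
    have "c - d \<in> tensor_kernel A M N"
      unfolding tensor_kernel_def by (rule generate.incl[OF that(1)])
    then have "c \<in> ?q d"
      unfolding r_coset_def using that by (auto intro!: bexI[of _ "c - d"])
    then show ?thesis
      using group.repr_independence[OF group_free_Abelian_group _ _ tensor_kernel_subgroup[OF M N]] that
      by (metis carrier_free_Abelian_group_iff)
  qed
  have add: "?q (c + d) = ?q c \<otimes>\<^bsub>tensor_group A M N\<^esub> ?q d"
    if "Poly_Mapping.keys c \<subseteq> carrier M \<times> carrier N" "Poly_Mapping.keys d \<subseteq> carrier M \<times> carrier N" for c d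
    using hom_mult[OF q, of c d] that by simp
  have keys2: "Poly_Mapping.keys (frag_of p + frag_of q) \<subseteq> carrier M \<times> carrier N"
    if "p \<in> carrier M \<times> carrier N" "q \<in> carrier M \<times> carrier N" for p q
    using keys_add[of "frag_of p" "frag_of q"] that by (auto simp: keys_frag_of)
  show ?thesis
  proof (rule balancedI)
    show "pure A M N x y \<in> carrier (tensor_group A M N)" if "x \<in> carrier M" "y \<in> carrier N" for x y
      by (rule pure_closed[OF that])
  next
    fix x x' y assume "x \<in> carrier M" "x' \<in> carrier M" "y \<in> carrier N"
    moreover from this have "frag_of (x \<otimes>\<^bsub>M\<^esub> x', y) - (frag_of (x, y) + frag_of (x', y)) \<in> tensor_relators A M N"
      unfolding tensor_relators_def diff_diff_eq[symmetric] by blast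
    ultimately show "pure A M N (x \<otimes>\<^bsub>M\<^esub> x') y = pure A M N x y \<otimes>\<^bsub>tensor_group A M N\<^esub> pure A M N x' y"
      using rel[of "frag_of (x \<otimes>\<^bsub>M\<^esub> x', y)" "frag_of (x, y) + frag_of (x', y)"]
        add[of "frag_of (x, y)" "frag_of (x', y)"] keys2[of "(x, y)" "(x', y)"]
      by (simp add: pure_def keys_frag_of)
  next
    fix x y y' assume "x \<in> carrier M" "y \<in> carrier N" "y' \<in> carrier N"
    moreover from this have "frag_of (x, y \<otimes>\<^bsub>N\<^esub> y') - (frag_of (x, y) + frag_of (x, y')) \<in> tensor_relators A M N"
      unfolding tensor_relators_def diff_diff_eq[symmetric] by blast
    ultimately show "pure A M N x (y \<otimes>\<^bsub>N\<^esub> y') = pure A M N x y \<otimes>\<^bsub>tensor_group A M N\<^esub> pure A M N x y'"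
      using rel[of "frag_of (x, y \<otimes>\<^bsub>N\<^esub> y')" "frag_of (x, y) + frag_of (x, y')"]
        add[of "frag_of (x, y)" "frag_of (x, y')"] keys2[of "(x, y)" "(x, y')"]
      by (simp add: pure_def keys_frag_of)
  next
    fix x r y assume "x \<in> carrier M" "r \<in> carrier A" "y \<in> carrier N"
    then show "pure A M N (x \<triangleleft>\<^bsub>M\<^esub> r) y = pure A M N x (r \<triangleright>\<^bsub>N\<^esub> y)"
      unfolding pure_def
      by (intro rel) (auto simp: keys_frag_of tensor_relators_def M.ract_closed N.lact_closed)
  qed
qed

section \<open>Tensor products as modules\<close>

text \<open>
  The tensor product as a right module and as a bimodule have the same underlying group
  \<open>tensor_group\<close>; carriers and operations are normalised to it, so that statements about groups apply to both.
\<close>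

lemma rtensor_simps [simp]:
  "carrier (rtensor A M N) = carrier (tensor_group A M N)"
  "monoid.mult (rtensor A M N) = monoid.mult (tensor_group A M N)"
  "one (rtensor A M N) = one (tensor_group A M N)"
  "ract (rtensor A M N) t r = tensor_lift (tensor_group A M N) (\<lambda>x y. pure A M N x (y \<triangleleft>\<^bsub>N\<^esub> r)) t"
  by (simp_all add: rtensor_def Let_def)

lemma bitensor_simps [simp]:
  "carrier (bitensor A M N) = carrier (tensor_group A M N)"
  "monoid.mult (bitensor A M N) = monoid.mult (tensor_group A M N)"
  "one (bitensor A M N) = one (tensor_group A M N)"
  "ract (bitensor A M N) t r = tensor_lift (tensor_group A M N) (\<lambda>x y. pure A M N x (y \<triangleleft>\<^bsub>N\<^esub> r)) t"
  "lact (bitensor A M N) r t = tensor_lift (tensor_group A M N) (\<lambda>x y. pure A M N (r \<triangleright>\<^bsub>M\<^esub> x) y) t"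
  by (simp_all add: bitensor_def rmod.defs bimod.defs)

lemma hom_rtensor_left [simp]: "hom (rtensor A M N) H = hom (tensor_group A M N) H"
  by (simp add: hom_def)

lemma hom_rtensor_right [simp]: "hom H (rtensor A M N) = hom H (tensor_group A M N)"
  by (simp add: hom_def)

lemma comm_group_cong:
  assumes "comm_group H" "carrier K = carrier H" "monoid.mult K = monoid.mult H" "one K = one H"
  shows "comm_group K"
proof -
  interpret H: comm_group H by fact
  show ?thesis
    by (rule comm_groupI) (use assms H.m_assoc H.m_comm H.l_inv_ex in auto)
qed

lemma hom_mult_hom:
  assumes "comm_group H" "f \<in> hom K H" "g \<in> hom K H"
  shows "(\<lambda>x. f x \<otimes>\<^bsub>H\<^esub> g x) \<in> hom K H"
proof -
  interpret H: comm_group H by fact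
  show ?thesis
    using assms(2,3) by (auto simp: hom_def Pi_iff H.m_ac)
qed

lemma hom_id: "(\<lambda>x. x) \<in> hom H H"
  by (simp add: hom_def)

lemma hom_comp: "\<lbrakk>f \<in> hom H K; g \<in> hom K L\<rbrakk> \<Longrightarrow> (\<lambda>x. g (f x)) \<in> hom H L"
  using hom_compose[of f H K g L] by (simp add: comp_def)

lemma balanced_hom_left:
  "\<lbrakk>balanced A M N H b; y \<in> carrier N\<rbrakk> \<Longrightarrow> (\<lambda>x. b x y) \<in> hom M H"
  by (simp add: balanced_def hom_def)

lemma pure_add_left:
  assumes "right_module A M" "bimodule A N" "x \<in> carrier M" "x' \<in> carrier M" "y \<in> carrier N"
  shows "pure A M N (x \<otimes>\<^bsub>M\<^esub> x') y = pure A M N x y \<otimes>\<^bsub>tensor_group A M N\<^esub> pure A M N x' y"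
  using pure_balanced[OF assms(1,2)] assms(3-) unfolding balanced_def by blast

lemma pure_add_right:
  assumes "right_module A M" "bimodule A N" "x \<in> carrier M" "y \<in> carrier N" "y' \<in> carrier N"
  shows "pure A M N x (y \<otimes>\<^bsub>N\<^esub> y') = pure A M N x y \<otimes>\<^bsub>tensor_group A M N\<^esub> pure A M N x y'"
  using pure_balanced[OF assms(1,2)] assms(3-) unfolding balanced_def by blast

lemma pure_middle:
  assumes "right_module A M" "bimodule A N" "x \<in> carrier M" "r \<in> carrier A" "y \<in> carrier N"
  shows "pure A M N (x \<triangleleft>\<^bsub>M\<^esub> r) y = pure A M N x (r \<triangleright>\<^bsub>N\<^esub> y)"
  using pure_balanced[OF assms(1,2)] assms(3-) unfolding balanced_def by blast

lemma bimodule_right_module: "bimodule A M \<Longrightarrow> right_module A M"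
  by (simp add: bimodule_def)

lemma balanced_ract:
  assumes M: "right_module A M" and N: "bimodule A N" and r: "r \<in> carrier A"
  shows "balanced A M N (tensor_group A M N) (\<lambda>x y. pure A M N x (y \<triangleleft>\<^bsub>N\<^esub> r))"
proof -
  interpret N: bimodule A N by fact
  show ?thesis
    by (rule balancedI)
      (use r in \<open>auto simp: N.ract_closed N.ract_add_left pure_closed pure_add_left[OF M N]
        pure_add_right[OF M N] N.lact_closed pure_middle[OF M N] N.lact_ract\<close>)
qed

lemma balanced_lact:
  assumes M: "bimodule A M" and N: "bimodule A N" and r: "r \<in> carrier A"
  shows "balanced A M N (tensor_group A M N) (\<lambda>x y. pure A M N (r \<triangleright>\<^bsub>M\<^esub> x) y)"
proof -
  interpret M: bimodule A M by fact
  note M' = bimodule_right_module[OF M]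
  show ?thesis
    by (rule balancedI)
      (use r in \<open>auto simp: M.lact_closed M.lact_add_right pure_closed pure_add_left[OF M' N]
        pure_add_right[OF M' N] pure_middle[OF M' N, symmetric] M.lact_ract\<close>)
qed

lemma pure_ract:
  assumes "right_module A M" "bimodule A N" "x \<in> carrier M" "y \<in> carrier N" "r \<in> carrier A"
  shows "pure A M N x y \<triangleleft>\<^bsub>rtensor A M N\<^esub> r = pure A M N x (y \<triangleleft>\<^bsub>N\<^esub> r)"
  using tensor_lift_pure[OF assms(1,2) tensor_group_comm_group[OF assms(1,2)] balanced_ract[OF assms(1,2,5)] assms(3,4)]
  by simp

lemma pure_lact:
  assumes "bimodule A M" "bimodule A N" "x \<in> carrier M" "y \<in> carrier N" "r \<in> carrier A"
  shows "r \<triangleright>\<^bsub>bitensor A M N\<^esub> pure A M N x y = pure A M N (r \<triangleright>\<^bsub>M\<^esub> x) y"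
  using tensor_lift_pure[OF bimodule_right_module[OF assms(1)] assms(2)
      tensor_group_comm_group[OF bimodule_right_module[OF assms(1)] assms(2)] balanced_lact[OF assms(1,2,5)] assms(3,4)]
  by simp

lemma rtensor_ract_hom:
  assumes "right_module A M" "bimodule A N" "r \<in> carrier A"
  shows "(\<lambda>t. t \<triangleleft>\<^bsub>rtensor A M N\<^esub> r) \<in> hom (tensor_group A M N) (tensor_group A M N)"
  using tensor_lift_hom[OF assms(1,2) tensor_group_comm_group[OF assms(1,2)] balanced_ract[OF assms]]
  by (simp add: hom_def Pi_iff)

lemma bitensor_lact_hom:
  assumes "bimodule A M" "bimodule A N" "r \<in> carrier A"
  shows "(\<lambda>t. r \<triangleright>\<^bsub>bitensor A M N\<^esub> t) \<in> hom (tensor_group A M N) (tensor_group A M N)"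
  using tensor_lift_hom[OF bimodule_right_module[OF assms(1)] assms(2)
      tensor_group_comm_group[OF bimodule_right_module[OF assms(1)] assms(2)] balanced_lact[OF assms]]
  by (simp add: hom_def Pi_iff)

lemma right_module_axiomsI:
  assumes "ring A" "comm_group M" "right_module_axioms A M"
  shows "right_module A M"
  using assms by (simp add: right_module_def)

text \<open>
  The action of a scalar is induced by a balanced map, hence additive. In the other axioms both
  sides are homomorphisms, and on pure tensors they are axioms of the right factor.
\<close>

lemma rtensor_right_module:
  assumes M: "right_module A M" and N: "bimodule A N"
  shows "right_module A (rtensor A M N)"
proof -
  let ?T = "tensor_group A M N"
  interpret N: bimodule A N by fact
  interpret T: comm_group ?T by (rule tensor_group_comm_group[OF M N])
  note hom = rtensor_ract_hom[OF M N]
  note ext = tensor_hom_ext[OF M N T.is_group]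
  note ract = pure_ract[OF M N]
  note simps = ract pure_add_right[OF M N] N.ract_closed pure_closed
  have closed: "t \<triangleleft>\<^bsub>rtensor A M N\<^esub> r \<in> carrier ?T" if "t \<in> carrier ?T" "r \<in> carrier A" for t r
    using hom_in_carrier[OF hom] that by simp
  show ?thesis
  proof (rule right_module_axiomsI[OF N.ring_axioms comm_group_cong[OF T.comm_group_axioms]])
    show "right_module_axioms A (rtensor A M N)"
    proof (unfold_locales, unfold rtensor_simps(1-3))
      show "t \<triangleleft>\<^bsub>rtensor A M N\<^esub> r \<in> carrier ?T" if "t \<in> carrier ?T" "r \<in> carrier A" for t r
        using closed that .
    next
      show "(s \<otimes>\<^bsub>?T\<^esub> t) \<triangleleft>\<^bsub>rtensor A M N\<^esub> r = (s \<triangleleft>\<^bsub>rtensor A M N\<^esub> r) \<otimes>\<^bsub>?T\<^esub> (t \<triangleleft>\<^bsub>rtensor A M N\<^esub> r)"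
        if "s \<in> carrier ?T" "t \<in> carrier ?T" "r \<in> carrier A" for s t r
        using hom_mult[OF hom[OF that(3)] that(1,2)] .
    next
      fix t r s assume t: "t \<in> carrier ?T" and r: "r \<in> carrier A" and s: "s \<in> carrier A"
      show "t \<triangleleft>\<^bsub>rtensor A M N\<^esub> (r \<oplus>\<^bsub>A\<^esub> s) = (t \<triangleleft>\<^bsub>rtensor A M N\<^esub> r) \<otimes>\<^bsub>?T\<^esub> (t \<triangleleft>\<^bsub>rtensor A M N\<^esub> s)"
        by (rule ext[OF hom hom_mult_hom[OF T.comm_group_axioms hom hom] _ t])
          (use r s in \<open>simp_all add: simps N.ract_add_right del: rtensor_simps(4)\<close>)
    next
      fix t r s assume t: "t \<in> carrier ?T" and r: "r \<in> carrier A" and s: "s \<in> carrier A"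
      show "t \<triangleleft>\<^bsub>rtensor A M N\<^esub> (r \<otimes>\<^bsub>A\<^esub> s) = (t \<triangleleft>\<^bsub>rtensor A M N\<^esub> r) \<triangleleft>\<^bsub>rtensor A M N\<^esub> s"
        by (rule ext[OF hom hom_comp[OF hom hom] _ t])
          (use r s in \<open>simp_all add: simps N.ract_mult del: rtensor_simps(4)\<close>)
    next
      fix t assume t: "t \<in> carrier ?T"
      show "t \<triangleleft>\<^bsub>rtensor A M N\<^esub> \<one>\<^bsub>A\<^esub> = t"
        by (rule ext[OF hom hom_id _ t])
          (simp_all add: simps N.ract_one del: rtensor_simps(4))
    qed
  qed simp_all
qed

lemma bitensor_right_module:
  assumes M: "right_module A M" and N: "bimodule A N"
  shows "right_module A (bitensor A M N)"
proof -
  interpret T: right_module A "rtensor A M N" by (rule rtensor_right_module[OF M N])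
  show ?thesis
    by (rule right_module_axiomsI[OF T.ring_axioms comm_group_cong[OF T.module.comm_group_axioms]])
      (use T.right_module_axioms in \<open>simp_all add: right_module_axioms_def right_module_def\<close>)
qed

text \<open>
  The scalars act from the left on the first factor and from the right on the second one, so the two
  actions commute already on pure tensors.
\<close>

lemma bitensor_bimodule:
  assumes M: "bimodule A M" and N: "bimodule A N"
  shows "bimodule A (bitensor A M N)"
proof -
  let ?T = "tensor_group A M N"
  note M' = bimodule_right_module[OF M]
  interpret M: bimodule A M by fact
  interpret N: bimodule A N by fact
  interpret T: comm_group ?T by (rule tensor_group_comm_group[OF M' N])
  note hom = bitensor_lact_hom[OF M N]
  have homr: "(\<lambda>t. t \<triangleleft>\<^bsub>bitensor A M N\<^esub> r) \<in> hom ?T ?T" if "r \<in> carrier A" for r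
    using rtensor_ract_hom[OF M' N that] by simp
  have ract: "pure A M N x y \<triangleleft>\<^bsub>bitensor A M N\<^esub> r = pure A M N x (y \<triangleleft>\<^bsub>N\<^esub> r)"
    if "x \<in> carrier M" "y \<in> carrier N" "r \<in> carrier A" for x y r
    using pure_ract[OF M' N that] by simp
  note ext = tensor_hom_ext[OF M' N T.is_group]
  note lact = pure_lact[OF M N]
  note simps = lact ract pure_add_left[OF M' N] M.lact_closed N.ract_closed pure_closed
  show ?thesis
  proof (rule bimodule.intro[OF bitensor_right_module[OF M' N]])
    show "bimodule_axioms A (bitensor A M N)"
    proof (unfold_locales, unfold bitensor_simps(1-3))
      show "r \<triangleright>\<^bsub>bitensor A M N\<^esub> t \<in> carrier ?T" if "r \<in> carrier A" "t \<in> carrier ?T" for t r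
        using hom_in_carrier[OF hom[OF that(1)] that(2)] .
    next
      show "r \<triangleright>\<^bsub>bitensor A M N\<^esub> (s \<otimes>\<^bsub>?T\<^esub> t) = (r \<triangleright>\<^bsub>bitensor A M N\<^esub> s) \<otimes>\<^bsub>?T\<^esub> (r \<triangleright>\<^bsub>bitensor A M N\<^esub> t)"
        if "r \<in> carrier A" "s \<in> carrier ?T" "t \<in> carrier ?T" for s t r
        using hom_mult[OF hom[OF that(1)] that(2,3)] .
    next
      fix t r s assume t: "t \<in> carrier ?T" and r: "r \<in> carrier A" and s: "s \<in> carrier A"
      show "(r \<oplus>\<^bsub>A\<^esub> s) \<triangleright>\<^bsub>bitensor A M N\<^esub> t = (r \<triangleright>\<^bsub>bitensor A M N\<^esub> t) \<otimes>\<^bsub>?T\<^esub> (s \<triangleright>\<^bsub>bitensor A M N\<^esub> t)"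
        by (rule ext[OF hom hom_mult_hom[OF T.comm_group_axioms hom hom] _ t])
          (use r s in \<open>simp_all add: simps M.lact_add_left del: bitensor_simps(4,5)\<close>)
      show "(r \<otimes>\<^bsub>A\<^esub> s) \<triangleright>\<^bsub>bitensor A M N\<^esub> t = r \<triangleright>\<^bsub>bitensor A M N\<^esub> (s \<triangleright>\<^bsub>bitensor A M N\<^esub> t)"
        by (rule ext[OF hom hom_comp[OF hom hom] _ t])
          (use r s in \<open>simp_all add: simps M.lact_mult del: bitensor_simps(4,5)\<close>)
    next
      fix t assume t: "t \<in> carrier ?T"
      show "\<one>\<^bsub>A\<^esub> \<triangleright>\<^bsub>bitensor A M N\<^esub> t = t"
        by (rule ext[OF hom hom_id _ t])
          (simp_all add: simps M.lact_one del: bitensor_simps(4,5))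
    next
      fix t r s assume r: "r \<in> carrier A" and t: "t \<in> carrier ?T" and s: "s \<in> carrier A"
      show "(r \<triangleright>\<^bsub>bitensor A M N\<^esub> t) \<triangleleft>\<^bsub>bitensor A M N\<^esub> s = r \<triangleright>\<^bsub>bitensor A M N\<^esub> (t \<triangleleft>\<^bsub>bitensor A M N\<^esub> s)"
        by (rule ext[OF hom_comp[OF hom homr] hom_comp[OF homr hom] _ t])
          (use r s in \<open>simp_all add: simps del: bitensor_simps(4,5)\<close>)
    qed
  qed
qed

lemma ring_bimod_bimodule:
  assumes "ring A"
  shows "bimodule A (ring_bimod A)"
proof -
  interpret A: ring A by fact
  have "comm_group (ring_bimod A)"
    by (rule comm_group_cong[OF A.a_comm_group]) (simp_all add: ring_bimod_def)
  then show ?thesis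
    by (simp add: bimodule_def right_module_def right_module_axioms_def bimodule_axioms_def assms)
      (simp add: ring_bimod_def A.l_distr A.r_distr A.m_assoc)
qed

section \<open>Linear maps and their tensor products\<close>

text \<open>
  \<open>rlinear\<close> and \<open>bilinear\<close> speak of the map only. These versions include the module axioms of source
  and target, since a map induced on tensor products is well defined only between modules.
\<close>

definition rmod_map ::
  "('r, 's) ring_scheme \<Rightarrow> ('r, 'm, 'y) rmod_scheme \<Rightarrow> ('r, 'n, 'z) rmod_scheme \<Rightarrow> ('m \<Rightarrow> 'n) \<Rightarrow> bool"
where
  "rmod_map A M N f \<longleftrightarrow> right_module A M \<and> right_module A N \<and> rlinear A M N f"

definition bimod_map ::
  "('r, 's) ring_scheme \<Rightarrow> ('r, 'm, 'y) bimod_scheme \<Rightarrow> ('r, 'n, 'z) bimod_scheme \<Rightarrow> ('m \<Rightarrow> 'n) \<Rightarrow> bool"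
where
  "bimod_map A M N f \<longleftrightarrow> bimodule A M \<and> bimodule A N \<and> bilinear A M N f"

lemma rmod_mapI:
  assumes "right_module A M" "right_module A N"
    and "\<And>x. x \<in> carrier M \<Longrightarrow> f x \<in> carrier N"
    and "\<And>x y. \<lbrakk>x \<in> carrier M; y \<in> carrier M\<rbrakk> \<Longrightarrow> f (x \<otimes>\<^bsub>M\<^esub> y) = f x \<otimes>\<^bsub>N\<^esub> f y"
    and "\<And>x r. \<lbrakk>x \<in> carrier M; r \<in> carrier A\<rbrakk> \<Longrightarrow> f (x \<triangleleft>\<^bsub>M\<^esub> r) = f x \<triangleleft>\<^bsub>N\<^esub> r"
  shows "rmod_map A M N f"
  using assms by (auto simp: rmod_map_def rlinear_def hom_def)

lemma rmod_mapD:
  assumes "rmod_map A M N f"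
  shows "right_module A M" "right_module A N" "rlinear A M N f" "f \<in> hom M N"
    "\<And>x. x \<in> carrier M \<Longrightarrow> f x \<in> carrier N"
    "\<And>x y. \<lbrakk>x \<in> carrier M; y \<in> carrier M\<rbrakk> \<Longrightarrow> f (x \<otimes>\<^bsub>M\<^esub> y) = f x \<otimes>\<^bsub>N\<^esub> f y"
    "\<And>x r. \<lbrakk>x \<in> carrier M; r \<in> carrier A\<rbrakk> \<Longrightarrow> f (x \<triangleleft>\<^bsub>M\<^esub> r) = f x \<triangleleft>\<^bsub>N\<^esub> r"
  using assms by (auto simp: rmod_map_def rlinear_def hom_def)

lemma bimod_mapD:
  assumes "bimod_map A M N f"
  shows "bimodule A M" "bimodule A N" "bilinear A M N f" "f \<in> hom M N"
    "\<And>x. x \<in> carrier M \<Longrightarrow> f x \<in> carrier N"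
    "\<And>x y. \<lbrakk>x \<in> carrier M; y \<in> carrier M\<rbrakk> \<Longrightarrow> f (x \<otimes>\<^bsub>M\<^esub> y) = f x \<otimes>\<^bsub>N\<^esub> f y"
    "\<And>x r. \<lbrakk>x \<in> carrier M; r \<in> carrier A\<rbrakk> \<Longrightarrow> f (x \<triangleleft>\<^bsub>M\<^esub> r) = f x \<triangleleft>\<^bsub>N\<^esub> r"
    "\<And>x r. \<lbrakk>x \<in> carrier M; r \<in> carrier A\<rbrakk> \<Longrightarrow> f (r \<triangleright>\<^bsub>M\<^esub> x) = r \<triangleright>\<^bsub>N\<^esub> f x"
  using assms by (auto simp: bimod_map_def bilinear_def rlinear_def hom_def)

lemma rmod_map_id: "right_module A M \<Longrightarrow> rmod_map A M M (\<lambda>x. x)"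
  by (simp add: rmod_map_def rlinear_def hom_def)

lemma bimod_map_id: "bimodule A M \<Longrightarrow> bimod_map A M M (\<lambda>x. x)"
  by (simp add: bimod_map_def bilinear_def rlinear_def hom_def)

lemma rmod_map_comp:
  assumes "rmod_map A M N f" "rmod_map A N P g"
  shows "rmod_map A M P (\<lambda>x. g (f x))"
  using assms by (auto simp: rmod_map_def rlinear_def hom_def Pi_iff)

lemma rmod_map_cong:
  assumes "rmod_map A M N f" "\<And>x. x \<in> carrier M \<Longrightarrow> g x = f x"
  shows "rmod_map A M N g"
proof -
  interpret right_module A M by (rule rmod_mapD(1)[OF assms(1)])
  show ?thesis
    by (rule rmod_mapI) (use rmod_mapD[OF assms(1)] assms(2) ract_closed in auto)
qed

lemma tensor_map_balanced:
  assumes f: "rmod_map A M M' f" and g: "bimod_map A N N' g"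
  shows "balanced A M N (tensor_group A M' N') (\<lambda>x y. pure A M' N' (f x) (g y))"
  by (rule balancedI)
    (simp_all add: rmod_mapD[OF f] bimod_mapD[OF g] pure_closed pure_add_left pure_add_right pure_middle)

lemma tensor_map_hom:
  assumes f: "rmod_map A M M' f" and g: "bimod_map A N N' g"
  shows "tensor_map A M' N' f g \<in> hom (tensor_group A M N) (tensor_group A M' N')"
  unfolding tensor_map_def
  by (rule tensor_lift_hom[OF rmod_mapD(1)[OF f] bimod_mapD(1)[OF g]
        tensor_group_comm_group[OF rmod_mapD(2)[OF f] bimod_mapD(2)[OF g]] tensor_map_balanced[OF f g]])

lemma tensor_map_closed:
  assumes "rmod_map A M M' f" "bimod_map A N N' g" "t \<in> carrier (tensor_group A M N)"
  shows "tensor_map A M' N' f g t \<in> carrier (tensor_group A M' N')"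
  by (rule hom_in_carrier[OF tensor_map_hom[OF assms(1,2)] assms(3)])

lemma tensor_map_pure:
  assumes f: "rmod_map A M M' f" and g: "bimod_map A N N' g" and "x \<in> carrier M" "y \<in> carrier N"
  shows "tensor_map A M' N' f g (pure A M N x y) = pure A M' N' (f x) (g y)"
  unfolding tensor_map_def
  by (rule tensor_lift_pure[OF rmod_mapD(1)[OF f] bimod_mapD(1)[OF g]
        tensor_group_comm_group[OF rmod_mapD(2)[OF f] bimod_mapD(2)[OF g]] tensor_map_balanced[OF f g] assms(3,4)])

lemma rmod_hom_ext:
  assumes M: "right_module A M" and N: "bimodule A N" and P: "right_module A P"
    and f: "f \<in> hom (tensor_group A M N) P" and g: "g \<in> hom (tensor_group A M N) P"
    and eq: "\<And>x y. \<lbrakk>x \<in> carrier M; y \<in> carrier N\<rbrakk> \<Longrightarrow> f (pure A M N x y) = g (pure A M N x y)"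
    and t: "t \<in> carrier (tensor_group A M N)"
  shows "f t = g t"
  using tensor_hom_ext[OF M N _ f g eq t] P
  by (simp add: right_module_def comm_group_def)

lemma tensor_map_rmod_map:
  assumes f: "rmod_map A M M' f" and g: "bimod_map A N N' g"
  shows "rmod_map A (rtensor A M N) (rtensor A M' N') (tensor_map A M' N' f g)"
proof -
  note MN = rmod_mapD(1)[OF f] bimod_mapD(1)[OF g]
  note MN' = rmod_mapD(2)[OF f] bimod_mapD(2)[OF g]
  note hom = tensor_map_hom[OF f g]
  interpret N: bimodule A N by (rule MN)
  have "tensor_map A M' N' f g (t \<triangleleft>\<^bsub>rtensor A M N\<^esub> r) = tensor_map A M' N' f g t \<triangleleft>\<^bsub>rtensor A M' N'\<^esub> r"
    if r: "r \<in> carrier A" and t: "t \<in> carrier (tensor_group A M N)" for t r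
    by (rule tensor_hom_ext[OF MN tensor_group_group[OF MN'] hom_comp[OF rtensor_ract_hom[OF MN r] hom]
          hom_comp[OF hom rtensor_ract_hom[OF MN' r]] _ t])
      (use r in \<open>simp add: pure_ract[OF MN] pure_ract[OF MN'] tensor_map_pure[OF f g] N.ract_closed
        rmod_mapD[OF f] bimod_mapD[OF g] del: rtensor_simps(4)\<close>)
  with hom show ?thesis
    unfolding rmod_map_def rlinear_def
    by (simp add: rtensor_right_module MN MN' del: rtensor_simps(4))
qed

lemma tensor_map_comp:
  assumes f: "rmod_map A M M' f" and f': "rmod_map A M' M'' f'"
    and g: "bimod_map A N N' g" and g': "bimod_map A N' N'' g'"
    and t: "t \<in> carrier (tensor_group A M N)"
  shows "tensor_map A M'' N'' f' g' (tensor_map A M' N' f g t)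
    = tensor_map A M'' N'' (\<lambda>x. f' (f x)) (\<lambda>y. g' (g y)) t"
proof -
  have ff: "rmod_map A M M'' (\<lambda>x. f' (f x))"
    by (rule rmod_map_comp[OF f f'])
  have gg: "bimod_map A N N'' (\<lambda>x. g' (g x))"
    using g g' by (auto simp: bimod_map_def bilinear_def rlinear_def hom_def Pi_iff)
  show ?thesis
    by (rule tensor_hom_ext[OF rmod_mapD(1)[OF f] bimod_mapD(1)[OF g]
          tensor_group_group[OF rmod_mapD(2)[OF f'] bimod_mapD(2)[OF g']]
          hom_comp[OF tensor_map_hom[OF f g] tensor_map_hom[OF f' g']] tensor_map_hom[OF ff gg] _ t])
      (simp add: tensor_map_pure[OF f g] tensor_map_pure[OF f' g'] tensor_map_pure[OF ff gg]
        rmod_mapD[OF f] bimod_mapD[OF g])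
qed

lemma tensor_map_cong:
  assumes f: "rmod_map A M M' f" and g: "bimod_map A N N' g"
    and ff': "\<And>x. x \<in> carrier M \<Longrightarrow> f' x = f x"
    and t: "t \<in> carrier (tensor_group A M N)"
  shows "tensor_map A M' N' f' g t = tensor_map A M' N' f g t"
proof -
  have f': "rmod_map A M M' f'"
    by (rule rmod_map_cong[OF f ff'])
  show ?thesis
    by (rule tensor_hom_ext[OF rmod_mapD(1)[OF f] bimod_mapD(1)[OF g]
          tensor_group_group[OF rmod_mapD(2)[OF f] bimod_mapD(2)[OF g]]
          tensor_map_hom[OF f' g] tensor_map_hom[OF f g] _ t])
      (simp add: tensor_map_pure[OF f g] tensor_map_pure[OF f' g] ff')
qed

lemma tensor_map_id:
  assumes M: "right_module A M" and N: "bimodule A N" and f: "\<And>x. x \<in> carrier M \<Longrightarrow> f x = x"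
    and t: "t \<in> carrier (tensor_group A M N)"
  shows "tensor_map A M N f (\<lambda>y. y) t = t"
proof -
  have f: "rmod_map A M M f"
    by (rule rmod_map_cong[OF rmod_map_id[OF M] f])
  note g = bimod_map_id[OF N]
  show ?thesis
    by (rule tensor_hom_ext[OF M N tensor_group_group[OF M N] tensor_map_hom[OF f g] hom_id _ t])
      (simp add: tensor_map_pure[OF f g] assms(3))
qed

section \<open>Naturality of the canonical isomorphisms\<close>

text \<open>
  The associativity isomorphism lifts twice: first in \<open>x \<otimes> y\<close> for fixed \<open>z\<close>, here, and then in the
  resulting map of \<open>x \<otimes> y\<close> and \<open>z\<close>. Moving a scalar from \<open>x\<close> to \<open>y\<close> uses the left action on \<open>N \<otimes> P\<close>.
\<close>

lemma assoc_inner_balanced: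
  assumes M: "right_module A M" and N: "bimodule A N" and P: "bimodule A P" and z: "z \<in> carrier P"
  shows "balanced A M N (tensor_group A M (bitensor A N P)) (\<lambda>x y. pure A M (bitensor A N P) x (pure A N P y z))"
proof -
  note N' = bimodule_right_module[OF N]
  note NP = bitensor_bimodule[OF N P]
  interpret M: right_module A M by fact
  interpret N: bimodule A N by fact
  have closed: "pure A M (bitensor A N P) x t \<in> carrier (tensor_group A M (bitensor A N P))"
    if "x \<in> carrier M" "t \<in> carrier (tensor_group A N P)" for x t
    by (rule pure_closed) (use that in simp_all)
  show ?thesis
    by (rule balancedI)
     (use z pure_add_left[OF M NP] pure_add_right[OF M NP] pure_middle[OF M NP] pure_lact[OF N P] in
       \<open>simp_all add: closed pure_closed pure_add_left[OF N' P] del: bitensor_simps(4,5)\<close>)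
qed

lemma
  fixes M :: "('r, 'm, 'x) rmod_scheme"
  assumes M: "right_module A M" and N: "bimodule A N" and P: "bimodule A P"
  shows assoc_hom: "tensor_assoc A M N P \<in>
      hom (tensor_group A (rtensor A M N) P) (tensor_group A M (bitensor A N P))"
    and assoc_pure: "\<And>x y z. \<lbrakk>x \<in> carrier M; y \<in> carrier N; z \<in> carrier P\<rbrakk> \<Longrightarrow>
      tensor_assoc A M N P (pure A (rtensor A M N) P (pure A M N x y) z)
      = pure A M (bitensor A N P) x (pure A N P y z)"
proof -
  note N' = bimodule_right_module[OF N]
  note NP = bitensor_bimodule[OF N P]
  note MN = rtensor_right_module[OF M N]
  let ?T = "tensor_group A M (bitensor A N P)"
  let ?i = "\<lambda>z x y. pure A M (bitensor A N P) x (pure A N P y z)"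
  interpret M: right_module A M by fact
  interpret N: bimodule A N by fact
  interpret P: bimodule A P by fact
  interpret MN: right_module A "rtensor A M N" by fact
  interpret T: comm_group ?T by (rule tensor_group_comm_group[OF M NP])
  note inner = assoc_inner_balanced[OF M N P]
  note lift_hom = tensor_lift_hom[OF M N T.comm_group_axioms inner]
  note lift_pure = tensor_lift_pure[OF M N T.comm_group_axioms inner]
  note ext = tensor_hom_ext[OF M N T.is_group]
  have pure_add: "pure A M (bitensor A N P) x (u \<otimes>\<^bsub>tensor_group A N P\<^esub> v)
      = pure A M (bitensor A N P) x u \<otimes>\<^bsub>?T\<^esub> pure A M (bitensor A N P) x v"
    if "x \<in> carrier M" "u \<in> carrier (tensor_group A N P)" "v \<in> carrier (tensor_group A N P)" for x u v
    using pure_add_right[OF M NP, of x u v] that by simp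
  have ract_hom: "(\<lambda>t. t \<triangleleft>\<^bsub>rtensor A M N\<^esub> r) \<in> hom (tensor_group A M N) (tensor_group A M N)"
    if "r \<in> carrier A" for r
    by (rule rtensor_ract_hom[OF M N that])
  have outer: "balanced A (rtensor A M N) P ?T (\<lambda>t z. tensor_lift ?T (?i z) t)"
  proof (rule balancedI, unfold rtensor_simps(1-3))
    show "tensor_lift ?T (?i z) t \<in> carrier ?T"
      if "t \<in> carrier (tensor_group A M N)" "z \<in> carrier P" for t z
      by (rule hom_in_carrier[OF lift_hom[OF that(2)] that(1)])
    show "tensor_lift ?T (?i z) (t \<otimes>\<^bsub>tensor_group A M N\<^esub> t')
        = tensor_lift ?T (?i z) t \<otimes>\<^bsub>?T\<^esub> tensor_lift ?T (?i z) t'"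
      if "t \<in> carrier (tensor_group A M N)" "t' \<in> carrier (tensor_group A M N)" "z \<in> carrier P" for t t' z
      by (rule hom_mult[OF lift_hom[OF that(3)] that(1,2)])
    show "tensor_lift ?T (?i (z \<otimes>\<^bsub>P\<^esub> z')) t = tensor_lift ?T (?i z) t \<otimes>\<^bsub>?T\<^esub> tensor_lift ?T (?i z') t"
      if t: "t \<in> carrier (tensor_group A M N)" and z: "z \<in> carrier P" "z' \<in> carrier P" for t z z'
      by (rule ext[OF lift_hom hom_mult_hom[OF T.comm_group_axioms lift_hom lift_hom] _ t])
        (use z in \<open>simp_all add: lift_pure pure_add_right[OF N' P] pure_add pure_closed\<close>)
    show "tensor_lift ?T (?i z) (t \<triangleleft>\<^bsub>rtensor A M N\<^esub> r) = tensor_lift ?T (?i (r \<triangleright>\<^bsub>P\<^esub> z)) t"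
      if t: "t \<in> carrier (tensor_group A M N)" and r: "r \<in> carrier A" and z: "z \<in> carrier P" for t r z
      by (rule ext[OF hom_comp[OF ract_hom lift_hom] lift_hom _ t])
        (use r z in \<open>simp_all add: lift_pure pure_ract[OF M N] P.lact_closed N.ract_closed
          pure_middle[OF N' P] del: rtensor_simps(4)\<close>)
  qed
  show "tensor_assoc A M N P \<in> hom (tensor_group A (rtensor A M N) P) ?T"
    unfolding tensor_assoc_def Let_def
    by (rule tensor_lift_hom[OF MN P T.comm_group_axioms outer])
  show "tensor_assoc A M N P (pure A (rtensor A M N) P (pure A M N x y) z) = ?i z x y"
    if "x \<in> carrier M" "y \<in> carrier N" "z \<in> carrier P" for x y z
    unfolding tensor_assoc_def Let_def
    using tensor_lift_pure[OF MN P T.comm_group_axioms outer, of "pure A M N x y" z] that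
    by (simp add: lift_pure pure_closed)
qed

text \<open>
  Two nested reductions to pure tensors: the elements \<open>s \<otimes> z\<close> generate, and for fixed \<open>z\<close> both sides
  are additive in \<open>s\<close>, so \<open>s\<close> may be taken pure as well.
\<close>

lemma tensor_assoc_natural:
  assumes f: "rmod_map A M M' f" and N: "bimodule A N" and P: "bimodule A P"
    and t: "t \<in> carrier (tensor_group A (rtensor A M N) P)"
  shows "tensor_assoc A M' N P (tensor_map A (rtensor A M' N) P (tensor_map A M' N f (\<lambda>d. d)) (\<lambda>d. d) t)
    = tensor_map A M' (bitensor A N P) f (\<lambda>d. d) (tensor_assoc A M N P t)"
proof -
  note M = rmod_mapD(1)[OF f] and M' = rmod_mapD(2)[OF f]
  note NP = bitensor_bimodule[OF N P]
  note MN = rtensor_right_module[OF M N]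
  note idN = bimod_map_id[OF N] and idP = bimod_map_id[OF P] and idNP = bimod_map_id[OF NP]
  note fN = tensor_map_rmod_map[OF f idN]
  note G = tensor_group_group[OF M' NP]
  note hom1 = hom_comp[OF tensor_map_hom[OF fN idP] assoc_hom[OF M' N P]]
  note hom2 = hom_comp[OF assoc_hom[OF M N P] tensor_map_hom[OF f idNP]]
  have closed: "pure A N P y z \<in> carrier (bitensor A N P)" if "y \<in> carrier N" "z \<in> carrier P" for y z
    using that by (simp add: pure_closed)
  have "tensor_assoc A M' N P (tensor_map A (rtensor A M' N) P (tensor_map A M' N f (\<lambda>d. d)) (\<lambda>d. d)
        (pure A (rtensor A M N) P s z))
      = tensor_map A M' (bitensor A N P) f (\<lambda>d. d) (tensor_assoc A M N P (pure A (rtensor A M N) P s z))"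
    if s: "s \<in> carrier (tensor_group A M N)" and z: "z \<in> carrier P" for s z
  proof -
    have hom: "(\<lambda>s. pure A (rtensor A M N) P s z) \<in> hom (tensor_group A M N) (tensor_group A (rtensor A M N) P)"
      using balanced_hom_left[OF pure_balanced[OF MN P] z] by simp
    show ?thesis
      by (rule tensor_hom_ext[OF M N G hom_comp[OF hom hom1] hom_comp[OF hom hom2] _ s])
        (use z in \<open>simp add: tensor_map_pure[OF fN idP] tensor_map_pure[OF f idN] pure_closed
          assoc_pure[OF M N P] assoc_pure[OF M' N P] rmod_mapD[OF f] tensor_map_pure[OF f idNP] closed\<close>)
  qed
  then show ?thesis
    by (intro tensor_hom_ext[OF MN P G hom1 hom2 _ t]) simp
qed

lemma right_unitor_balanced:
  assumes "right_module A M"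
  shows "balanced A M (ring_bimod A) M (\<lambda>x r. x \<triangleleft>\<^bsub>M\<^esub> r)"
proof -
  interpret right_module A M by fact
  show ?thesis
    by (rule balancedI)
      (simp_all add: ring_bimod_def ract_closed ract_add_left ract_add_right ract_mult)
qed

lemma right_module_comm_group: "right_module A M \<Longrightarrow> comm_group M"
  by (simp add: right_module_def)

lemma right_module_ring: "right_module A M \<Longrightarrow> ring A"
  by (simp add: right_module_def)

lemma right_unitor_hom:
  assumes M: "right_module A M"
  shows "right_unitor M \<in> hom (tensor_group A M (ring_bimod A)) M"
  unfolding right_unitor_def
  by (rule tensor_lift_hom[OF M ring_bimod_bimodule[OF right_module_ring[OF M]]
        right_module_comm_group[OF M] right_unitor_balanced[OF M]])

lemma right_unitor_pure:
  assumes M: "right_module A M" and "x \<in> carrier M" "r \<in> carrier A"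
  shows "right_unitor M (pure A M (ring_bimod A) x r) = x \<triangleleft>\<^bsub>M\<^esub> r"
  unfolding right_unitor_def
  by (rule tensor_lift_pure[OF M ring_bimod_bimodule[OF right_module_ring[OF M]]
        right_module_comm_group[OF M] right_unitor_balanced[OF M]])
    (use assms in \<open>simp_all add: ring_bimod_def\<close>)

text \<open>
  On a pure tensor \<open>x \<otimes> r\<close> this is the linearity \<open>f (x \<triangleleft> r) = f x \<triangleleft> r\<close>.
\<close>

lemma right_unitor_natural:
  assumes f: "rmod_map A M M' f" and t: "t \<in> carrier (tensor_group A M (ring_bimod A))"
  shows "right_unitor M' (tensor_map A M' (ring_bimod A) f (\<lambda>d. d) t) = f (right_unitor M t)"
proof -
  note M = rmod_mapD(1)[OF f] and M' = rmod_mapD(2)[OF f]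
  note R = ring_bimod_bimodule[OF right_module_ring[OF M]]
  note idR = bimod_map_id[OF R]
  have car: "carrier (ring_bimod A) = carrier A"
    by (simp add: ring_bimod_def)
  show ?thesis
    by (rule rmod_hom_ext[OF M R M' hom_comp[OF tensor_map_hom[OF f idR] right_unitor_hom[OF M']]
          hom_comp[OF right_unitor_hom[OF M] rmod_mapD(4)[OF f]] _ t])
      (simp add: car tensor_map_pure[OF f idR] right_unitor_pure[OF M] right_unitor_pure[OF M'] rmod_mapD[OF f])
qed

section \<open>Colinear squares\<close>

text \<open>
  The square with top \<open>r : M\<^sub>0 \<rightarrow> M\<^sub>1 \<otimes> P\<close>, bottom \<open>s : N\<^sub>0 \<rightarrow> N\<^sub>1 \<otimes> P\<close> and vertical maps \<open>f\<^sub>0\<close> and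
  \<open>f\<^sub>1 \<otimes> P\<close> commutes. Separate modules at the two ends of a coaction are needed because the coaction of
  a graded comodule changes the degree; for a comodule both ends coincide.
\<close>

definition colinear ::
  "('r, 's) ring_scheme \<Rightarrow> ('r, 'p, 'z) bimod_scheme \<Rightarrow>
   ('r, 'm0, 'y0) rmod_scheme \<Rightarrow> ('r, 'm1, 'y1) rmod_scheme \<Rightarrow> ('m0 \<Rightarrow> ('m1, 'p) tens) \<Rightarrow>
   ('r, 'n0, 'x0) rmod_scheme \<Rightarrow> ('r, 'n1, 'x1) rmod_scheme \<Rightarrow> ('n0 \<Rightarrow> ('n1, 'p) tens) \<Rightarrow>
   ('m0 \<Rightarrow> 'n0) \<Rightarrow> ('m1 \<Rightarrow> 'n1) \<Rightarrow> bool"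
where
  "colinear A P M0 M1 r N0 N1 s f0 f1 \<longleftrightarrow> bimodule A P \<and>
     rmod_map A M0 (rtensor A M1 P) r \<and> rmod_map A N0 (rtensor A N1 P) s \<and>
     rmod_map A M0 N0 f0 \<and> rmod_map A M1 N1 f1 \<and>
     (\<forall>m\<in>carrier M0. tensor_map A N1 P f1 (\<lambda>d. d) (r m) = s (f0 m))"

lemma colinearI:
  assumes "bimodule A P"
    and "rmod_map A M0 (rtensor A M1 P) r" "rmod_map A N0 (rtensor A N1 P) s"
    and "rmod_map A M0 N0 f0" "rmod_map A M1 N1 f1"
    and "\<And>m. m \<in> carrier M0 \<Longrightarrow> tensor_map A N1 P f1 (\<lambda>d. d) (r m) = s (f0 m)"
  shows "colinear A P M0 M1 r N0 N1 s f0 f1"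
  using assms by (simp add: colinear_def)

lemma colinearD:
  assumes "colinear A P M0 M1 r N0 N1 s f0 f1"
  shows "bimodule A P" "rmod_map A M0 (rtensor A M1 P) r" "rmod_map A N0 (rtensor A N1 P) s"
    "rmod_map A M0 N0 f0" "rmod_map A M1 N1 f1"
    "\<And>m. m \<in> carrier M0 \<Longrightarrow> tensor_map A N1 P f1 (\<lambda>d. d) (r m) = s (f0 m)"
    "\<And>m. m \<in> carrier M0 \<Longrightarrow> r m \<in> carrier (tensor_group A M1 P)"
  using assms rmod_mapD(5)[of A M0 "rtensor A M1 P" r] by (simp_all add: colinear_def)

lemma colinear_id:
  assumes P: "bimodule A P" and r: "rmod_map A M0 (rtensor A M1 P) r" and M1: "right_module A M1"
  shows "colinear A P M0 M1 r M0 M1 r (\<lambda>x. x) (\<lambda>x. x)"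
proof (rule colinearI[OF P r r rmod_map_id rmod_map_id[OF M1]])
  show "right_module A M0"
    by (rule rmod_mapD(1)[OF r])
  show "tensor_map A M1 P (\<lambda>x. x) (\<lambda>d. d) (r m) = r m" if "m \<in> carrier M0" for m
    using tensor_map_id[OF M1 P, of "\<lambda>x. x" "r m"] rmod_mapD(5)[OF r that] by simp
qed

lemma colinear_comp:
  assumes f: "colinear A P L0 L1 q M0 M1 r f0 f1" and g: "colinear A P M0 M1 r N0 N1 s g0 g1"
  shows "colinear A P L0 L1 q N0 N1 s (\<lambda>x. g0 (f0 x)) (\<lambda>x. g1 (f1 x))"
proof (rule colinearI[OF colinearD(1,2)[OF f] colinearD(3)[OF g]
      rmod_map_comp[OF colinearD(4)[OF f] colinearD(4)[OF g]]
      rmod_map_comp[OF colinearD(5)[OF f] colinearD(5)[OF g]]])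
  fix m assume m: "m \<in> carrier L0"
  note idP = bimod_map_id[OF colinearD(1)[OF f]]
  show "tensor_map A N1 P (\<lambda>x. g1 (f1 x)) (\<lambda>d. d) (q m) = s (g0 (f0 m))"
    using tensor_map_comp[OF colinearD(5)[OF f] colinearD(5)[OF g] idP idP colinearD(7)[OF f m]]
      colinearD(6)[OF f m] colinearD(6)[OF g rmod_mapD(5)[OF colinearD(4)[OF f] m]]
    by simp
qed

lemma colinear_cong:
  assumes f: "colinear A P M0 M1 r N0 N1 s f0 f1"
    and eq0: "\<And>x. x \<in> carrier M0 \<Longrightarrow> g0 x = f0 x" and eq1: "\<And>x. x \<in> carrier M1 \<Longrightarrow> g1 x = f1 x"
  shows "colinear A P M0 M1 r N0 N1 s g0 g1"
proof (rule colinearI[OF colinearD(1-3)[OF f] rmod_map_cong[OF colinearD(4)[OF f] eq0]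
      rmod_map_cong[OF colinearD(5)[OF f] eq1]])
  show "tensor_map A N1 P g1 (\<lambda>d. d) (r m) = s (g0 m)" if m: "m \<in> carrier M0" for m
    using tensor_map_cong[OF colinearD(5)[OF f] bimod_map_id[OF colinearD(1)[OF f]] eq1 colinearD(7)[OF f m]]
      colinearD(6)[OF f m] eq0[OF m] by simp
qed

text \<open>
  Read \<open>r01\<close>, \<open>r12\<close>, \<open>r02\<close> as the coactions from degree \<open>\<alpha>\<beta>\<gamma>\<close> to \<open>\<alpha>\<beta>\<close>, from \<open>\<alpha>\<beta>\<close> to \<open>\<alpha>\<close>, and from
  \<open>\<alpha>\<beta>\<gamma>\<close> to \<open>\<alpha>\<close>. The three squares move the vertical maps past the coactions until they meet the
  associativity isomorphism, which is natural.
\<close>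

lemma coassoc_transport:
  assumes P: "bimodule A P" and Q: "bimodule A Q" and D: "bimod_map A R (bitensor A P Q) D"
    and sq01: "colinear A Q M0 M1 r01 N0 N1 s01 i0 i1"
    and sq12: "colinear A P M1 M2 r12 N1 N2 s12 i1 i2"
    and sq02: "colinear A R M0 M2 r02 N0 N2 s02 i0 i2"
    and m: "m \<in> carrier M0"
    and coassoc: "tensor_map A M2 (bitensor A P Q) (\<lambda>x. x) D (r02 m)
      = tensor_assoc A M2 P Q (tensor_map A (rtensor A M2 P) Q r12 (\<lambda>d. d) (r01 m))"
  shows "tensor_map A N2 (bitensor A P Q) (\<lambda>x. x) D (s02 (i0 m))
      = tensor_assoc A N2 P Q (tensor_map A (rtensor A N2 P) Q s12 (\<lambda>d. d) (s01 (i0 m)))"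
proof -
  note r01 = colinearD(2)[OF sq01] and r12 = colinearD(2)[OF sq12] and r02 = colinearD(2)[OF sq02]
  note s12 = colinearD(3)[OF sq12]
  note i1 = colinearD(4)[OF sq12] and i2 = colinearD(5)[OF sq12]
  note eq01 = colinearD(6)[OF sq01 m, symmetric] and eq02 = colinearD(6)[OF sq02 m, symmetric]
  note eq12 = colinearD(6)[OF sq12, symmetric]
  note idP = bimod_map_id[OF P] and idQ = bimod_map_id[OF Q]
  note PQ = bitensor_bimodule[OF P Q]
  note idPQ = bimod_map_id[OF PQ] and idR = bimod_map_id[OF bimod_mapD(1)[OF D]]
  note idM2 = rmod_map_id[OF rmod_mapD(1)[OF i2]] and idN2 = rmod_map_id[OF rmod_mapD(2)[OF i2]]
  note i2P = tensor_map_rmod_map[OF i2 idP]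
  have r01m: "r01 m \<in> carrier (tensor_group A M1 Q)" and r02m: "r02 m \<in> carrier (tensor_group A M2 R)"
    using rmod_mapD(5)[OF r01 m] rmod_mapD(5)[OF r02 m] by simp_all
  have s: "tensor_map A (rtensor A M2 P) Q r12 (\<lambda>d. d) (r01 m) \<in> carrier (tensor_group A (rtensor A M2 P) Q)"
    by (rule tensor_map_closed[OF r12 idQ r01m])
  have "tensor_map A N2 (bitensor A P Q) (\<lambda>x. x) D (s02 (i0 m))
      = tensor_map A N2 (bitensor A P Q) i2 D (r02 m)"
    by (simp add: eq02 tensor_map_comp[OF i2 idN2 idR D r02m])
  also have "\<dots> = tensor_map A N2 (bitensor A P Q) i2 (\<lambda>d. d) (tensor_map A M2 (bitensor A P Q) (\<lambda>x. x) D (r02 m))"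
    by (simp add: tensor_map_comp[OF idM2 i2 D idPQ r02m])
  also have "\<dots> = tensor_assoc A N2 P Q (tensor_map A (rtensor A N2 P) Q (tensor_map A N2 P i2 (\<lambda>d. d)) (\<lambda>d. d)
        (tensor_map A (rtensor A M2 P) Q r12 (\<lambda>d. d) (r01 m)))"
    by (simp only: coassoc tensor_assoc_natural[OF i2 P Q s])
  also have "\<dots> = tensor_assoc A N2 P Q
        (tensor_map A (rtensor A N2 P) Q (\<lambda>x. tensor_map A N2 P i2 (\<lambda>d. d) (r12 x)) (\<lambda>d. d) (r01 m))"
    by (simp only: tensor_map_comp[OF r12 i2P idQ idQ r01m])
  also have "\<dots> = tensor_assoc A N2 P Q
        (tensor_map A (rtensor A N2 P) Q (\<lambda>x. s12 (i1 x)) (\<lambda>d. d) (r01 m))"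
    by (simp only: tensor_map_cong[OF rmod_map_comp[OF r12 i2P] idQ eq12 r01m])
  also have "\<dots> = tensor_assoc A N2 P Q
        (tensor_map A (rtensor A N2 P) Q s12 (\<lambda>d. d) (tensor_map A N1 Q i1 (\<lambda>d. d) (r01 m)))"
    by (simp only: tensor_map_comp[OF i1 s12 idQ idQ r01m])
  finally show ?thesis
    by (simp only: eq01)
qed

lemma counit_transport:
  assumes E: "bimod_map A R (ring_bimod A) e"
    and sq: "colinear A R M M r N N s i i"
    and m: "m \<in> carrier M"
    and counit: "right_unitor M (tensor_map A M (ring_bimod A) (\<lambda>x. x) e (r m)) = m"
  shows "right_unitor N (tensor_map A N (ring_bimod A) (\<lambda>x. x) e (s (i m))) = i m"
proof -
  note i = colinearD(4)[OF sq] and r = colinearD(2)[OF sq] and eq = colinearD(6)[OF sq m, symmetric]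
  note idM = rmod_map_id[OF rmod_mapD(1)[OF i]] and idN = rmod_map_id[OF rmod_mapD(2)[OF i]]
  note idR = bimod_map_id[OF bimod_mapD(1)[OF E]] and idA = bimod_map_id[OF bimod_mapD(2)[OF E]]
  have rm: "r m \<in> carrier (tensor_group A M R)"
    using rmod_mapD(5)[OF r m] by simp
  have "tensor_map A N (ring_bimod A) (\<lambda>x. x) e (s (i m)) = tensor_map A N (ring_bimod A) i e (r m)"
    by (simp add: eq tensor_map_comp[OF i idN idR E rm])
  also have "\<dots> = tensor_map A N (ring_bimod A) i (\<lambda>d. d) (tensor_map A M (ring_bimod A) (\<lambda>x. x) e (r m))"
    by (simp add: tensor_map_comp[OF idM i E idA rm])
  finally show ?thesis
    by (simp add: right_unitor_natural[OF i tensor_map_closed[OF idM E rm]] counit)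
qed

section \<open>Isomorphic copies and direct sums\<close>

lemma image_mod_simps:
  assumes "inj_on h (carrier M)"
  shows carrier_image_mod: "carrier (image_mod h M) = h ` carrier M"
    and one_image_mod: "one (image_mod h M) = h (one M)"
    and mult_image_mod: "\<lbrakk>x \<in> carrier M; y \<in> carrier M\<rbrakk> \<Longrightarrow> h x \<otimes>\<^bsub>image_mod h M\<^esub> h y = h (x \<otimes>\<^bsub>M\<^esub> y)"
    and ract_image_mod: "x \<in> carrier M \<Longrightarrow> h x \<triangleleft>\<^bsub>image_mod h M\<^esub> r = h (x \<triangleleft>\<^bsub>M\<^esub> r)"
  using assms by (simp_all add: image_mod_def Let_def)

lemma image_mod_right_module:
  assumes M: "right_module A M" and h: "inj_on h (carrier M)"
  shows "right_module A (image_mod h M)"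
proof -
  interpret M: right_module A M by fact
  note simps = image_mod_simps[OF h]
  have "comm_group (image_mod h M)"
  proof (rule comm_groupI)
    fix x assume "x \<in> carrier (image_mod h M)"
    then obtain m where m: "m \<in> carrier M" "x = h m"
      by (auto simp: simps)
    then show "\<exists>y\<in>carrier (image_mod h M). y \<otimes>\<^bsub>image_mod h M\<^esub> x = \<one>\<^bsub>image_mod h M\<^esub>"
      by (intro bexI[of _ "h (inv\<^bsub>M\<^esub> m)"]) (auto simp: simps)
  qed (auto simp: simps M.module.m_ac)
  moreover have "right_module_axioms A (image_mod h M)"
    by unfold_locales
      (auto simp: simps M.ract_closed M.ract_add_left M.ract_add_right M.ract_mult M.ract_one)
  ultimately show ?thesis
    by (intro right_module_axiomsI[OF M.ring_axioms])
qed

lemma image_mod_map: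
  assumes M: "right_module A M" and h: "inj_on h (carrier M)"
  shows "rmod_map A M (image_mod h M) h"
  by (rule rmod_mapI[OF M image_mod_right_module[OF M h]]) (simp_all add: image_mod_simps[OF h])

lemma image_mod_inv_map:
  assumes M: "right_module A M" and h: "inj_on h (carrier M)"
  shows "rmod_map A (image_mod h M) M (inv_into (carrier M) h)"
proof -
  interpret M: right_module A M by fact
  show ?thesis
    by (rule rmod_mapI[OF image_mod_right_module[OF M h] M])
      (auto simp: image_mod_simps[OF h] h M.ract_closed)
qed

lemma hom_finprod:
  assumes "comm_group K" "comm_group H" "f \<in> hom K H" "g \<in> X \<rightarrow> carrier K"
  shows "f (finprod K g X) = finprod H (\<lambda>x. f (g x)) X"
proof -
  interpret K: comm_group K by fact
  interpret H: comm_group H by fact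
  interpret f: group_hom K H f
    using assms(3) by (simp add: group_hom_def group_hom_axioms_def K.is_group H.is_group)
  show ?thesis
    using assms(4)
  proof (induction X rule: infinite_finite_induct)
    case (insert x X)
    then show ?case
      by (subst K.finprod_insert) (auto simp: Pi_iff)
  qed simp_all
qed

lemma direct_sum_simps [simp]:
  "monoid.mult (direct_sum I M) = (\<lambda>x y. \<lambda>i\<in>I. x i \<otimes>\<^bsub>M i\<^esub> y i)"
  "one (direct_sum I M) = (\<lambda>i\<in>I. \<one>\<^bsub>M i\<^esub>)"
  "ract (direct_sum I M) x r = (\<lambda>\<beta>\<in>I. x \<beta> \<triangleleft>\<^bsub>M \<beta>\<^esub> r)"
  "carrier (direct_sum I M) = carrier (sum_group I M)"
  by (simp_all add: direct_sum_def monoid.defs rmod.defs flip: mult_sum_group one_sum_group)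

lemma right_module_group: "right_module A M \<Longrightarrow> group M"
  by (simp add: right_module_def comm_group_def)

lemma ract_zero:
  assumes "right_module A M" "r \<in> carrier A"
  shows "\<one>\<^bsub>M\<^esub> \<triangleleft>\<^bsub>M\<^esub> r = \<one>\<^bsub>M\<^esub>"
proof -
  interpret M: right_module A M by fact
  have "(\<one>\<^bsub>M\<^esub> \<triangleleft>\<^bsub>M\<^esub> r) \<otimes>\<^bsub>M\<^esub> (\<one>\<^bsub>M\<^esub> \<triangleleft>\<^bsub>M\<^esub> r) = \<one>\<^bsub>M\<^esub> \<triangleleft>\<^bsub>M\<^esub> r"
    using M.ract_add_left[of "\<one>\<^bsub>M\<^esub>" "\<one>\<^bsub>M\<^esub>" r] assms(2) by simp
  then show ?thesis
    using M.module.l_cancel_one M.ract_closed assms(2) by blast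
qed

text \<open>
  The axioms hold in each coordinate; a scalar does not enlarge the support because it fixes zero.
\<close>

lemma direct_sum_right_module:
  assumes A: "ring A" and M: "\<And>i. i \<in> I \<Longrightarrow> right_module A (M i)"
  shows "right_module A (direct_sum I M)"
proof -
  have grp: "\<And>i. i \<in> I \<Longrightarrow> group (M i)"
    using M right_module_group by blast
  note car = carrier_sum_group[of I M, OF grp]
  have "group (sum_group I M)"
    by (simp add: grp)
  moreover have "x \<otimes>\<^bsub>sum_group I M\<^esub> y = y \<otimes>\<^bsub>sum_group I M\<^esub> x"
    if "x \<in> carrier (sum_group I M)" "y \<in> carrier (sum_group I M)" for x y
  proof -
    have "x i \<otimes>\<^bsub>M i\<^esub> y i = y i \<otimes>\<^bsub>M i\<^esub> x i" if "i \<in> I" for i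
      using that \<open>x \<in> _\<close> \<open>y \<in> _\<close> comm_monoid.m_comm[of "M i"] M[OF that]
      by (auto simp: car right_module_def comm_group_def)
    then show ?thesis
      by (simp cong: restrict_cong)
  qed
  ultimately have "comm_group (sum_group I M)"
    by (rule group.group_comm_groupI)
  then have cg: "comm_group (direct_sum I M)"
    by (rule comm_group_cong) simp_all
  have closed: "(\<lambda>\<beta>\<in>I. x \<beta> \<triangleleft>\<^bsub>M \<beta>\<^esub> r) \<in> carrier (sum_group I M)"
    if x: "x \<in> carrier (sum_group I M)" and r: "r \<in> carrier A" for x r
  proof -
    have "{i \<in> I. (\<lambda>\<beta>\<in>I. x \<beta> \<triangleleft>\<^bsub>M \<beta>\<^esub> r) i \<noteq> \<one>\<^bsub>M i\<^esub>} \<subseteq> {i \<in> I. x i \<noteq> \<one>\<^bsub>M i\<^esub>}"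
      using ract_zero[OF M r] by auto
    moreover have "finite {i \<in> I. x i \<noteq> \<one>\<^bsub>M i\<^esub>}"
      using x by (simp add: car)
    ultimately have "finite {i \<in> I. (\<lambda>\<beta>\<in>I. x \<beta> \<triangleleft>\<^bsub>M \<beta>\<^esub> r) i \<noteq> \<one>\<^bsub>M i\<^esub>}"
      by (rule finite_subset)
    then show ?thesis
      using x right_module.ract_closed[OF M] r by (auto simp: car PiE_iff)
  qed
  have "right_module_axioms A (direct_sum I M)"
  proof (unfold_locales, unfold direct_sum_simps)
    show "(\<lambda>\<beta>\<in>I. x \<beta> \<triangleleft>\<^bsub>M \<beta>\<^esub> r) \<in> carrier (sum_group I M)"
      if "x \<in> carrier (sum_group I M)" "r \<in> carrier A" for x r
      by (rule closed[OF that])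
  next
    fix x y r assume "x \<in> carrier (sum_group I M)" "y \<in> carrier (sum_group I M)" "r \<in> carrier A"
    then show "(\<lambda>\<beta>\<in>I. (\<lambda>i\<in>I. x i \<otimes>\<^bsub>M i\<^esub> y i) \<beta> \<triangleleft>\<^bsub>M \<beta>\<^esub> r)
      = (\<lambda>i\<in>I. (\<lambda>\<beta>\<in>I. x \<beta> \<triangleleft>\<^bsub>M \<beta>\<^esub> r) i \<otimes>\<^bsub>M i\<^esub> (\<lambda>\<beta>\<in>I. y \<beta> \<triangleleft>\<^bsub>M \<beta>\<^esub> r) i)"
      using right_module.ract_add_left[OF M] by (auto simp: car PiE_iff intro!: restrict_ext)
  next
    fix x r s assume "x \<in> carrier (sum_group I M)" "r \<in> carrier A" "s \<in> carrier A"
    then show "(\<lambda>\<beta>\<in>I. x \<beta> \<triangleleft>\<^bsub>M \<beta>\<^esub> (r \<oplus>\<^bsub>A\<^esub> s))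
      = (\<lambda>i\<in>I. (\<lambda>\<beta>\<in>I. x \<beta> \<triangleleft>\<^bsub>M \<beta>\<^esub> r) i \<otimes>\<^bsub>M i\<^esub> (\<lambda>\<beta>\<in>I. x \<beta> \<triangleleft>\<^bsub>M \<beta>\<^esub> s) i)"
      using right_module.ract_add_right[OF M] by (auto simp: car PiE_iff intro!: restrict_ext)
  next
    fix x r s assume "x \<in> carrier (sum_group I M)" "r \<in> carrier A" "s \<in> carrier A"
    then show "(\<lambda>\<beta>\<in>I. x \<beta> \<triangleleft>\<^bsub>M \<beta>\<^esub> (r \<otimes>\<^bsub>A\<^esub> s)) = (\<lambda>\<beta>\<in>I. (\<lambda>\<beta>\<in>I. x \<beta> \<triangleleft>\<^bsub>M \<beta>\<^esub> r) \<beta> \<triangleleft>\<^bsub>M \<beta>\<^esub> s)"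
      using right_module.ract_mult[OF M] by (auto simp: car PiE_iff intro!: restrict_ext)
  next
    fix x assume x: "x \<in> carrier (sum_group I M)"
    then have "(\<lambda>\<beta>\<in>I. x \<beta> \<triangleleft>\<^bsub>M \<beta>\<^esub> \<one>\<^bsub>A\<^esub>) = restrict x I"
      using right_module.ract_one[OF M] by (auto simp: car PiE_iff intro!: restrict_ext)
    also have "\<dots> = x"
      using x by (auto simp: car PiE_iff extensional_restrict)
    finally show "(\<lambda>\<beta>\<in>I. x \<beta> \<triangleleft>\<^bsub>M \<beta>\<^esub> \<one>\<^bsub>A\<^esub>) = x" .
  qed
  then show ?thesis
    by (rule right_module_axiomsI[OF A cg])
qed

lemma inj_Fam: "inj_on Fam X" and inj_Mu: "inj_on (Mu \<alpha>) Y"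
  by (auto intro: inj_onI)

text \<open>
  This has the shape of the coaction on \<open>F\<^sub>1(M)\<close>: the sum runs over the support of the element, so that
  it is finite for every index set.
\<close>

definition sum_lift ::
  "('h, 'z) monoid_scheme \<Rightarrow> 'g set \<Rightarrow> ('g \<Rightarrow> ('r, ('g, 'v) univ) rmod) \<Rightarrow>
   ('g \<Rightarrow> ('g, 'v) univ \<Rightarrow> 'h) \<Rightarrow> ('g, 'v) univ \<Rightarrow> 'h"
where
  "sum_lift H I M f x = (\<Otimes>\<^bsub>H\<^esub>\<beta>\<in>{\<beta> \<in> I. unFam x \<beta> \<noteq> \<one>\<^bsub>M \<beta>\<^esub>}. f \<beta> (unFam x \<beta>))"

text \<open>
  The ring axioms are assumed separately since the index set may be empty. The summands live in the
  universe \<open>univ\<close>, where their direct sum is again available.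
\<close>

locale module_family = ring A
  for A :: "('r, 's) ring_scheme" and I :: "'g set" and M :: "'g \<Rightarrow> ('r, ('g, 'v) univ) rmod" +
  assumes module: "i \<in> I \<Longrightarrow> right_module A (M i)"
begin

abbreviation "S \<equiv> sum_mod I M"

lemma group: "i \<in> I \<Longrightarrow> group (M i)"
  using module right_module_group by blast

lemma carrier_sum_mod:
  "carrier S = Fam ` {x \<in> \<Pi>\<^sub>E i\<in>I. carrier (M i). finite {i \<in> I. x i \<noteq> \<one>\<^bsub>M i\<^esub>}}"
  by (simp add: sum_mod_def carrier_image_mod[OF inj_Fam] carrier_sum_group[of I M, OF group])

lemma carrier_sum_modE:
  assumes "x \<in> carrier S"
  obtains y where "x = Fam y" "y \<in> (\<Pi>\<^sub>E i\<in>I. carrier (M i))" "finite {i \<in> I. y i \<noteq> \<one>\<^bsub>M i\<^esub>}"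
  using assms by (auto simp: carrier_sum_mod)

lemma sum_mod_right_module: "right_module A S"
  unfolding sum_mod_def
  by (rule image_mod_right_module[OF direct_sum_right_module[OF ring_axioms module] inj_Fam])

lemma sum_mod_mult:
  assumes "x \<in> carrier S" "y \<in> carrier S"
  shows "x \<otimes>\<^bsub>S\<^esub> y = Fam (\<lambda>i\<in>I. unFam x i \<otimes>\<^bsub>M i\<^esub> unFam y i)"
  using assms by (auto simp: sum_mod_def carrier_image_mod[OF inj_Fam] mult_image_mod[OF inj_Fam] simp del: mult_sum_group)

lemma sum_mod_ract:
  assumes "x \<in> carrier S"
  shows "x \<triangleleft>\<^bsub>S\<^esub> r = Fam (\<lambda>i\<in>I. unFam x i \<triangleleft>\<^bsub>M i\<^esub> r)"
  using assms by (auto simp: sum_mod_def carrier_image_mod[OF inj_Fam] ract_image_mod[OF inj_Fam])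

lemma proj_map:
  assumes "i \<in> I"
  shows "rmod_map A S (M i) (\<lambda>x. unFam x i)"
  by (rule rmod_mapI[OF sum_mod_right_module module[OF assms]])
    (use assms in \<open>auto simp: sum_mod_mult sum_mod_ract elim!: carrier_sum_modE\<close>)

lemma sum_mod_eqI:
  assumes "x \<in> carrier S" "y \<in> carrier S" "\<And>i. i \<in> I \<Longrightarrow> unFam x i = unFam y i"
  shows "x = y"
proof -
  obtain x' y' where "x = Fam x'" "x' \<in> (\<Pi>\<^sub>E i\<in>I. carrier (M i))" "y = Fam y'" "y' \<in> (\<Pi>\<^sub>E i\<in>I. carrier (M i))"
    using assms(1,2) by (auto simp: carrier_sum_mod)
  then show ?thesis
    using assms(3) PiE_ext[of x' I _ y'] by simp
qed

lemma proj_incl: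
  assumes "j \<in> I"
  shows "unFam (sum_incl I M i m) j = (if j = i then m else \<one>\<^bsub>M j\<^esub>)"
  using assms by (simp add: sum_incl_def)

lemma incl_closed:
  assumes "i \<in> I" "m \<in> carrier (M i)"
  shows "sum_incl I M i m \<in> carrier S"
proof -
  have "finite {j \<in> I. (\<lambda>\<beta>\<in>I. if \<beta> = i then m else \<one>\<^bsub>M \<beta>\<^esub>) j \<noteq> \<one>\<^bsub>M j\<^esub>}"
    by (rule finite_subset[of _ "{i}"]) auto
  then show ?thesis
    using assms monoid.one_closed[OF group.is_monoid[OF group]]
    unfolding sum_incl_def carrier_sum_mod by (intro imageI) auto
qed

lemma incl_map:
  assumes i: "i \<in> I"
  shows "rmod_map A (M i) S (sum_incl I M i)"
proof -
  interpret Mi: right_module A "M i" by (rule module[OF i])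
  show ?thesis
  proof (rule rmod_mapI[OF module[OF i] sum_mod_right_module])
    show "sum_incl I M i x \<in> carrier S" if "x \<in> carrier (M i)" for x
      by (rule incl_closed[OF i that])
    show "sum_incl I M i (x \<otimes>\<^bsub>M i\<^esub> y) = sum_incl I M i x \<otimes>\<^bsub>S\<^esub> sum_incl I M i y"
      if "x \<in> carrier (M i)" "y \<in> carrier (M i)" for x y
      using that monoid.l_one[OF group.is_monoid[OF group]] monoid.one_closed[OF group.is_monoid[OF group]]
      by (auto simp: sum_mod_mult incl_closed[OF i] proj_incl) (auto simp: sum_incl_def intro!: restrict_ext)
    show "sum_incl I M i (x \<triangleleft>\<^bsub>M i\<^esub> r) = sum_incl I M i x \<triangleleft>\<^bsub>S\<^esub> r"
      if "x \<in> carrier (M i)" "r \<in> carrier A" for x r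
      using that ract_zero[OF module]
      by (auto simp: sum_mod_ract incl_closed[OF i]) (auto simp: sum_incl_def intro!: restrict_ext)
  qed
qed

text \<open>
  Compare coordinates: the projection to \<open>M\<^sub>j\<close> is a homomorphism, and it kills every summand except
  the one with index \<open>j\<close>.
\<close>

lemma sum_mod_decompose:
  assumes x: "x \<in> carrier S"
  shows "x = sum_lift S I M (sum_incl I M) x"
proof -
  interpret S: right_module A S by (rule sum_mod_right_module)
  obtain y where y: "x = Fam y" "y \<in> (\<Pi>\<^sub>E i\<in>I. carrier (M i))" "finite {i \<in> I. y i \<noteq> \<one>\<^bsub>M i\<^esub>}"
    using x by (rule carrier_sum_modE)
  let ?X = "{i \<in> I. y i \<noteq> \<one>\<^bsub>M i\<^esub>}"
  have incl: "(\<lambda>i. sum_incl I M i (y i)) \<in> ?X \<rightarrow> carrier S"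
    using y(2) by (auto intro!: incl_closed)
  have "unFam (finprod S (\<lambda>i. sum_incl I M i (y i)) ?X) j = y j" if j: "j \<in> I" for j
  proof -
    interpret Mj: right_module A "M j" by (rule module[OF j])
    have "unFam (finprod S (\<lambda>i. sum_incl I M i (y i)) ?X) j
        = finprod (M j) (\<lambda>i. unFam (sum_incl I M i (y i)) j) ?X"
      by (rule hom_finprod[OF S.module.comm_group_axioms Mj.module.comm_group_axioms rmod_mapD(4)[OF proj_map[OF j]] incl])
    also have "\<dots> = finprod (M j) (\<lambda>i. if i = j then y j else \<one>\<^bsub>M j\<^esub>) (insert j ?X)"
      by (rule Mj.module.finprod_mono_neutral_cong_left)
        (use y j in \<open>auto simp: proj_incl\<close>)
    also have "\<dots> = y j"
      using Mj.module.finprod_singleton_swap[of j "insert j ?X" "\<lambda>_. y j"] y j by auto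
    finally show ?thesis .
  qed
  note proj = this
  show ?thesis
    unfolding sum_lift_def y(1)
    by (rule sum_mod_eqI) (use x y(1) incl proj in simp_all)
qed

lemma sum_hom_ext:
  assumes H: "comm_group H" and f: "f \<in> hom S H" and g: "g \<in> hom S H"
    and eq: "\<And>i m. \<lbrakk>i \<in> I; m \<in> carrier (M i)\<rbrakk> \<Longrightarrow> f (sum_incl I M i m) = g (sum_incl I M i m)"
    and x: "x \<in> carrier S"
  shows "f x = g x"
proof -
  interpret S: right_module A S by (rule sum_mod_right_module)
  interpret H: comm_group H by fact
  let ?X = "{i \<in> I. unFam x i \<noteq> \<one>\<^bsub>M i\<^esub>}"
  have m: "unFam x i \<in> carrier (M i)" if "i \<in> I" for i
    by (rule rmod_mapD(5)[OF proj_map[OF that] x])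
  have hom: "h x = finprod H (\<lambda>i. h (sum_incl I M i (unFam x i))) ?X" if h: "h \<in> hom S H" for h
    by (subst sum_mod_decompose[OF x], unfold sum_lift_def,
        rule hom_finprod[OF S.module.comm_group_axioms H h])
      (use m in \<open>auto intro!: incl_closed\<close>)
  show ?thesis
    unfolding hom[OF f] hom[OF g]
    by (rule H.finprod_cong')
      (use m eq hom_in_carrier[OF g incl_closed] in auto)
qed

lemma sum_lift_incl:
  assumes H: "comm_group H" and f: "f i \<in> hom (M i) H" and i: "i \<in> I" and m: "m \<in> carrier (M i)"
  shows "sum_lift H I M f (sum_incl I M i m) = f i m"
proof -
  interpret H: comm_group H by fact
  interpret f: group_hom "M i" H "f i"
    using f by (simp add: group_hom_def group_hom_axioms_def group[OF i] H.is_group)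
  have supp: "{j \<in> I. unFam (sum_incl I M i m) j \<noteq> \<one>\<^bsub>M j\<^esub>} = (if m = \<one>\<^bsub>M i\<^esub> then {} else {i})"
    using i by (auto simp: proj_incl split: if_splits)
  show ?thesis
    using i m f.hom_closed[OF m] by (simp add: sum_lift_def supp proj_incl)
qed

text \<open>
  The index set of the sum in \<open>sum_lift\<close> depends on the argument. As the maps \<open>f i\<close> preserve zero, it
  may be replaced by the set of all indices whose summand is not zero; the resulting sum is additive by
  \<open>hom_group_sum\<close>.
\<close>

lemma sum_lift_hom:
  assumes H: "comm_group H" and f: "\<And>i. i \<in> I \<Longrightarrow> f i \<in> hom (M i) H"
  shows "sum_lift H I M f \<in> hom S H"
proof -
  interpret H: comm_group H by fact
  let ?g = "\<lambda>x. gfinprod H (\<lambda>i. f i (x i)) I"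
  have g: "?g \<in> hom (sum_group I M) H"
    by (rule H.hom_group_sum[where f = f and A = M and I = I]; fact f group)
  have *: "sum_lift H I M f (Fam y) = ?g y" if "y \<in> carrier (sum_group I M)" for y
  proof -
    let ?X = "{i \<in> I. y i \<noteq> \<one>\<^bsub>M i\<^esub>}"
    have y: "y \<in> (\<Pi>\<^sub>E i\<in>I. carrier (M i))" "finite ?X"
      using that by (simp_all add: carrier_sum_group[of I M, OF group])
    have fy: "f i (y i) \<in> carrier H" if "i \<in> I" for i
      using hom_in_carrier[OF f[OF that]] y(1) that by auto
    have "finprod H (\<lambda>i. f i (y i)) ?X = gfinprod H (\<lambda>i. f i (y i)) ?X"
      by (rule H.gfinprod_eq_finprod[symmetric]) (use y fy in auto)
    also have "\<dots> = ?g y"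
      by (rule H.gfinprod_mono_neutral_cong_left)
        (use fy in \<open>auto intro: hom_one[OF f group H.is_group]\<close>)
    finally show ?thesis
      by (simp add: sum_lift_def)
  qed
  show ?thesis
  proof (rule homI)
    fix x y assume x: "x \<in> carrier S" and y: "y \<in> carrier S"
    then obtain x' y' where x': "x = Fam x'" "x' \<in> carrier (sum_group I M)"
      and y': "y = Fam y'" "y' \<in> carrier (sum_group I M)"
      by (auto simp: sum_mod_def carrier_image_mod[OF inj_Fam])
    interpret sg: group "sum_group I M"
      by (simp add: group)
    have "x \<otimes>\<^bsub>S\<^esub> y = Fam (x' \<otimes>\<^bsub>sum_group I M\<^esub> y')"
      by (simp add: sum_mod_mult x y) (simp add: x' y')
    then show "sum_lift H I M f (x \<otimes>\<^bsub>S\<^esub> y) = sum_lift H I M f x \<otimes>\<^bsub>H\<^esub> sum_lift H I M f y"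
      using hom_mult[OF g x'(2) y'(2)] *[OF x'(2)] *[OF y'(2)] *[OF sg.m_closed[OF x'(2) y'(2)]]
      by (simp only: x'(1) y'(1))
    show "sum_lift H I M f x \<in> carrier H"
      unfolding x'(1) *[OF x'(2)] by (rule hom_in_carrier[OF g x'(2)])
  qed
qed

text \<open>
  Both sides of the scalar law are homomorphisms, so it suffices to look at one summand.
\<close>

lemma sum_lift_map:
  assumes P: "right_module A P" and f: "\<And>i. i \<in> I \<Longrightarrow> rmod_map A (M i) P (f i)"
  shows "rmod_map A S P (sum_lift P I M f)"
proof -
  interpret P: right_module A P by fact
  interpret S: right_module A S by (rule sum_mod_right_module)
  have fh: "f i \<in> hom (M i) P" if "i \<in> I" for i
    by (rule rmod_mapD(4)[OF f[OF that]])
  note hom = sum_lift_hom[OF P.module.comm_group_axioms fh]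
  have "sum_lift P I M f (x \<triangleleft>\<^bsub>S\<^esub> r) = sum_lift P I M f x \<triangleleft>\<^bsub>P\<^esub> r"
    if x: "x \<in> carrier S" and r: "r \<in> carrier A" for x r
  proof (rule sum_hom_ext[OF P.module.comm_group_axioms _ _ _ x])
    have "(\<lambda>x. x \<triangleleft>\<^bsub>S\<^esub> r) \<in> hom S S"
      using r by (auto simp: hom_def S.ract_closed S.ract_add_left)
    then show "(\<lambda>x. sum_lift P I M f (x \<triangleleft>\<^bsub>S\<^esub> r)) \<in> hom S P"
      by (rule hom_comp[OF _ hom])
    have P_hom: "(\<lambda>x. x \<triangleleft>\<^bsub>P\<^esub> r) \<in> hom P P"
      using r by (auto simp: hom_def P.ract_closed P.ract_add_left)
    show "(\<lambda>x. sum_lift P I M f x \<triangleleft>\<^bsub>P\<^esub> r) \<in> hom S P"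
      by (rule hom_comp[OF hom P_hom])
    fix i m assume i: "i \<in> I" and m: "m \<in> carrier (M i)"
    interpret Mi: right_module A "M i" by (rule module[OF i])
    show "sum_lift P I M f (sum_incl I M i m \<triangleleft>\<^bsub>S\<^esub> r) = sum_lift P I M f (sum_incl I M i m) \<triangleleft>\<^bsub>P\<^esub> r"
      using sum_lift_incl[where f = f and i = i, OF P.module.comm_group_axioms fh[OF i] i] i m r Mi.ract_closed[OF m r]
      by (simp add: rmod_mapD(7)[OF incl_map[OF i] m r, symmetric] rmod_mapD(7)[OF f[OF i] m r])
  qed
  with hom show ?thesis
    by (simp add: rmod_map_def rlinear_def P sum_mod_right_module)
qed

end

lemma (in module_family) tuple_map:
  assumes I: "finite I" and N: "right_module A N" and l: "\<And>i. i \<in> I \<Longrightarrow> rmod_map A N (M i) (l i)"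
  shows "rmod_map A N S (\<lambda>n. Fam (\<lambda>i\<in>I. l i n))"
proof -
  have closed: "Fam (\<lambda>i\<in>I. l i n) \<in> carrier S" if "n \<in> carrier N" for n
    unfolding carrier_sum_mod by (intro imageI) (use I rmod_mapD(5)[OF l that] in auto)
  show ?thesis
    by (rule rmod_mapI[OF N sum_mod_right_module closed])
      (auto simp: sum_mod_mult sum_mod_ract closed rmod_mapD(6)[OF l] rmod_mapD(7)[OF l] intro!: restrict_ext)
qed

section \<open>Tensor products of direct sums\<close>

lemma finprod_rtensor: "finprod (rtensor A M N) = finprod (tensor_group A M N)"
  by (simp add: finprod_def fun_eq_iff)

context module_family begin

text \<open>
  For finite \<open>I\<close> the identity of the direct sum is the sum of the maps \<open>incl\<^sub>i \<circ> proj\<^sub>i\<close>, and tensoring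
  with \<open>P\<close> preserves sums of maps.
\<close>

lemma tensor_sum_decompose:
  assumes I: "finite I" and P: "bimodule A P" and t: "t \<in> carrier (tensor_group A S P)"
  shows "t = (\<Otimes>\<^bsub>tensor_group A S P\<^esub>i\<in>I. tensor_map A S P (sum_incl I M i) (\<lambda>d. d)
    (tensor_map A (M i) P (\<lambda>x. unFam x i) (\<lambda>d. d) t))"
proof -
  let ?T = "tensor_group A S P"
  note S = sum_mod_right_module
  interpret S: right_module A S by (rule S)
  interpret T: comm_group ?T by (rule tensor_group_comm_group[OF S P])
  note idP = bimod_map_id[OF P]
  let ?c = "\<lambda>i t. tensor_map A S P (sum_incl I M i) (\<lambda>d. d) (tensor_map A (M i) P (\<lambda>x. unFam x i) (\<lambda>d. d) t)"
  have c_hom: "?c i \<in> hom ?T ?T" if "i \<in> I" for i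
    by (rule hom_comp[OF tensor_map_hom[OF proj_map[OF that] idP] tensor_map_hom[OF incl_map[OF that] idP]])
  have c_pure: "?c i (pure A S P x y) = pure A S P (sum_incl I M i (unFam x i)) y"
    if "i \<in> I" "x \<in> carrier S" "y \<in> carrier P" for i x y
    using that by (simp add: tensor_map_pure[OF proj_map idP] tensor_map_pure[OF incl_map idP] rmod_mapD(5)[OF proj_map])
  have hom: "(\<lambda>t. \<Otimes>\<^bsub>?T\<^esub>i\<in>I. ?c i t) \<in> hom ?T ?T"
  proof (rule homI)
    show "(\<Otimes>\<^bsub>?T\<^esub>i\<in>I. ?c i s) \<in> carrier ?T" if "s \<in> carrier ?T" for s
      using hom_in_carrier[OF c_hom that] by (intro T.finprod_closed) auto
    show "(\<Otimes>\<^bsub>?T\<^esub>i\<in>I. ?c i (s \<otimes>\<^bsub>?T\<^esub> u)) = (\<Otimes>\<^bsub>?T\<^esub>i\<in>I. ?c i s) \<otimes>\<^bsub>?T\<^esub> (\<Otimes>\<^bsub>?T\<^esub>i\<in>I. ?c i u)"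
      if "s \<in> carrier ?T" "u \<in> carrier ?T" for s u
    proof -
      note s = hom_in_carrier[OF c_hom that(1)] and u = hom_in_carrier[OF c_hom that(2)]
      have "(\<Otimes>\<^bsub>?T\<^esub>i\<in>I. ?c i (s \<otimes>\<^bsub>?T\<^esub> u)) = (\<Otimes>\<^bsub>?T\<^esub>i\<in>I. ?c i s \<otimes>\<^bsub>?T\<^esub> ?c i u)"
        by (rule T.finprod_cong') (use s u hom_mult[OF c_hom that] in auto)
      also have "\<dots> = (\<Otimes>\<^bsub>?T\<^esub>i\<in>I. ?c i s) \<otimes>\<^bsub>?T\<^esub> (\<Otimes>\<^bsub>?T\<^esub>i\<in>I. ?c i u)"
        by (rule T.finprod_multf) (use s u in auto)
      finally show ?thesis .
    qed
  qed
  show ?thesis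
  proof (rule tensor_hom_ext[OF S P T.is_group hom_id hom _ t])
    fix x y assume x: "x \<in> carrier S" and y: "y \<in> carrier P"
    have m: "unFam x i \<in> carrier (M i)" if "i \<in> I" for i
      by (rule rmod_mapD(5)[OF proj_map[OF that] x])
    have "x = (\<Otimes>\<^bsub>S\<^esub>i\<in>I. sum_incl I M i (unFam x i))"
      by (subst sum_mod_decompose[OF x], unfold sum_lift_def,
          rule S.module.finprod_mono_neutral_cong_left)
        (use I m in \<open>auto intro!: incl_closed hom_one[OF rmod_mapD(4)[OF incl_map] group S.module.is_group]\<close>)
    then have "pure A S P x y = pure A S P (\<Otimes>\<^bsub>S\<^esub>i\<in>I. sum_incl I M i (unFam x i)) y"
      by simp
    also have "\<dots> = (\<Otimes>\<^bsub>?T\<^esub>i\<in>I. pure A S P (sum_incl I M i (unFam x i)) y)"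
      by (rule hom_finprod[OF S.module.comm_group_axioms T.comm_group_axioms
            balanced_hom_left[OF pure_balanced[OF S P] y]])
        (use m incl_closed in auto)
    also have "\<dots> = (\<Otimes>\<^bsub>?T\<^esub>i\<in>I. ?c i (pure A S P x y))"
      by (rule T.finprod_cong')
        (use x y c_pure hom_in_carrier[OF c_hom pure_closed[OF x y]] in auto)
    finally show "pure A S P x y = (\<Otimes>\<^bsub>?T\<^esub>i\<in>I. ?c i (pure A S P x y))" .
  qed
qed

lemma tensor_sum_eqI:
  assumes I: "finite I" and P: "bimodule A P"
    and s: "s \<in> carrier (tensor_group A S P)" and t: "t \<in> carrier (tensor_group A S P)"
    and eq: "\<And>i. i \<in> I \<Longrightarrow> tensor_map A (M i) P (\<lambda>x. unFam x i) (\<lambda>d. d) s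
      = tensor_map A (M i) P (\<lambda>x. unFam x i) (\<lambda>d. d) t"
  shows "s = t"
proof -
  note S = sum_mod_right_module
  note idP = bimod_map_id[OF P]
  interpret T: comm_group "tensor_group A S P" by (rule tensor_group_comm_group[OF S P])
  show ?thesis
    by (subst tensor_sum_decompose[OF I P s], subst tensor_sum_decompose[OF I P t], rule T.finprod_cong')
      (use eq tensor_map_closed[OF incl_map idP tensor_map_closed[OF proj_map idP t]] in auto)
qed

end

definition sum_map :: "'g set \<Rightarrow> ('g \<Rightarrow> ('g, 'v) univ \<Rightarrow> ('g, 'v) univ) \<Rightarrow> ('g, 'v) univ \<Rightarrow> ('g, 'v) univ" where
  "sum_map I f x = Fam (\<lambda>i\<in>I. f i (unFam x i))"

lemma sum_map_map:
  assumes M: "module_family A I M" and N: "module_family A I N"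
    and f: "\<And>i. i \<in> I \<Longrightarrow> rmod_map A (M i) (N i) (f i)"
  shows "rmod_map A (sum_mod I M) (sum_mod I N) (sum_map I f)"
proof -
  interpret M: module_family A I M by fact
  interpret N: module_family A I N by fact
  have f1: "f i \<one>\<^bsub>M i\<^esub> = \<one>\<^bsub>N i\<^esub>" if "i \<in> I" for i
    by (rule hom_one[OF rmod_mapD(4)[OF f[OF that]] M.group[OF that] N.group[OF that]])
  have m: "unFam x i \<in> carrier (M i)" if "x \<in> carrier M.S" "i \<in> I" for x i
    by (rule rmod_mapD(5)[OF M.proj_map[OF that(2)] that(1)])
  have closed: "sum_map I f x \<in> carrier N.S" if x: "x \<in> carrier M.S" for x
  proof -
    have "finite {i \<in> I. (\<lambda>i\<in>I. f i (unFam x i)) i \<noteq> \<one>\<^bsub>N i\<^esub>}"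
      by (rule finite_subset[of _ "{i \<in> I. unFam x i \<noteq> \<one>\<^bsub>M i\<^esub>}"])
        (use x f1 in \<open>auto elim!: M.carrier_sum_modE\<close>)
    then show ?thesis
      unfolding sum_map_def N.carrier_sum_mod
      by (intro imageI) (use m[OF x] rmod_mapD(5)[OF f] in auto)
  qed
  show ?thesis
  proof (rule rmod_mapI[OF M.sum_mod_right_module N.sum_mod_right_module closed])
    fix x y assume x: "x \<in> carrier M.S" and y: "y \<in> carrier M.S"
    show "sum_map I f (x \<otimes>\<^bsub>M.S\<^esub> y) = sum_map I f x \<otimes>\<^bsub>N.S\<^esub> sum_map I f y"
      unfolding N.sum_mod_mult[OF closed[OF x] closed[OF y]] M.sum_mod_mult[OF x y]
      by (auto simp: sum_map_def m[OF x] m[OF y] rmod_mapD(6)[OF f] intro!: restrict_ext)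
  next
    fix x r assume x: "x \<in> carrier M.S" and r: "r \<in> carrier A"
    show "sum_map I f (x \<triangleleft>\<^bsub>M.S\<^esub> r) = sum_map I f x \<triangleleft>\<^bsub>N.S\<^esub> r"
      unfolding N.sum_mod_ract[OF closed[OF x]] M.sum_mod_ract[OF x]
      by (auto simp: sum_map_def m[OF x] rmod_mapD(7)[OF f _ r] intro!: restrict_ext)
  qed
qed

lemma sum_map_incl:
  assumes M: "module_family A I M" and N: "module_family A I N"
    and f: "\<And>i. i \<in> I \<Longrightarrow> rmod_map A (M i) (N i) (f i)"
  shows "sum_map I f (sum_incl I M i m) = sum_incl I N i (f i m)"
proof -
  interpret M: module_family A I M by fact
  interpret N: module_family A I N by fact
  have "f j \<one>\<^bsub>M j\<^esub> = \<one>\<^bsub>N j\<^esub>" if "j \<in> I" for j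
    by (rule hom_one[OF rmod_mapD(4)[OF f[OF that]] M.group[OF that] N.group[OF that]])
  then show ?thesis
    by (auto simp: sum_map_def sum_incl_def intro!: restrict_ext)
qed

section \<open>Morphisms of comodules\<close>

context group_coring begin

lemma comult_map:
  assumes "\<alpha> \<in> carrier G" "\<beta> \<in> carrier G"
  shows "bimod_map A (part C (\<alpha> \<otimes>\<^bsub>G\<^esub> \<beta>)) (bitensor A (part C \<alpha>) (part C \<beta>)) (comult C \<alpha> \<beta>)"
  using assms comult_bilinear by (simp add: bimod_map_def part_bimodule bitensor_bimodule)

lemma counit_map: "bimod_map A (part C \<one>\<^bsub>G\<^esub>) (ring_bimod A) (counit C)"
  using counit_bilinear by (simp add: bimod_map_def part_bimodule ring_bimod_bimodule base.ring_axioms)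

end

lemma (in right_comodule) cmod_module: "right_module A (cmod M)"
  by unfold_locales

lemma (in right_comodule) coact_map:
  assumes "\<alpha> \<in> carrier G"
  shows "rmod_map A (cmod M) (rtensor A (cmod M) (part C \<alpha>)) (coact M \<alpha>)"
  using coact_linear[OF assms] by (simp add: rmod_map_def cmod_module rtensor_right_module part_bimodule assms)

lemma (in right_gcomodule) gcoact_map:
  assumes "\<alpha> \<in> carrier G" "\<beta> \<in> carrier G"
  shows "rmod_map A (gmod M (\<alpha> \<otimes>\<^bsub>G\<^esub> \<beta>)) (rtensor A (gmod M \<alpha>) (part C \<beta>)) (gcoact M \<alpha> \<beta>)"
  using gcoact_linear[OF assms] by (simp add: rmod_map_def gmod_module rtensor_right_module part_bimodule assms)

text \<open>
  Morphisms of comodules and of graded comodules without the extensionality condition, so that they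
  compose as plain functions, followed by the two mixed kinds of compatible families.
\<close>

definition comod_map ::
  "('g, 'gz) monoid_scheme \<Rightarrow> ('r, 's) ring_scheme \<Rightarrow> ('g, 'r, 'c) coring_data \<Rightarrow>
   ('g, 'r, 'c, 'm) comod_data \<Rightarrow> ('g, 'r, 'c, 'n) comod_data \<Rightarrow> ('m \<Rightarrow> 'n) \<Rightarrow> bool"
where
  "comod_map G A C M N f \<longleftrightarrow> (\<forall>\<alpha>\<in>carrier G.
     colinear A (part C \<alpha>) (cmod M) (cmod M) (coact M \<alpha>) (cmod N) (cmod N) (coact N \<alpha>) f f)"

definition gcomod_map ::
  "('g, 'gz) monoid_scheme \<Rightarrow> ('r, 's) ring_scheme \<Rightarrow> ('g, 'r, 'c) coring_data \<Rightarrow>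
   ('g, 'r, 'c, 'm) gcomod_data \<Rightarrow> ('g, 'r, 'c, 'n) gcomod_data \<Rightarrow> ('g \<Rightarrow> 'm \<Rightarrow> 'n) \<Rightarrow> bool"
where
  "gcomod_map G A C M N f \<longleftrightarrow> (\<forall>\<alpha>\<in>carrier G. \<forall>\<beta>\<in>carrier G.
     colinear A (part C \<beta>) (gmod M (\<alpha> \<otimes>\<^bsub>G\<^esub> \<beta>)) (gmod M \<alpha>) (gcoact M \<alpha> \<beta>)
       (gmod N (\<alpha> \<otimes>\<^bsub>G\<^esub> \<beta>)) (gmod N \<alpha>) (gcoact N \<alpha> \<beta>) (f (\<alpha> \<otimes>\<^bsub>G\<^esub> \<beta>)) (f \<alpha>))"

definition family_to ::
  "('g, 'gz) monoid_scheme \<Rightarrow> ('r, 's) ring_scheme \<Rightarrow> ('g, 'r, 'c) coring_data \<Rightarrow>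
   ('g, 'r, 'c, 'm) gcomod_data \<Rightarrow> ('g, 'r, 'c, 'n) comod_data \<Rightarrow> ('g \<Rightarrow> 'm \<Rightarrow> 'n) \<Rightarrow> bool"
where
  "family_to G A C M N k \<longleftrightarrow> (\<forall>\<alpha>\<in>carrier G. \<forall>\<beta>\<in>carrier G.
     colinear A (part C \<beta>) (gmod M (\<alpha> \<otimes>\<^bsub>G\<^esub> \<beta>)) (gmod M \<alpha>) (gcoact M \<alpha> \<beta>)
       (cmod N) (cmod N) (coact N \<beta>) (k (\<alpha> \<otimes>\<^bsub>G\<^esub> \<beta>)) (k \<alpha>))"

definition family_from ::
  "('g, 'gz) monoid_scheme \<Rightarrow> ('r, 's) ring_scheme \<Rightarrow> ('g, 'r, 'c) coring_data \<Rightarrow>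
   ('g, 'r, 'c, 'n) comod_data \<Rightarrow> ('g, 'r, 'c, 'm) gcomod_data \<Rightarrow> ('g \<Rightarrow> 'n \<Rightarrow> 'm) \<Rightarrow> bool"
where
  "family_from G A C N M l \<longleftrightarrow> (\<forall>\<alpha>\<in>carrier G. \<forall>\<beta>\<in>carrier G.
     colinear A (part C \<beta>) (cmod N) (cmod N) (coact N \<beta>)
       (gmod M (\<alpha> \<otimes>\<^bsub>G\<^esub> \<beta>)) (gmod M \<alpha>) (gcoact M \<alpha> \<beta>) (l (\<alpha> \<otimes>\<^bsub>G\<^esub> \<beta>)) (l \<alpha>))"

context group_coring begin

lemma comod_map_rmod_map:
  assumes "comod_map G A C M N f"
  shows "rmod_map A (cmod M) (cmod N) f"
  using assms colinearD(4) one_closed unfolding comod_map_def by blast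

lemma gcomod_map_rmod_map:
  assumes "gcomod_map G A C M N f" "\<alpha> \<in> carrier G"
  shows "rmod_map A (gmod M \<alpha>) (gmod N \<alpha>) (f \<alpha>)"
  using assms colinearD(5) one_closed unfolding gcomod_map_def by blast

lemma family_to_rmod_map:
  assumes "family_to G A C M N f" "\<alpha> \<in> carrier G"
  shows "rmod_map A (gmod M \<alpha>) (cmod N) (f \<alpha>)"
  using assms colinearD(5) one_closed unfolding family_to_def by blast

lemma family_from_rmod_map:
  assumes "family_from G A C N M f" "\<alpha> \<in> carrier G"
  shows "rmod_map A (cmod N) (gmod M \<alpha>) (f \<alpha>)"
  using assms colinearD(5) one_closed unfolding family_from_def by blast

text \<open>
  The condition on coactions in \<open>Hom\<close> is the commutativity of the squares; the remaining parts of
  \<open>colinear\<close> are axioms of the objects. Linearity of \<open>f\<close> is visible in any square, for instance at the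
  unit of \<open>G\<close>.
\<close>

lemma Hom_comodules_iff:
  assumes "right_comodule G A C M" "right_comodule G A C N"
  shows "f \<in> Hom (comodules G A C) M N \<longleftrightarrow> f \<in> extensional (carrier (cmod M)) \<and> comod_map G A C M N f"
proof -
  interpret M: right_comodule G A C M by fact
  interpret N: right_comodule G A C N by fact
  have "comod_map G A C M N f \<longleftrightarrow> rlinear A (cmod M) (cmod N) f \<and>
      (\<forall>\<alpha>\<in>carrier G. \<forall>m\<in>carrier (cmod M).
        tensor_map A (cmod N) (part C \<alpha>) f (\<lambda>d. d) (coact M \<alpha> m) = coact N \<alpha> (f m))"
    using one_closed
    by (auto simp: comod_map_def colinear_def part_bimodule M.coact_map N.coact_map rmod_map_def[of A "cmod M" "cmod N"]
        M.cmod_module N.cmod_module)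
  then show ?thesis
    by (auto simp: comodules_def PiE_def rlinear_def hom_def)
qed

lemma Hom_gcomodules_iff:
  assumes "right_gcomodule G A C M" "right_gcomodule G A C N"
  shows "f \<in> Hom (gcomodules G A C) M N \<longleftrightarrow> f \<in> extensional (carrier G) \<and>
    (\<forall>\<alpha>\<in>carrier G. f \<alpha> \<in> extensional (carrier (gmod M \<alpha>))) \<and> gcomod_map G A C M N f"
proof -
  interpret M: right_gcomodule G A C M by fact
  interpret N: right_gcomodule G A C N by fact
  have "gcomod_map G A C M N f \<longleftrightarrow> (\<forall>\<alpha>\<in>carrier G. rlinear A (gmod M \<alpha>) (gmod N \<alpha>) (f \<alpha>)) \<and>
      (\<forall>\<alpha>\<in>carrier G. \<forall>\<beta>\<in>carrier G. \<forall>m\<in>carrier (gmod M (\<alpha> \<otimes>\<^bsub>G\<^esub> \<beta>)).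
        tensor_map A (gmod N \<alpha>) (part C \<beta>) (f \<alpha>) (\<lambda>d. d) (gcoact M \<alpha> \<beta> m)
        = gcoact N \<alpha> \<beta> (f (\<alpha> \<otimes>\<^bsub>G\<^esub> \<beta>) m))"
    (is "_ = ?R")
  proof
    assume "gcomod_map G A C M N f"
    with gcomod_map_rmod_map[OF this] show ?R
      by (auto simp: gcomod_map_def colinear_def rmod_map_def)
  next
    assume ?R
    then show "gcomod_map G A C M N f"
      by (auto simp: gcomod_map_def colinear_def part_bimodule M.gcoact_map N.gcoact_map
          rmod_map_def[of A "gmod M _" "gmod N _"] M.gmod_module N.gmod_module)
  qed
  then show ?thesis
    by (auto simp: gcomodules_def PiE_def rlinear_def hom_def Pi_iff)
qed

lemma comod_map_id:
  assumes "right_comodule G A C M"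
  shows "comod_map G A C M M (\<lambda>x. x)"
proof -
  interpret M: right_comodule G A C M by fact
  show ?thesis
    by (simp add: comod_map_def colinear_id part_bimodule M.coact_map M.cmod_module)
qed

lemma gcomod_map_id:
  assumes "right_gcomodule G A C M"
  shows "gcomod_map G A C M M (\<lambda>\<alpha> x. x)"
proof -
  interpret M: right_gcomodule G A C M by fact
  show ?thesis
    by (simp add: gcomod_map_def colinear_id part_bimodule M.gcoact_map M.gmod_module)
qed

text \<open>
  Every composite of maps of the four kinds is obtained by pasting squares.
\<close>

lemma
  shows comod_map_comp: "\<lbrakk>comod_map G A C L M f; comod_map G A C M N g\<rbrakk> \<Longrightarrow> comod_map G A C L N (\<lambda>x. g (f x))"
    and gcomod_map_comp: "\<lbrakk>gcomod_map G A C L' M' f'; gcomod_map G A C M' N' g'\<rbrakk>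
      \<Longrightarrow> gcomod_map G A C L' N' (\<lambda>\<alpha> x. g' \<alpha> (f' \<alpha> x))"
    and family_to_comp_comod_map: "\<lbrakk>family_to G A C L' M k; comod_map G A C M N g\<rbrakk>
      \<Longrightarrow> family_to G A C L' N (\<lambda>\<alpha> x. g (k \<alpha> x))"
    and gcomod_map_comp_family_to: "\<lbrakk>gcomod_map G A C L' M' f'; family_to G A C M' N k'\<rbrakk>
      \<Longrightarrow> family_to G A C L' N (\<lambda>\<alpha> x. k' \<alpha> (f' \<alpha> x))"
    and family_from_comp_gcomod_map: "\<lbrakk>family_from G A C L M' l; gcomod_map G A C M' N' g'\<rbrakk>
      \<Longrightarrow> family_from G A C L N' (\<lambda>\<alpha> x. g' \<alpha> (l \<alpha> x))"
    and comod_map_comp_family_from: "\<lbrakk>comod_map G A C L M f; family_from G A C M N' l'\<rbrakk>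
      \<Longrightarrow> family_from G A C L N' (\<lambda>\<alpha> x. l' \<alpha> (f x))"
    and family_to_comp_family_from: "\<lbrakk>family_to G A C L' M k; family_from G A C M N' l'\<rbrakk>
      \<Longrightarrow> gcomod_map G A C L' N' (\<lambda>\<alpha> x. l' \<alpha> (k \<alpha> x))"
  unfolding comod_map_def gcomod_map_def family_to_def family_from_def
  by (blast intro: colinear_comp)+

lemma comod_map_cong:
  assumes "comod_map G A C M N f" "\<And>x. x \<in> carrier (cmod M) \<Longrightarrow> g x = f x"
  shows "comod_map G A C M N g"
  using assms colinear_cong[of A _ _ _ _ _ _ _ f f g g] unfolding comod_map_def by metis

lemma gcomod_map_cong:
  assumes "gcomod_map G A C M N f" "\<And>\<alpha> x. \<lbrakk>\<alpha> \<in> carrier G; x \<in> carrier (gmod M \<alpha>)\<rbrakk> \<Longrightarrow> g \<alpha> x = f \<alpha> x"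
  shows "gcomod_map G A C M N g"
  unfolding gcomod_map_def
proof (intro ballI)
  fix \<alpha> \<beta> assume \<alpha>\<beta>: "\<alpha> \<in> carrier G" "\<beta> \<in> carrier G"
  then have sq: "colinear A (part C \<beta>) (gmod M (\<alpha> \<otimes>\<^bsub>G\<^esub> \<beta>)) (gmod M \<alpha>) (gcoact M \<alpha> \<beta>)
       (gmod N (\<alpha> \<otimes>\<^bsub>G\<^esub> \<beta>)) (gmod N \<alpha>) (gcoact N \<alpha> \<beta>) (f (\<alpha> \<otimes>\<^bsub>G\<^esub> \<beta>)) (f \<alpha>)"
    using assms(1) by (simp add: gcomod_map_def)
  show "colinear A (part C \<beta>) (gmod M (\<alpha> \<otimes>\<^bsub>G\<^esub> \<beta>)) (gmod M \<alpha>) (gcoact M \<alpha> \<beta>)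
       (gmod N (\<alpha> \<otimes>\<^bsub>G\<^esub> \<beta>)) (gmod N \<alpha>) (gcoact N \<alpha> \<beta>) (g (\<alpha> \<otimes>\<^bsub>G\<^esub> \<beta>)) (g \<alpha>)"
    by (rule colinear_cong[OF sq]) (use \<alpha>\<beta> assms(2) in auto)
qed

lemma family_from_cong:
  assumes "family_from G A C N M f" "\<And>\<alpha> x. \<lbrakk>\<alpha> \<in> carrier G; x \<in> carrier (cmod N)\<rbrakk> \<Longrightarrow> g \<alpha> x = f \<alpha> x"
  shows "family_from G A C N M g"
  unfolding family_from_def
proof (intro ballI)
  fix \<alpha> \<beta> assume \<alpha>\<beta>: "\<alpha> \<in> carrier G" "\<beta> \<in> carrier G"
  then have sq: "colinear A (part C \<beta>) (cmod N) (cmod N) (coact N \<beta>)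
       (gmod M (\<alpha> \<otimes>\<^bsub>G\<^esub> \<beta>)) (gmod M \<alpha>) (gcoact M \<alpha> \<beta>) (f (\<alpha> \<otimes>\<^bsub>G\<^esub> \<beta>)) (f \<alpha>)"
    using assms(1) by (simp add: family_from_def)
  show "colinear A (part C \<beta>) (cmod N) (cmod N) (coact N \<beta>)
       (gmod M (\<alpha> \<otimes>\<^bsub>G\<^esub> \<beta>)) (gmod M \<alpha>) (gcoact M \<alpha> \<beta>) (g (\<alpha> \<otimes>\<^bsub>G\<^esub> \<beta>)) (g \<alpha>)"
    by (rule colinear_cong[OF sq]) (use \<alpha>\<beta> assms(2) in auto)
qed

lemma comodules_simps [simp]:
  "Obj (comodules G A C) = {M. right_comodule G A C M}"
  "Idn (comodules G A C) M = (\<lambda>m\<in>carrier (cmod M). m)"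
  "Cmp (comodules G A C) M N P g f = compose (carrier (cmod M)) g f"
  by (simp_all add: comodules_def)

lemma gcomodules_simps [simp]:
  "Obj (gcomodules G A C) = {M. right_gcomodule G A C M}"
  "Idn (gcomodules G A C) M = (\<lambda>\<alpha>\<in>carrier G. \<lambda>m\<in>carrier (gmod M \<alpha>). m)"
  "Cmp (gcomodules G A C) M N P g' f' = (\<lambda>\<alpha>\<in>carrier G. compose (carrier (gmod M \<alpha>)) (g' \<alpha>) (f' \<alpha>))"
  by (simp_all add: gcomodules_def)

lemma comodules_category: "category (comodules G A C)"
proof (rule category.intro, unfold comodules_simps mem_Collect_eq)
  fix X assume X: "right_comodule G A C X"
  show "(\<lambda>m\<in>carrier (cmod X). m) \<in> Hom (comodules G A C) X X"
    by (auto simp: Hom_comodules_iff X intro: comod_map_cong[OF comod_map_id[OF X]])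
next
  fix X Y f assume X: "right_comodule G A C X" and Y: "right_comodule G A C Y"
    and f: "f \<in> Hom (comodules G A C) X Y"
  then have f: "f \<in> extensional (carrier (cmod X))" "comod_map G A C X Y f"
    by (simp_all add: Hom_comodules_iff)
  note f_closed = rmod_mapD(5)[OF comod_map_rmod_map[OF f(2)]]
  show "compose (carrier (cmod X)) f (\<lambda>m\<in>carrier (cmod X). m) = f"
    using f(1) by (auto simp: compose_def extensional_def fun_eq_iff)
  show "compose (carrier (cmod X)) (\<lambda>m\<in>carrier (cmod Y). m) f = f"
    using f(1) f_closed by (auto simp: compose_def extensional_def fun_eq_iff)
next
  fix X Y Z f g assume X: "right_comodule G A C X" and Y: "right_comodule G A C Y" and Z: "right_comodule G A C Z"
    and f: "f \<in> Hom (comodules G A C) X Y" and g: "g \<in> Hom (comodules G A C) Y Z"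
  then have "comod_map G A C X Z (\<lambda>x. g (f x))"
    by (auto simp: Hom_comodules_iff intro: comod_map_comp)
  then show "compose (carrier (cmod X)) g f \<in> Hom (comodules G A C) X Z"
    by (auto simp: Hom_comodules_iff X Z compose_def elim: comod_map_cong)
next
  fix W X Y Z f g h assume W: "right_comodule G A C W" and X: "right_comodule G A C X"
    and f: "f \<in> Hom (comodules G A C) W X"
  then have "comod_map G A C W X f"
    by (simp add: Hom_comodules_iff)
  note f_closed = rmod_mapD(5)[OF comod_map_rmod_map[OF this]]
  show "compose (carrier (cmod W)) h (compose (carrier (cmod W)) g f)
     = compose (carrier (cmod W)) (compose (carrier (cmod X)) h g) f"
    using f_closed by (auto simp: compose_def fun_eq_iff)
qed

lemma gcomodules_category: "category (gcomodules G A C)"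
proof (rule category.intro, unfold gcomodules_simps mem_Collect_eq)
  fix X assume X: "right_gcomodule G A C X"
  show "(\<lambda>\<alpha>\<in>carrier G. \<lambda>m\<in>carrier (gmod X \<alpha>). m) \<in> Hom (gcomodules G A C) X X"
    by (auto simp: Hom_gcomodules_iff X intro: gcomod_map_cong[OF gcomod_map_id[OF X]])
next
  fix X Y f assume X: "right_gcomodule G A C X" and Y: "right_gcomodule G A C Y"
    and f: "f \<in> Hom (gcomodules G A C) X Y"
  then have f: "f \<in> extensional (carrier G)" "\<And>\<alpha>. \<alpha> \<in> carrier G \<Longrightarrow> f \<alpha> \<in> extensional (carrier (gmod X \<alpha>))"
    "gcomod_map G A C X Y f"
    by (simp_all add: Hom_gcomodules_iff)
  note f_closed = rmod_mapD(5)[OF gcomod_map_rmod_map[OF f(3)]]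
  show "(\<lambda>\<alpha>\<in>carrier G. compose (carrier (gmod X \<alpha>)) (f \<alpha>) ((\<lambda>\<alpha>\<in>carrier G. \<lambda>m\<in>carrier (gmod X \<alpha>). m) \<alpha>)) = f"
    by (rule extensionalityI[OF _ f(1)]) (use f(2) in \<open>auto simp: compose_def extensional_def fun_eq_iff\<close>)
  show "(\<lambda>\<alpha>\<in>carrier G. compose (carrier (gmod X \<alpha>)) ((\<lambda>\<alpha>\<in>carrier G. \<lambda>m\<in>carrier (gmod Y \<alpha>). m) \<alpha>) (f \<alpha>)) = f"
    by (rule extensionalityI[OF _ f(1)]) (use f(2) f_closed in \<open>auto simp: compose_def extensional_def fun_eq_iff\<close>)
next
  fix X Y Z f g assume X: "right_gcomodule G A C X" and Y: "right_gcomodule G A C Y" and Z: "right_gcomodule G A C Z"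
    and f: "f \<in> Hom (gcomodules G A C) X Y" and g: "g \<in> Hom (gcomodules G A C) Y Z"
  then have "gcomod_map G A C X Z (\<lambda>\<alpha> x. g \<alpha> (f \<alpha> x))"
    by (auto simp: Hom_gcomodules_iff intro: gcomod_map_comp)
  then show "(\<lambda>\<alpha>\<in>carrier G. compose (carrier (gmod X \<alpha>)) (g \<alpha>) (f \<alpha>)) \<in> Hom (gcomodules G A C) X Z"
    by (auto simp: Hom_gcomodules_iff X Z compose_def elim: gcomod_map_cong)
next
  fix W X Y Z f g h assume W: "right_gcomodule G A C W" and X: "right_gcomodule G A C X"
    and f: "f \<in> Hom (gcomodules G A C) W X"
  then have "gcomod_map G A C W X f"
    by (simp add: Hom_gcomodules_iff)
  note f_closed = rmod_mapD(5)[OF gcomod_map_rmod_map[OF this]]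
  show "(\<lambda>\<alpha>\<in>carrier G. compose (carrier (gmod W \<alpha>)) (h \<alpha>)
        ((\<lambda>\<alpha>\<in>carrier G. compose (carrier (gmod W \<alpha>)) (g \<alpha>) (f \<alpha>)) \<alpha>))
     = (\<lambda>\<alpha>\<in>carrier G. compose (carrier (gmod W \<alpha>))
        ((\<lambda>\<alpha>\<in>carrier G. compose (carrier (gmod X \<alpha>)) (h \<alpha>) (g \<alpha>)) \<alpha>) (f \<alpha>))"
    using f_closed by (auto simp: compose_def fun_eq_iff)
qed

end

section \<open>The direct sum of a graded comodule\<close>

text \<open>
  The functor \<open>F\<^sub>1\<close> is defined on graded comodules carried by the universe \<open>univ\<close>, where the direct sum
  of the components exists.
\<close>

locale universe_gcomodule = right_gcomodule G A C M
  for G :: "('g, 'gz) monoid_scheme" and A :: "('r, 's) ring_scheme"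
    and C :: "('g, 'r, 'c) coring_data" and M :: "('g, 'r, 'c, ('g, 'v) univ) gcomod_data"
begin

sublocale family: module_family A "carrier G" "gmod M"
  by (simp add: module_family_def module_family_axioms_def base.ring_axioms gmod_module)

abbreviation "incl \<equiv> sum_incl (carrier G) (gmod M)"

lemma cmod_F1 [simp]: "cmod (F1_obj G A C M) = family.S"
  by (simp add: F1_obj_def Let_def)

lemma coact_F1:
  "coact (F1_obj G A C M) \<alpha> = sum_lift (rtensor A family.S (part C \<alpha>)) (carrier G) (gmod M)
     (\<lambda>\<beta> m. tensor_map A family.S (part C \<alpha>) (incl (\<beta> \<otimes>\<^bsub>G\<^esub> inv\<^bsub>G\<^esub> \<alpha>)) (\<lambda>d. d) (gcoact M (\<beta> \<otimes>\<^bsub>G\<^esub> inv\<^bsub>G\<^esub> \<alpha>) \<alpha> m))"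
  by (simp add: F1_obj_def Let_def sum_lift_def fun_eq_iff finprod_rtensor)

lemma right_cancel: "\<lbrakk>\<alpha> \<in> carrier G; \<beta> \<in> carrier G\<rbrakk> \<Longrightarrow> \<beta> \<otimes>\<^bsub>G\<^esub> inv\<^bsub>G\<^esub> \<alpha> \<otimes>\<^bsub>G\<^esub> \<alpha> = \<beta>"
  by (simp add: m_assoc)

lemma F1_component_map:
  assumes \<alpha>: "\<alpha> \<in> carrier G" and \<beta>: "\<beta> \<in> carrier G"
  shows "rmod_map A (gmod M \<beta>) (rtensor A family.S (part C \<alpha>))
     (\<lambda>m. tensor_map A family.S (part C \<alpha>) (incl (\<beta> \<otimes>\<^bsub>G\<^esub> inv\<^bsub>G\<^esub> \<alpha>)) (\<lambda>d. d) (gcoact M (\<beta> \<otimes>\<^bsub>G\<^esub> inv\<^bsub>G\<^esub> \<alpha>) \<alpha> m))"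
proof -
  have \<gamma>: "\<beta> \<otimes>\<^bsub>G\<^esub> inv\<^bsub>G\<^esub> \<alpha> \<in> carrier G"
    using \<alpha> \<beta> by simp
  have "rmod_map A (gmod M \<beta>) (rtensor A (gmod M (\<beta> \<otimes>\<^bsub>G\<^esub> inv\<^bsub>G\<^esub> \<alpha>)) (part C \<alpha>)) (gcoact M (\<beta> \<otimes>\<^bsub>G\<^esub> inv\<^bsub>G\<^esub> \<alpha>) \<alpha>)"
    using gcoact_map[OF \<gamma> \<alpha>] by (simp add: right_cancel \<alpha> \<beta>)
  then show ?thesis
    by (rule rmod_map_comp[OF _ tensor_map_rmod_map[OF family.incl_map[OF \<gamma>] bimod_map_id[OF part_bimodule[OF \<alpha>]]]])
qed

lemma coact_F1_map:
  assumes \<alpha>: "\<alpha> \<in> carrier G"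
  shows "rmod_map A family.S (rtensor A family.S (part C \<alpha>)) (coact (F1_obj G A C M) \<alpha>)"
  unfolding coact_F1
  by (rule family.sum_lift_map[OF rtensor_right_module[OF family.sum_mod_right_module part_bimodule[OF \<alpha>]] F1_component_map[OF \<alpha>]])

text \<open>
  The index \<open>\<gamma>\<alpha>\<close> replaces the index \<open>\<beta>\<close> of the definition and removes the inverse: \<open>\<beta>\<alpha>\<^sup>-\<^sup>1 = \<gamma>\<close>.
\<close>

lemma coact_F1_incl:
  assumes \<gamma>: "\<gamma> \<in> carrier G" and \<alpha>: "\<alpha> \<in> carrier G" and m: "m \<in> carrier (gmod M (\<gamma> \<otimes>\<^bsub>G\<^esub> \<alpha>))"
  shows "coact (F1_obj G A C M) \<alpha> (incl (\<gamma> \<otimes>\<^bsub>G\<^esub> \<alpha>) m)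
    = tensor_map A family.S (part C \<alpha>) (incl \<gamma>) (\<lambda>d. d) (gcoact M \<gamma> \<alpha> m)"
proof -
  have \<gamma>\<alpha>: "\<gamma> \<otimes>\<^bsub>G\<^esub> \<alpha> \<in> carrier G" and cancel: "\<gamma> \<otimes>\<^bsub>G\<^esub> \<alpha> \<otimes>\<^bsub>G\<^esub> inv\<^bsub>G\<^esub> \<alpha> = \<gamma>"
    using \<gamma> \<alpha> by (simp_all add: m_assoc)
  have "comm_group (rtensor A family.S (part C \<alpha>))"
    by (rule right_module_comm_group[OF rtensor_right_module[OF family.sum_mod_right_module part_bimodule[OF \<alpha>]]])
  from family.sum_lift_incl[where f = "\<lambda>\<beta> m. tensor_map A family.S (part C \<alpha>) (incl (\<beta> \<otimes>\<^bsub>G\<^esub> inv\<^bsub>G\<^esub> \<alpha>)) (\<lambda>d. d)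
        (gcoact M (\<beta> \<otimes>\<^bsub>G\<^esub> inv\<^bsub>G\<^esub> \<alpha>) \<alpha> m)" and i = "\<gamma> \<otimes>\<^bsub>G\<^esub> \<alpha>",
      OF this rmod_mapD(4)[OF F1_component_map[OF \<alpha> \<gamma>\<alpha>]] \<gamma>\<alpha> m]
  show ?thesis
    by (simp add: coact_F1 cancel)
qed

lemma incl_family: "family_to G A C M (F1_obj G A C M) incl"
  by (auto simp: family_to_def part_bimodule gcoact_map coact_F1_map family.incl_map coact_F1_incl intro!: colinearI)

lemma incl_colinear:
  assumes "\<alpha> \<in> carrier G" "\<beta> \<in> carrier G"
  shows "colinear A (part C \<beta>) (gmod M (\<alpha> \<otimes>\<^bsub>G\<^esub> \<beta>)) (gmod M \<alpha>) (gcoact M \<alpha> \<beta>)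
       family.S family.S (coact (F1_obj G A C M) \<beta>) (incl (\<alpha> \<otimes>\<^bsub>G\<^esub> \<beta>)) (incl \<alpha>)"
  using incl_family assms by (simp add: family_to_def)

text \<open>
  Both sides of each axiom are additive, so it suffices to check it on the image of an inclusion
  \<open>M\<^sub>\<gamma> \<rightarrow> F\<^sub>1(M)\<close>, where it is transported from \<open>M\<close> along the squares formed by the inclusions.
\<close>

lemma F1_comodule: "right_comodule G A C (F1_obj G A C M)"
proof (rule right_comodule.intro[OF group_coring_axioms _ right_comodule_axioms.intro], unfold cmod_F1)
  let ?r = "coact (F1_obj G A C M)"
  note S = family.sum_mod_right_module
  note idS = rmod_map_id[OF S]
  show "right_module A family.S" by (rule S)
  show "rlinear A family.S (rtensor A family.S (part C \<alpha>)) (?r \<alpha>)" if "\<alpha> \<in> carrier G" for \<alpha>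
    by (rule rmod_mapD(3)[OF coact_F1_map[OF that]])
  show "right_unitor family.S (tensor_map A family.S (ring_bimod A) (\<lambda>x. x) (counit C) (?r \<one>\<^bsub>G\<^esub> x)) = x"
    if x: "x \<in> carrier family.S" for x
  proof (rule family.sum_hom_ext[OF right_module_comm_group[OF S] _ hom_id _ x])
    have "?r \<one>\<^bsub>G\<^esub> \<in> hom family.S (tensor_group A family.S (part C \<one>\<^bsub>G\<^esub>))"
      using rmod_mapD(4)[OF coact_F1_map[OF one_closed]] by simp
    from hom_comp[OF hom_comp[OF this tensor_map_hom[OF idS counit_map]] right_unitor_hom[OF S]]
    show "(\<lambda>x. right_unitor family.S (tensor_map A family.S (ring_bimod A) (\<lambda>x. x) (counit C) (?r \<one>\<^bsub>G\<^esub> x)))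
      \<in> hom family.S family.S" .
    fix \<gamma> m assume \<gamma>: "\<gamma> \<in> carrier G" and m: "m \<in> carrier (gmod M \<gamma>)"
    have sq: "colinear A (part C \<one>\<^bsub>G\<^esub>) (gmod M \<gamma>) (gmod M \<gamma>) (gcoact M \<gamma> \<one>\<^bsub>G\<^esub>)
       family.S family.S (?r \<one>\<^bsub>G\<^esub>) (incl \<gamma>) (incl \<gamma>)"
      using incl_colinear[OF \<gamma> one_closed] \<gamma> by simp
    show "right_unitor family.S (tensor_map A family.S (ring_bimod A) (\<lambda>x. x) (counit C) (?r \<one>\<^bsub>G\<^esub> (incl \<gamma> m))) = incl \<gamma> m"
      by (rule counit_transport[OF counit_map sq m gcoact_counit[OF \<gamma> m]])
  qed
  show "tensor_map A family.S (bitensor A (part C \<alpha>) (part C \<beta>)) (\<lambda>x. x) (comult C \<alpha> \<beta>) (?r (\<alpha> \<otimes>\<^bsub>G\<^esub> \<beta>) x)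
      = tensor_assoc A family.S (part C \<alpha>) (part C \<beta>)
          (tensor_map A (rtensor A family.S (part C \<alpha>)) (part C \<beta>) (?r \<alpha>) (\<lambda>d. d) (?r \<beta> x))"
    if \<alpha>: "\<alpha> \<in> carrier G" and \<beta>: "\<beta> \<in> carrier G" and x: "x \<in> carrier family.S" for \<alpha> \<beta> x
  proof -
    note P = part_bimodule[OF \<alpha>] and Q = part_bimodule[OF \<beta>]
    note PQ = bitensor_bimodule[OF P Q]
    have \<alpha>\<beta>: "\<alpha> \<otimes>\<^bsub>G\<^esub> \<beta> \<in> carrier G"
      using \<alpha> \<beta> by simp
    have r_hom: "?r \<delta> \<in> hom family.S (tensor_group A family.S (part C \<delta>))" if "\<delta> \<in> carrier G" for \<delta>
      using rmod_mapD(4)[OF coact_F1_map[OF that]] by simp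
    show ?thesis
    proof (rule family.sum_hom_ext[OF tensor_group_comm_group[OF S PQ]
          hom_comp[OF r_hom[OF \<alpha>\<beta>] tensor_map_hom[OF idS comult_map[OF \<alpha> \<beta>]]]
          hom_comp[OF hom_comp[OF r_hom[OF \<beta>] tensor_map_hom[OF coact_F1_map[OF \<alpha>] bimod_map_id[OF Q]]] assoc_hom[OF S P Q]]
          _ x])
      fix \<gamma> m assume \<gamma>: "\<gamma> \<in> carrier G" and m: "m \<in> carrier (gmod M \<gamma>)"
      \<comment> \<open>The coaction of \<open>\<alpha>\<beta>\<close> takes degree \<open>\<gamma>\<close> to degree \<open>\<delta>\<close>, passing through \<open>\<delta>\<alpha>\<close>.\<close>
      define \<delta> where "\<delta> = \<gamma> \<otimes>\<^bsub>G\<^esub> inv\<^bsub>G\<^esub> (\<alpha> \<otimes>\<^bsub>G\<^esub> \<beta>)"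
      have \<delta>: "\<delta> \<in> carrier G" and \<gamma>_eq: "\<gamma> = \<delta> \<otimes>\<^bsub>G\<^esub> (\<alpha> \<otimes>\<^bsub>G\<^esub> \<beta>)" "\<gamma> = \<delta> \<otimes>\<^bsub>G\<^esub> \<alpha> \<otimes>\<^bsub>G\<^esub> \<beta>"
        using \<alpha> \<beta> \<gamma> by (simp_all add: \<delta>_def right_cancel flip: m_assoc) (simp_all add: m_assoc)
      have sq01: "colinear A (part C \<beta>) (gmod M \<gamma>) (gmod M (\<delta> \<otimes>\<^bsub>G\<^esub> \<alpha>)) (gcoact M (\<delta> \<otimes>\<^bsub>G\<^esub> \<alpha>) \<beta>)
         family.S family.S (?r \<beta>) (incl \<gamma>) (incl (\<delta> \<otimes>\<^bsub>G\<^esub> \<alpha>))"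
        using incl_colinear[of "\<delta> \<otimes>\<^bsub>G\<^esub> \<alpha>" \<beta>] \<alpha> \<beta> \<delta> by (simp add: \<gamma>_eq(2))
      have sq02: "colinear A (part C (\<alpha> \<otimes>\<^bsub>G\<^esub> \<beta>)) (gmod M \<gamma>) (gmod M \<delta>) (gcoact M \<delta> (\<alpha> \<otimes>\<^bsub>G\<^esub> \<beta>))
         family.S family.S (?r (\<alpha> \<otimes>\<^bsub>G\<^esub> \<beta>)) (incl \<gamma>) (incl \<delta>)"
        using incl_colinear[OF \<delta> \<alpha>\<beta>] by (simp add: \<gamma>_eq(1))
      show "tensor_map A family.S (bitensor A (part C \<alpha>) (part C \<beta>)) (\<lambda>x. x) (comult C \<alpha> \<beta>) (?r (\<alpha> \<otimes>\<^bsub>G\<^esub> \<beta>) (incl \<gamma> m))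
        = tensor_assoc A family.S (part C \<alpha>) (part C \<beta>)
            (tensor_map A (rtensor A family.S (part C \<alpha>)) (part C \<beta>) (?r \<alpha>) (\<lambda>d. d) (?r \<beta> (incl \<gamma> m)))"
        by (rule coassoc_transport[OF P Q comult_map[OF \<alpha> \<beta>] sq01 incl_colinear[OF \<delta> \<alpha>] sq02 m])
          (use gcoact_coassoc[OF \<delta> \<alpha> \<beta>] m in \<open>simp add: \<gamma>_eq(2)\<close>)
    qed
  qed
qed

text \<open>
  Half of the first adjunction: the square of \<open>h\<close> may be tested after restriction to each summand, where
  it is the square of the family \<open>h \<circ> incl\<close>.
\<close>

lemma comod_map_from_F1I:
  assumes N: "right_comodule G A C N" and h: "rmod_map A family.S (cmod N) h"
    and k: "family_to G A C M N (\<lambda>\<alpha> m. h (incl \<alpha> m))"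
  shows "comod_map G A C (F1_obj G A C M) N h"
  unfolding comod_map_def cmod_F1
proof (intro ballI colinearI)
  interpret N: right_comodule G A C N by fact
  fix \<alpha> assume \<alpha>: "\<alpha> \<in> carrier G"
  show P: "bimodule A (part C \<alpha>)" by (rule part_bimodule[OF \<alpha>])
  show r: "rmod_map A family.S (rtensor A family.S (part C \<alpha>)) (coact (F1_obj G A C M) \<alpha>)"
    by (rule coact_F1_map[OF \<alpha>])
  show s: "rmod_map A (cmod N) (rtensor A (cmod N) (part C \<alpha>)) (coact N \<alpha>)"
    by (rule N.coact_map[OF \<alpha>])
  show "rmod_map A family.S (cmod N) h" by (rule h)
  show "rmod_map A family.S (cmod N) h" by (rule h)
  note idP = bimod_map_id[OF P]
  show "tensor_map A (cmod N) (part C \<alpha>) h (\<lambda>d. d) (coact (F1_obj G A C M) \<alpha> x) = coact N \<alpha> (h x)"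
    if x: "x \<in> carrier family.S" for x
  proof (rule family.sum_hom_ext[OF tensor_group_comm_group[OF N.cmod_module P] hom_comp[OF _ tensor_map_hom[OF h idP]]
        hom_comp[OF rmod_mapD(4)[OF h]] _ x])
    show "coact (F1_obj G A C M) \<alpha> \<in> hom family.S (tensor_group A family.S (part C \<alpha>))"
      using rmod_mapD(4)[OF r] by simp
    show "coact N \<alpha> \<in> hom (cmod N) (tensor_group A (cmod N) (part C \<alpha>))"
      using rmod_mapD(4)[OF s] by simp
    fix \<beta> m assume \<beta>: "\<beta> \<in> carrier G" and m: "m \<in> carrier (gmod M \<beta>)"
    \<comment> \<open>The coaction takes degree \<open>\<beta>\<close> to degree \<open>\<gamma>\<close>.\<close>
    define \<gamma> where "\<gamma> = \<beta> \<otimes>\<^bsub>G\<^esub> inv\<^bsub>G\<^esub> \<alpha>"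
    have \<gamma>: "\<gamma> \<in> carrier G" and \<beta>_eq: "\<beta> = \<gamma> \<otimes>\<^bsub>G\<^esub> \<alpha>"
      using \<alpha> \<beta> by (simp_all add: \<gamma>_def right_cancel)
    note sq = incl_colinear[OF \<gamma> \<alpha>, folded \<beta>_eq]
    have "colinear A (part C \<alpha>) (gmod M \<beta>) (gmod M \<gamma>) (gcoact M \<gamma> \<alpha>)
       (cmod N) (cmod N) (coact N \<alpha>) (\<lambda>m. h (incl \<beta> m)) (\<lambda>m. h (incl \<gamma> m))"
      using k \<gamma> \<alpha> by (auto simp: family_to_def \<beta>_eq)
    from colinearD(6)[OF this m]
    show "tensor_map A (cmod N) (part C \<alpha>) h (\<lambda>d. d) (coact (F1_obj G A C M) \<alpha> (incl \<beta> m)) = coact N \<alpha> (h (incl \<beta> m))"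
      by (simp only: colinearD(6)[OF sq m, symmetric] tensor_map_comp[OF colinearD(5)[OF sq] h idP idP colinearD(7)[OF sq m]])
  qed
qed

lemma sum_lift_comod_map:
  assumes N: "right_comodule G A C N" and k: "family_to G A C M N k"
  shows "comod_map G A C (F1_obj G A C M) N (sum_lift (cmod N) (carrier G) (gmod M) k)"
proof -
  interpret N: right_comodule G A C N by fact
  have k_map: "rmod_map A (gmod M \<alpha>) (cmod N) (k \<alpha>)" if "\<alpha> \<in> carrier G" for \<alpha>
    by (rule family_to_rmod_map[OF k that])
  have eq: "sum_lift (cmod N) (carrier G) (gmod M) k (incl \<alpha> m) = k \<alpha> m"
    if "\<alpha> \<in> carrier G" "m \<in> carrier (gmod M \<alpha>)" for \<alpha> m
    by (rule family.sum_lift_incl[where f = k and i = \<alpha>,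
          OF right_module_comm_group[OF N.cmod_module] rmod_mapD(4)[OF k_map[OF that(1)]] that])
  show ?thesis
  proof (rule comod_map_from_F1I[OF N family.sum_lift_map[OF N.cmod_module k_map]])
    show "family_to G A C M N (\<lambda>\<alpha> m. sum_lift (cmod N) (carrier G) (gmod M) k (incl \<alpha> m))"
      unfolding family_to_def
    proof (intro ballI)
      fix \<alpha> \<beta> assume \<alpha>: "\<alpha> \<in> carrier G" and \<beta>: "\<beta> \<in> carrier G"
      then have "colinear A (part C \<beta>) (gmod M (\<alpha> \<otimes>\<^bsub>G\<^esub> \<beta>)) (gmod M \<alpha>) (gcoact M \<alpha> \<beta>)
         (cmod N) (cmod N) (coact N \<beta>) (k (\<alpha> \<otimes>\<^bsub>G\<^esub> \<beta>)) (k \<alpha>)"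
        using k by (simp add: family_to_def)
      then show "colinear A (part C \<beta>) (gmod M (\<alpha> \<otimes>\<^bsub>G\<^esub> \<beta>)) (gmod M \<alpha>) (gcoact M \<alpha> \<beta>)
         (cmod N) (cmod N) (coact N \<beta>) (\<lambda>m. sum_lift (cmod N) (carrier G) (gmod M) k (incl (\<alpha> \<otimes>\<^bsub>G\<^esub> \<beta>) m))
         (\<lambda>m. sum_lift (cmod N) (carrier G) (gmod M) k (incl \<alpha> m))"
        by (rule colinear_cong) (use \<alpha> \<beta> in \<open>simp_all add: eq\<close>)
    qed
  qed
qed

text \<open>
  On the summand of degree \<open>\<delta>\<alpha>\<close> the coaction lands in \<open>M\<^sub>\<delta> \<otimes> C\<^sub>\<alpha>\<close>. Projecting to degree \<open>\<gamma>\<close> gives the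
  coaction of \<open>M\<close> if \<open>\<delta> = \<gamma>\<close>. Otherwise both sides vanish, because \<open>\<delta>\<alpha> \<noteq> \<gamma>\<alpha>\<close> in a group.
\<close>

lemma proj_family: "family_from G A C (F1_obj G A C M) M (\<lambda>\<alpha> x. unFam x \<alpha>)"
  unfolding family_from_def cmod_F1
proof (intro ballI colinearI)
  fix \<gamma> \<alpha> assume \<gamma>: "\<gamma> \<in> carrier G" and \<alpha>: "\<alpha> \<in> carrier G"
  then have \<gamma>\<alpha>: "\<gamma> \<otimes>\<^bsub>G\<^esub> \<alpha> \<in> carrier G" by simp
  show P: "bimodule A (part C \<alpha>)" by (rule part_bimodule[OF \<alpha>])
  show r: "rmod_map A family.S (rtensor A family.S (part C \<alpha>)) (coact (F1_obj G A C M) \<alpha>)"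
    by (rule coact_F1_map[OF \<alpha>])
  show s: "rmod_map A (gmod M (\<gamma> \<otimes>\<^bsub>G\<^esub> \<alpha>)) (rtensor A (gmod M \<gamma>) (part C \<alpha>)) (gcoact M \<gamma> \<alpha>)"
    by (rule gcoact_map[OF \<gamma> \<alpha>])
  show proj0: "rmod_map A family.S (gmod M (\<gamma> \<otimes>\<^bsub>G\<^esub> \<alpha>)) (\<lambda>x. unFam x (\<gamma> \<otimes>\<^bsub>G\<^esub> \<alpha>))"
    by (rule family.proj_map[OF \<gamma>\<alpha>])
  show proj1: "rmod_map A family.S (gmod M \<gamma>) (\<lambda>x. unFam x \<gamma>)"
    by (rule family.proj_map[OF \<gamma>])
  note idP = bimod_map_id[OF P]
  let ?T = "tensor_group A (gmod M \<gamma>) (part C \<alpha>)"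
  interpret T: comm_group ?T
    by (rule tensor_group_comm_group[OF gmod_module[OF \<gamma>] P])
  show "tensor_map A (gmod M \<gamma>) (part C \<alpha>) (\<lambda>x. unFam x \<gamma>) (\<lambda>d. d) (coact (F1_obj G A C M) \<alpha> x)
      = gcoact M \<gamma> \<alpha> (unFam x (\<gamma> \<otimes>\<^bsub>G\<^esub> \<alpha>))"
    if x: "x \<in> carrier family.S" for x
  proof (rule family.sum_hom_ext[OF T.comm_group_axioms hom_comp[OF _ tensor_map_hom[OF proj1 idP]]
        hom_comp[OF rmod_mapD(4)[OF proj0]] _ x])
    show "coact (F1_obj G A C M) \<alpha> \<in> hom family.S (tensor_group A family.S (part C \<alpha>))"
      using rmod_mapD(4)[OF r] by simp
    show s_hom: "gcoact M \<gamma> \<alpha> \<in> hom (gmod M (\<gamma> \<otimes>\<^bsub>G\<^esub> \<alpha>)) ?T"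
      using rmod_mapD(4)[OF s] by simp
    fix \<beta> m assume \<beta>: "\<beta> \<in> carrier G" and m: "m \<in> carrier (gmod M \<beta>)"
    define \<delta> where "\<delta> = \<beta> \<otimes>\<^bsub>G\<^esub> inv\<^bsub>G\<^esub> \<alpha>"
    have \<delta>: "\<delta> \<in> carrier G" and \<beta>_eq: "\<beta> = \<delta> \<otimes>\<^bsub>G\<^esub> \<alpha>"
      using \<alpha> \<beta> by (simp_all add: \<delta>_def right_cancel)
    have inj: "\<delta> \<otimes>\<^bsub>G\<^esub> \<alpha> = \<gamma> \<otimes>\<^bsub>G\<^esub> \<alpha> \<longleftrightarrow> \<delta> = \<gamma>"
      using \<alpha> \<gamma> \<delta> by simp
    note sq = incl_colinear[OF \<delta> \<alpha>, folded \<beta>_eq]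
    have t: "gcoact M \<delta> \<alpha> m \<in> carrier (tensor_group A (gmod M \<delta>) (part C \<alpha>))"
      by (rule colinearD(7)[OF sq m])
    have lhs: "tensor_map A (gmod M \<gamma>) (part C \<alpha>) (\<lambda>x. unFam x \<gamma>) (\<lambda>d. d) (coact (F1_obj G A C M) \<alpha> (incl \<beta> m))
      = tensor_map A (gmod M \<gamma>) (part C \<alpha>) (\<lambda>m. unFam (incl \<delta> m) \<gamma>) (\<lambda>d. d) (gcoact M \<delta> \<alpha> m)"
      by (simp only: colinearD(6)[OF sq m, symmetric] tensor_map_comp[OF colinearD(5)[OF sq] proj1 idP idP t])
    show "tensor_map A (gmod M \<gamma>) (part C \<alpha>) (\<lambda>x. unFam x \<gamma>) (\<lambda>d. d) (coact (F1_obj G A C M) \<alpha> (incl \<beta> m))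
      = gcoact M \<gamma> \<alpha> (unFam (incl \<beta> m) (\<gamma> \<otimes>\<^bsub>G\<^esub> \<alpha>))"
    proof (cases "\<delta> = \<gamma>")
      case True
      then show ?thesis
        unfolding lhs using t \<gamma> \<gamma>\<alpha> by (simp add: family.proj_incl \<beta>_eq tensor_map_id[OF gmod_module[OF \<gamma>] P])
    next
      case False
      interpret M\<gamma>: right_module A "gmod M \<gamma>" by (rule gmod_module[OF \<gamma>])
      have comp: "rmod_map A (gmod M \<delta>) (gmod M \<gamma>) (\<lambda>m. unFam (incl \<delta> m) \<gamma>)"
        by (rule rmod_map_comp[OF family.incl_map[OF \<delta>] proj1])
      have zero: "unFam (incl \<delta> m) \<gamma> = \<one>\<^bsub>gmod M \<gamma>\<^esub>" for m
        using False by (simp add: family.proj_incl[OF \<gamma>])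
      have "tensor_map A (gmod M \<gamma>) (part C \<alpha>) (\<lambda>m. unFam (incl \<delta> m) \<gamma>) (\<lambda>d. d) (gcoact M \<delta> \<alpha> m) = \<one>\<^bsub>?T\<^esub>"
      proof (rule tensor_hom_ext[OF gmod_module[OF \<delta>] P T.is_group tensor_map_hom[OF comp idP] _ _ t])
        show "(\<lambda>_. \<one>\<^bsub>?T\<^esub>) \<in> hom (tensor_group A (gmod M \<delta>) (part C \<alpha>)) ?T"
          by (simp add: hom_def)
        show "tensor_map A (gmod M \<gamma>) (part C \<alpha>) (\<lambda>m. unFam (incl \<delta> m) \<gamma>) (\<lambda>d. d) (pure A (gmod M \<delta>) (part C \<alpha>) x y) = \<one>\<^bsub>?T\<^esub>"
          if "x \<in> carrier (gmod M \<delta>)" "y \<in> carrier (part C \<alpha>)" for x y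
          using hom_one[OF balanced_hom_left[OF pure_balanced[OF gmod_module[OF \<gamma>] P] that(2)]
              M\<gamma>.module.is_group T.is_group]
          unfolding tensor_map_pure[OF comp idP that] by (simp add: zero)
      qed
      moreover have "gcoact M \<gamma> \<alpha> \<one>\<^bsub>gmod M (\<gamma> \<otimes>\<^bsub>G\<^esub> \<alpha>)\<^esub> = \<one>\<^bsub>?T\<^esub>"
        by (rule hom_one[OF s_hom family.group[OF \<gamma>\<alpha>] T.is_group])
      ultimately show ?thesis
        unfolding lhs using False inj \<gamma>\<alpha> by (simp add: family.proj_incl \<beta>_eq)
    qed
  qed
qed

text \<open>
  Dual to \<open>comod_map_from_F1I\<close>: the square of \<open>h\<close> is tested after projection to each summand, which is
  conclusive because of the finiteness of \<open>G\<close>.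
\<close>

lemma comod_map_to_F1I:
  assumes fin: "finite (carrier G)" and N: "right_comodule G A C N" and h: "rmod_map A (cmod N) family.S h"
    and l: "family_from G A C N M (\<lambda>\<alpha> n. unFam (h n) \<alpha>)"
  shows "comod_map G A C N (F1_obj G A C M) h"
  unfolding comod_map_def cmod_F1
proof (intro ballI colinearI)
  interpret N: right_comodule G A C N by fact
  fix \<alpha> assume \<alpha>: "\<alpha> \<in> carrier G"
  show P: "bimodule A (part C \<alpha>)" by (rule part_bimodule[OF \<alpha>])
  show s: "rmod_map A family.S (rtensor A family.S (part C \<alpha>)) (coact (F1_obj G A C M) \<alpha>)"
    by (rule coact_F1_map[OF \<alpha>])
  show r: "rmod_map A (cmod N) (rtensor A (cmod N) (part C \<alpha>)) (coact N \<alpha>)"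
    by (rule N.coact_map[OF \<alpha>])
  show "rmod_map A (cmod N) family.S h" by (rule h)
  show "rmod_map A (cmod N) family.S h" by (rule h)
  note idP = bimod_map_id[OF P]
  fix n assume n: "n \<in> carrier (cmod N)"
  have rn: "coact N \<alpha> n \<in> carrier (tensor_group A (cmod N) (part C \<alpha>))"
    using rmod_mapD(5)[OF r n] by simp
  have hn: "h n \<in> carrier family.S"
    by (rule rmod_mapD(5)[OF h n])
  show "tensor_map A family.S (part C \<alpha>) h (\<lambda>d. d) (coact N \<alpha> n) = coact (F1_obj G A C M) \<alpha> (h n)"
  proof (rule family.tensor_sum_eqI[OF fin P tensor_map_closed[OF h idP rn]])
    show "coact (F1_obj G A C M) \<alpha> (h n) \<in> carrier (tensor_group A family.S (part C \<alpha>))"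
      using rmod_mapD(5)[OF s hn] by simp
    fix \<gamma> assume \<gamma>: "\<gamma> \<in> carrier G"
    have sq: "colinear A (part C \<alpha>) family.S family.S (coact (F1_obj G A C M) \<alpha>)
       (gmod M (\<gamma> \<otimes>\<^bsub>G\<^esub> \<alpha>)) (gmod M \<gamma>) (gcoact M \<gamma> \<alpha>) (\<lambda>x. unFam x (\<gamma> \<otimes>\<^bsub>G\<^esub> \<alpha>)) (\<lambda>x. unFam x \<gamma>)"
      using proj_family \<gamma> \<alpha> by (simp add: family_from_def)
    have "colinear A (part C \<alpha>) (cmod N) (cmod N) (coact N \<alpha>)
       (gmod M (\<gamma> \<otimes>\<^bsub>G\<^esub> \<alpha>)) (gmod M \<gamma>) (gcoact M \<gamma> \<alpha>) (\<lambda>x. unFam (h x) (\<gamma> \<otimes>\<^bsub>G\<^esub> \<alpha>)) (\<lambda>x. unFam (h x) \<gamma>)"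
      using l \<gamma> \<alpha> by (auto simp: family_from_def)
    from colinearD(6)[OF this n]
    show "tensor_map A (gmod M \<gamma>) (part C \<alpha>) (\<lambda>x. unFam x \<gamma>) (\<lambda>d. d) (tensor_map A family.S (part C \<alpha>) h (\<lambda>d. d) (coact N \<alpha> n))
      = tensor_map A (gmod M \<gamma>) (part C \<alpha>) (\<lambda>x. unFam x \<gamma>) (\<lambda>d. d) (coact (F1_obj G A C M) \<alpha> (h n))"
      by (simp only: colinearD(6)[OF sq hn] tensor_map_comp[OF h colinearD(5)[OF sq] idP idP rn])
  qed
qed

end

section \<open>The constant graded comodule\<close>

text \<open>
  The functor \<open>G\<^sub>1\<close> is defined on comodules carried by \<open>univ\<close>, where the indexed copies exist.
\<close>

locale universe_comodule = right_comodule G A C N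
  for G :: "('g, 'gz) monoid_scheme" and A :: "('r, 's) ring_scheme"
    and C :: "('g, 'r, 'c) coring_data" and N :: "('g, 'r, 'c, ('g, 'v) univ) comod_data"
begin

abbreviation "copy \<alpha> \<equiv> image_mod (Mu \<alpha>) (cmod N)"
abbreviation "unMu \<alpha> \<equiv> inv_into (carrier (cmod N)) (Mu \<alpha>)"

lemma gmod_G1 [simp]: "gmod (G1_obj G A C N) \<alpha> = copy \<alpha>"
  by (simp add: G1_obj_def)

lemma carrier_copy: "carrier (copy \<alpha>) = Mu \<alpha> ` carrier (cmod N)"
  by (rule carrier_image_mod[OF inj_Mu])

lemma unMu_Mu: "n \<in> carrier (cmod N) \<Longrightarrow> unMu \<alpha> (Mu \<alpha> n) = n"
  by (rule inv_into_f_f[OF inj_Mu])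

lemma Mu_map: "rmod_map A (cmod N) (copy \<alpha>) (Mu \<alpha>)"
  by (rule image_mod_map[OF cmod_module inj_Mu])

lemma unMu_map: "rmod_map A (copy \<alpha>) (cmod N) (unMu \<alpha>)"
  by (rule image_mod_inv_map[OF cmod_module inj_Mu])

lemma gcoact_G1:
  "gcoact (G1_obj G A C N) \<alpha> \<beta> x
    = tensor_map A (copy \<alpha>) (part C \<beta>) (Mu \<alpha>) (\<lambda>d. d) (coact N \<beta> (unMu (\<alpha> \<otimes>\<^bsub>G\<^esub> \<beta>) x))"
  by (simp add: G1_obj_def)

lemma gcoact_G1_map:
  assumes "\<alpha> \<in> carrier G" "\<beta> \<in> carrier G"
  shows "rmod_map A (copy (\<alpha> \<otimes>\<^bsub>G\<^esub> \<beta>)) (rtensor A (copy \<alpha>) (part C \<beta>)) (gcoact (G1_obj G A C N) \<alpha> \<beta>)"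
  unfolding gcoact_G1[abs_def]
  by (rule rmod_map_comp[OF rmod_map_comp[OF unMu_map coact_map[OF assms(2)]]
        tensor_map_rmod_map[OF Mu_map bimod_map_id[OF part_bimodule[OF assms(2)]]]])

lemma Mu_family: "family_from G A C N (G1_obj G A C N) Mu"
  by (auto simp: family_from_def part_bimodule coact_map gcoact_G1_map Mu_map gcoact_G1 unMu_Mu intro!: colinearI)

text \<open>
  The coaction of \<open>G\<^sub>1(N)\<close> is \<open>\<mu>\<^sub>\<alpha> \<otimes> C\<^sub>\<beta>\<close> after the coaction of \<open>N\<close>, and the inverse of \<open>\<mu>\<^sub>\<alpha>\<close> undoes the
  first factor.
\<close>

lemma unMu_family: "family_to G A C (G1_obj G A C N) N unMu"
  unfolding family_to_def gmod_G1
proof (intro ballI colinearI)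
  fix \<alpha> \<beta> assume \<alpha>: "\<alpha> \<in> carrier G" and \<beta>: "\<beta> \<in> carrier G"
  show P: "bimodule A (part C \<beta>)" by (rule part_bimodule[OF \<beta>])
  fix x assume "x \<in> carrier (copy (\<alpha> \<otimes>\<^bsub>G\<^esub> \<beta>))"
  then have "unMu (\<alpha> \<otimes>\<^bsub>G\<^esub> \<beta>) x \<in> carrier (cmod N)"
    by (rule rmod_mapD(5)[OF unMu_map])
  then have t: "coact N \<beta> (unMu (\<alpha> \<otimes>\<^bsub>G\<^esub> \<beta>) x) \<in> carrier (tensor_group A (cmod N) (part C \<beta>))"
    using rmod_mapD(5)[OF coact_map[OF \<beta>]] by simp
  show "tensor_map A (cmod N) (part C \<beta>) (unMu \<alpha>) (\<lambda>d. d) (gcoact (G1_obj G A C N) \<alpha> \<beta> x) = coact N \<beta> (unMu (\<alpha> \<otimes>\<^bsub>G\<^esub> \<beta>) x)"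
    unfolding gcoact_G1 tensor_map_comp[OF Mu_map unMu_map bimod_map_id[OF P] bimod_map_id[OF P] t]
    by (rule tensor_map_id[OF cmod_module P unMu_Mu t])
qed (auto simp: gcoact_G1_map coact_map unMu_map)

text \<open>
  Every element of a copy is \<open>\<mu>\<^sub>\<alpha>(n)\<close> for some \<open>n\<close>, so the axioms of \<open>N\<close> at \<open>n\<close> are transported along
  the squares of \<open>Mu_family\<close>.
\<close>

lemma G1_gcomodule: "right_gcomodule G A C (G1_obj G A C N)"
proof (rule right_gcomodule.intro[OF group_coring_axioms right_gcomodule_axioms.intro], unfold gmod_G1)
  let ?s = "gcoact (G1_obj G A C N)"
  have sq: "colinear A (part C \<beta>) (cmod N) (cmod N) (coact N \<beta>) (copy (\<alpha> \<otimes>\<^bsub>G\<^esub> \<beta>)) (copy \<alpha>) (?s \<alpha> \<beta>) (Mu (\<alpha> \<otimes>\<^bsub>G\<^esub> \<beta>)) (Mu \<alpha>)"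
    if "\<alpha> \<in> carrier G" "\<beta> \<in> carrier G" for \<alpha> \<beta>
    using Mu_family that by (simp add: family_from_def)
  show "right_module A (copy \<alpha>)" for \<alpha>
    by (rule rmod_mapD(2)[OF Mu_map])
  show "rlinear A (copy (\<alpha> \<otimes>\<^bsub>G\<^esub> \<beta>)) (rtensor A (copy \<alpha>) (part C \<beta>)) (?s \<alpha> \<beta>)"
    if "\<alpha> \<in> carrier G" "\<beta> \<in> carrier G" for \<alpha> \<beta>
    by (rule rmod_mapD(3)[OF gcoact_G1_map[OF that]])
  show "right_unitor (copy \<alpha>) (tensor_map A (copy \<alpha>) (ring_bimod A) (\<lambda>x. x) (counit C) (?s \<alpha> \<one>\<^bsub>G\<^esub> x)) = x"
    if \<alpha>: "\<alpha> \<in> carrier G" and x: "x \<in> carrier (copy \<alpha>)" for \<alpha> x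
  proof -
    obtain n where n: "n \<in> carrier (cmod N)" "x = Mu \<alpha> n"
      using x by (auto simp: carrier_copy)
    have unit_sq: "colinear A (part C \<one>\<^bsub>G\<^esub>) (cmod N) (cmod N) (coact N \<one>\<^bsub>G\<^esub>) (copy \<alpha>) (copy \<alpha>) (?s \<alpha> \<one>\<^bsub>G\<^esub>) (Mu \<alpha>) (Mu \<alpha>)"
      using sq[OF \<alpha> one_closed] \<alpha> by simp
    show ?thesis
      unfolding n(2) by (rule counit_transport[OF counit_map unit_sq n(1) coact_counit[OF n(1)]])
  qed
  fix \<alpha> \<beta> \<gamma> x
  assume \<alpha>: "\<alpha> \<in> carrier G" and \<beta>: "\<beta> \<in> carrier G" and \<gamma>: "\<gamma> \<in> carrier G"
    and x: "x \<in> carrier (copy (\<alpha> \<otimes>\<^bsub>G\<^esub> \<beta> \<otimes>\<^bsub>G\<^esub> \<gamma>))"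
  obtain n where n: "n \<in> carrier (cmod N)" "x = Mu (\<alpha> \<otimes>\<^bsub>G\<^esub> \<beta> \<otimes>\<^bsub>G\<^esub> \<gamma>) n"
    using x by (auto simp: carrier_copy)
  have \<alpha>\<beta>: "\<alpha> \<otimes>\<^bsub>G\<^esub> \<beta> \<in> carrier G" and \<beta>\<gamma>: "\<beta> \<otimes>\<^bsub>G\<^esub> \<gamma> \<in> carrier G"
    using \<alpha> \<beta> \<gamma> by simp_all
  have sq02: "colinear A (part C (\<beta> \<otimes>\<^bsub>G\<^esub> \<gamma>)) (cmod N) (cmod N) (coact N (\<beta> \<otimes>\<^bsub>G\<^esub> \<gamma>))
     (copy (\<alpha> \<otimes>\<^bsub>G\<^esub> \<beta> \<otimes>\<^bsub>G\<^esub> \<gamma>)) (copy \<alpha>) (?s \<alpha> (\<beta> \<otimes>\<^bsub>G\<^esub> \<gamma>)) (Mu (\<alpha> \<otimes>\<^bsub>G\<^esub> \<beta> \<otimes>\<^bsub>G\<^esub> \<gamma>)) (Mu \<alpha>)"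
    using sq[OF \<alpha> \<beta>\<gamma>] \<alpha> \<beta> \<gamma> by (simp add: m_assoc)
  show "tensor_map A (copy \<alpha>) (bitensor A (part C \<beta>) (part C \<gamma>)) (\<lambda>x. x) (comult C \<beta> \<gamma>) (?s \<alpha> (\<beta> \<otimes>\<^bsub>G\<^esub> \<gamma>) x)
      = tensor_assoc A (copy \<alpha>) (part C \<beta>) (part C \<gamma>)
          (tensor_map A (rtensor A (copy \<alpha>) (part C \<beta>)) (part C \<gamma>) (?s \<alpha> \<beta>) (\<lambda>d. d) (?s (\<alpha> \<otimes>\<^bsub>G\<^esub> \<beta>) \<gamma> x))"
    unfolding n(2)
    by (rule coassoc_transport[OF part_bimodule[OF \<beta>] part_bimodule[OF \<gamma>] comult_map[OF \<beta> \<gamma>]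
          sq[OF \<alpha>\<beta> \<gamma>] sq[OF \<alpha> \<beta>] sq02 n(1) coact_coassoc[OF \<beta> \<gamma> n(1)]])
qed

end

section \<open>The functors\<close>

context group_coring begin

lemma universe_gcomoduleI: "right_gcomodule G A C M \<Longrightarrow> universe_gcomodule G A C M"
  by (simp add: universe_gcomodule_def)

lemma universe_comoduleI: "right_comodule G A C N \<Longrightarrow> universe_comodule G A C N"
  by (simp add: universe_comodule_def)

lemma F1_simps [simp]:
  "omap (F1 G A C) M = F1_obj G A C M"
  "amap (F1 G A C) M N f = (\<lambda>x\<in>carrier (sum_mod (carrier G) (gmod M)). sum_map (carrier G) f x)"
  by (simp_all add: F1_def sum_map_def)

lemma G1_simps [simp]:
  "omap (G1 G A C) M = G1_obj G A C M"
  "amap (G1 G A C) M N f = (\<lambda>\<alpha>\<in>carrier G. \<lambda>x\<in>Mu \<alpha> ` carrier (cmod M).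
        Mu \<alpha> (f (inv_into (carrier (cmod M)) (Mu \<alpha>) x)))"
  by (simp_all add: G1_def)

text \<open>
  Restricted to the summands, the map is the family \<open>incl \<circ> f\<close>, a composite of compatible maps.
\<close>

lemma sum_map_comod_map:
  assumes M: "right_gcomodule G A C M" and N: "right_gcomodule G A C N" and f: "gcomod_map G A C M N f"
  shows "comod_map G A C (F1_obj G A C M) (F1_obj G A C N) (sum_map (carrier G) f)"
proof -
  interpret M: universe_gcomodule G A C M by (rule universe_gcomoduleI[OF M])
  interpret N: universe_gcomodule G A C N by (rule universe_gcomoduleI[OF N])
  note f_map = gcomod_map_rmod_map[OF f]
  show ?thesis
  proof (rule M.comod_map_from_F1I[OF N.F1_comodule])
    show "rmod_map A M.family.S (cmod (F1_obj G A C N)) (sum_map (carrier G) f)"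
      using sum_map_map[OF M.family.module_family_axioms N.family.module_family_axioms f_map] by simp
    show "family_to G A C M (F1_obj G A C N) (\<lambda>\<alpha> m. sum_map (carrier G) f (M.incl \<alpha> m))"
      using gcomod_map_comp_family_to[OF f N.incl_family]
      by (simp add: sum_map_incl[OF M.family.module_family_axioms N.family.module_family_axioms f_map])
  qed
qed

lemma F1_functor: "is_functor (gcomodules G A C) (comodules G A C) (F1 G A C)"
proof (rule is_functor.intro[OF gcomodules_category comodules_category is_functor_axioms.intro],
    unfold gcomodules_simps comodules_simps mem_Collect_eq F1_simps)
  fix X :: "('g, 'r, 'c, ('g, 'v) univ) gcomod_data"
  assume X: "right_gcomodule G A C X"
  interpret X: universe_gcomodule G A C X by (rule universe_gcomoduleI[OF X])
  show "right_comodule G A C (F1_obj G A C X)" by (rule X.F1_comodule)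
  have "sum_map (carrier G) (\<lambda>\<alpha>\<in>carrier G. \<lambda>m\<in>carrier (gmod X \<alpha>). m) x = x" if x: "x \<in> carrier X.family.S" for x
    using x by (auto simp: sum_map_def PiE_iff elim!: X.family.carrier_sum_modE) (auto simp: extensional_def)
  then show "(\<lambda>x\<in>carrier X.family.S. sum_map (carrier G) (\<lambda>\<alpha>\<in>carrier G. \<lambda>m\<in>carrier (gmod X \<alpha>). m) x)
    = (\<lambda>m\<in>carrier (cmod (F1_obj G A C X)). m)"
    by (auto intro!: restrict_ext)
  fix Y :: "('g, 'r, 'c, ('g, 'v) univ) gcomod_data" and f
  assume Y: "right_gcomodule G A C Y" and f: "f \<in> Hom (gcomodules G A C) X Y"
  interpret Y: universe_gcomodule G A C Y by (rule universe_gcomoduleI[OF Y])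
  have f': "gcomod_map G A C X Y f"
    using f by (simp add: Hom_gcomodules_iff X Y)
  show "(\<lambda>x\<in>carrier X.family.S. sum_map (carrier G) f x) \<in> Hom (comodules G A C) (F1_obj G A C X) (F1_obj G A C Y)"
    by (auto simp: Hom_comodules_iff X.F1_comodule Y.F1_comodule intro: comod_map_cong[OF sum_map_comod_map[OF X Y f']])
  fix Z :: "('g, 'r, 'c, ('g, 'v) univ) gcomod_data" and g
  assume Z: "right_gcomodule G A C Z" and g: "g \<in> Hom (gcomodules G A C) Y Z"
  have "sum_map (carrier G) f x \<in> carrier Y.family.S" if "x \<in> carrier X.family.S" for x
    using rmod_mapD(5)[OF comod_map_rmod_map[OF sum_map_comod_map[OF X Y f']]] that by simp
  moreover have "unFam x \<alpha> \<in> carrier (gmod X \<alpha>)" if "x \<in> carrier X.family.S" "\<alpha> \<in> carrier G" for x \<alpha>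
    by (rule rmod_mapD(5)[OF X.family.proj_map[OF that(2)] that(1)])
  ultimately show "(\<lambda>x\<in>carrier X.family.S. sum_map (carrier G) (\<lambda>\<alpha>\<in>carrier G. compose (carrier (gmod X \<alpha>)) (g \<alpha>) (f \<alpha>)) x)
    = compose (carrier (cmod (F1_obj G A C X))) (\<lambda>x\<in>carrier Y.family.S. sum_map (carrier G) g x)
        (\<lambda>x\<in>carrier X.family.S. sum_map (carrier G) f x)"
    by (auto simp: compose_def sum_map_def intro!: restrict_ext)
qed

lemma copy_gcomod_map:
  assumes M: "right_comodule G A C M" and N: "right_comodule G A C N" and f: "comod_map G A C M N f"
  shows "gcomod_map G A C (G1_obj G A C M) (G1_obj G A C N)
    (\<lambda>\<alpha> x. Mu \<alpha> (f (inv_into (carrier (cmod M)) (Mu \<alpha>) x)))"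
  using family_to_comp_family_from[OF
      family_to_comp_comod_map[OF universe_comodule.unMu_family[OF universe_comoduleI[OF M]] f]
      universe_comodule.Mu_family[OF universe_comoduleI[OF N]]] .

lemma G1_functor: "is_functor (comodules G A C) (gcomodules G A C) (G1 G A C)"
proof (rule is_functor.intro[OF comodules_category gcomodules_category is_functor_axioms.intro],
    unfold gcomodules_simps comodules_simps mem_Collect_eq G1_simps)
  fix X :: "('g, 'r, 'c, ('g, 'v) univ) comod_data"
  assume X: "right_comodule G A C X"
  interpret X: universe_comodule G A C X by (rule universe_comoduleI[OF X])
  show "right_gcomodule G A C (G1_obj G A C X)" by (rule X.G1_gcomodule)
  show "(\<lambda>\<alpha>\<in>carrier G. \<lambda>x\<in>Mu \<alpha> ` carrier (cmod X). Mu \<alpha> ((\<lambda>m\<in>carrier (cmod X). m) (X.unMu \<alpha> x)))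
    = (\<lambda>\<alpha>\<in>carrier G. \<lambda>m\<in>carrier (gmod (G1_obj G A C X) \<alpha>). m)"
    by (auto simp: X.carrier_copy X.unMu_Mu intro!: restrict_ext)
  fix Y :: "('g, 'r, 'c, ('g, 'v) univ) comod_data" and f
  assume Y: "right_comodule G A C Y" and f: "f \<in> Hom (comodules G A C) X Y"
  interpret Y: universe_comodule G A C Y by (rule universe_comoduleI[OF Y])
  have f': "comod_map G A C X Y f"
    using f by (simp add: Hom_comodules_iff X Y)
  show "(\<lambda>\<alpha>\<in>carrier G. \<lambda>x\<in>Mu \<alpha> ` carrier (cmod X). Mu \<alpha> (f (X.unMu \<alpha> x)))
    \<in> Hom (gcomodules G A C) (G1_obj G A C X) (G1_obj G A C Y)"
    by (auto simp: Hom_gcomodules_iff X.G1_gcomodule Y.G1_gcomodule X.carrier_copy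
        intro: gcomod_map_cong[OF copy_gcomod_map[OF X Y f']])
  fix Z :: "('g, 'r, 'c, ('g, 'v) univ) comod_data" and g
  assume Z: "right_comodule G A C Z" and g: "g \<in> Hom (comodules G A C) Y Z"
  have f_closed: "f x \<in> carrier (cmod Y)" if "x \<in> carrier (cmod X)" for x
    by (rule rmod_mapD(5)[OF comod_map_rmod_map[OF f'] that])
  show "(\<lambda>\<alpha>\<in>carrier G. \<lambda>x\<in>Mu \<alpha> ` carrier (cmod X). Mu \<alpha> (compose (carrier (cmod X)) g f (X.unMu \<alpha> x)))
    = (\<lambda>\<alpha>\<in>carrier G. compose (carrier (gmod (G1_obj G A C X) \<alpha>))
        ((\<lambda>\<alpha>\<in>carrier G. \<lambda>x\<in>Mu \<alpha> ` carrier (cmod Y). Mu \<alpha> (g (Y.unMu \<alpha> x))) \<alpha>)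
        ((\<lambda>\<alpha>\<in>carrier G. \<lambda>x\<in>Mu \<alpha> ` carrier (cmod X). Mu \<alpha> (f (X.unMu \<alpha> x))) \<alpha>))"
    by (auto simp: compose_def X.carrier_copy X.unMu_Mu Y.unMu_Mu f_closed intro!: restrict_ext)
qed

section \<open>The two adjunctions\<close>

text \<open>
  The inverse sends a graded morphism \<open>f\<close> to the map on the direct sum with components \<open>\<mu>\<^sub>\<alpha>\<^sup>-\<^sup>1 \<circ> f\<^sub>\<alpha>\<close>.
\<close>

lemma F1_G1_bij:
  assumes M: "right_gcomodule G A C M" and N: "right_comodule G A C N"
  shows "bij_betw (\<lambda>h. \<lambda>\<alpha>\<in>carrier G. \<lambda>m\<in>carrier (gmod M \<alpha>). Mu \<alpha> (h (sum_incl (carrier G) (gmod M) \<alpha> m)))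
    (Hom (comodules G A C) (F1_obj G A C M) N) (Hom (gcomodules G A C) M (G1_obj G A C N))"
proof -
  interpret M: universe_gcomodule G A C M by (rule universe_gcomoduleI[OF M])
  interpret N: universe_comodule G A C N by (rule universe_comoduleI[OF N])
  let ?phi = "\<lambda>h. \<lambda>\<alpha>\<in>carrier G. \<lambda>m\<in>carrier (gmod M \<alpha>). Mu \<alpha> (h (M.incl \<alpha> m))"
  let ?psi = "\<lambda>f. \<lambda>x\<in>carrier M.family.S. sum_lift (cmod N) (carrier G) (gmod M) (\<lambda>\<alpha> m. N.unMu \<alpha> (f \<alpha> m)) x"
  note N_group = right_module_comm_group[OF N.cmod_module]
  have Hom1: "h \<in> Hom (comodules G A C) (F1_obj G A C M) N \<longleftrightarrow>
      h \<in> extensional (carrier M.family.S) \<and> comod_map G A C (F1_obj G A C M) N h" for h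
    by (simp add: Hom_comodules_iff M.F1_comodule N)
  have Hom2: "f \<in> Hom (gcomodules G A C) M (G1_obj G A C N) \<longleftrightarrow> f \<in> extensional (carrier G) \<and>
      (\<forall>\<alpha>\<in>carrier G. f \<alpha> \<in> extensional (carrier (gmod M \<alpha>))) \<and> gcomod_map G A C M (G1_obj G A C N) f" for f
    by (simp add: Hom_gcomodules_iff N.G1_gcomodule M)
  have to_family: "family_to G A C M N (\<lambda>\<alpha> m. N.unMu \<alpha> (f \<alpha> m))"
    if "gcomod_map G A C M (G1_obj G A C N) f" for f
    by (rule gcomod_map_comp_family_to[OF that N.unMu_family])
  have lift_incl: "sum_lift (cmod N) (carrier G) (gmod M) k (M.incl \<alpha> m) = k \<alpha> m"
    if "\<alpha> \<in> carrier G" "m \<in> carrier (gmod M \<alpha>)" "family_to G A C M N k" for k \<alpha> m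
    by (rule M.family.sum_lift_incl[where f = k and i = \<alpha>,
          OF N_group rmod_mapD(4)[OF family_to_rmod_map[OF that(3,1)]] that(1,2)])
  show ?thesis
  proof (rule bij_betwI[where g = ?psi]; (intro Pi_I)?)
    fix h assume h: "h \<in> Hom (comodules G A C) (F1_obj G A C M) N"
    then have h': "comod_map G A C (F1_obj G A C M) N h" by (simp add: Hom1)
    have map: "gcomod_map G A C M (G1_obj G A C N) (\<lambda>\<alpha> m. Mu \<alpha> (h (M.incl \<alpha> m)))"
      by (rule family_to_comp_family_from[OF family_to_comp_comod_map[OF M.incl_family h'] N.Mu_family])
    have phi_map: "gcomod_map G A C M (G1_obj G A C N) (?phi h)"
      by (rule gcomod_map_cong[OF map]) simp
    then show "?phi h \<in> Hom (gcomodules G A C) M (G1_obj G A C N)"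
      by (simp add: Hom2)
    have h_hom: "h \<in> hom M.family.S (cmod N)"
      using rmod_mapD(4)[OF comod_map_rmod_map[OF h']] by simp
    have incl: "h (M.incl \<alpha> m) \<in> carrier (cmod N)" if "\<alpha> \<in> carrier G" "m \<in> carrier (gmod M \<alpha>)" for \<alpha> m
      by (rule hom_in_carrier[OF h_hom M.family.incl_closed[OF that]])
    have "sum_lift (cmod N) (carrier G) (gmod M) (\<lambda>\<alpha> m. N.unMu \<alpha> (?phi h \<alpha> m)) x = h x"
      if x: "x \<in> carrier M.family.S" for x
    proof (rule M.family.sum_hom_ext[OF N_group _ h_hom _ x])
      show "sum_lift (cmod N) (carrier G) (gmod M) (\<lambda>\<alpha> m. N.unMu \<alpha> (?phi h \<alpha> m)) \<in> hom M.family.S (cmod N)"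
        using rmod_mapD(4)[OF comod_map_rmod_map[OF M.sum_lift_comod_map[OF N to_family[OF phi_map]]]] by simp
      show "sum_lift (cmod N) (carrier G) (gmod M) (\<lambda>\<alpha> m. N.unMu \<alpha> (?phi h \<alpha> m)) (M.incl \<alpha> m) = h (M.incl \<alpha> m)"
        if "\<alpha> \<in> carrier G" "m \<in> carrier (gmod M \<alpha>)" for \<alpha> m
        using lift_incl[OF that to_family[OF phi_map]] that by (simp add: N.unMu_Mu incl)
    qed
    then show "?psi (?phi h) = h"
      using h by (intro extensionalityI[of _ "carrier M.family.S"]) (auto simp: Hom1)
  next
    fix f assume f: "f \<in> Hom (gcomodules G A C) M (G1_obj G A C N)"
    then have f': "gcomod_map G A C M (G1_obj G A C N) f" by (simp add: Hom2)
    have "comod_map G A C (F1_obj G A C M) N (?psi f)"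
      by (rule comod_map_cong[OF M.sum_lift_comod_map[OF N to_family[OF f']]]) simp
    then show "?psi f \<in> Hom (comodules G A C) (F1_obj G A C M) N"
      by (simp add: Hom1)
    have "?phi (?psi f) \<alpha> m = f \<alpha> m" if \<alpha>: "\<alpha> \<in> carrier G" and m: "m \<in> carrier (gmod M \<alpha>)" for \<alpha> m
    proof -
      have "f \<alpha> m \<in> Mu \<alpha> ` carrier (cmod N)"
        using rmod_mapD(5)[OF gcomod_map_rmod_map[OF f' \<alpha>] m] by (simp add: N.carrier_copy)
      then show ?thesis
        using \<alpha> m lift_incl[OF \<alpha> m to_family[OF f']] by (simp add: M.family.incl_closed f_inv_into_f)
    qed
    then have "?phi (?psi f) \<alpha> = f \<alpha>" if "\<alpha> \<in> carrier G" for \<alpha>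
      using f that by (intro extensionalityI[of _ "carrier (gmod M \<alpha>)"]) (auto simp: Hom2)
    then show "?phi (?psi f) = f"
      using f by (intro extensionalityI[of _ "carrier G"]) (auto simp: Hom2)
  qed
qed

text \<open>
  For naturality, both sides send \<open>m\<close> of degree \<open>\<alpha>\<close> to \<open>\<mu>\<^sub>\<alpha>(g(h(incl\<^sub>\<alpha>(f\<^sub>\<alpha>(m)))))\<close>.
\<close>

lemma F1_G1_adjoint:
  "adjoint_pair (gcomodules G A C :: (('g, 'r, 'c, ('g, 'v) univ) gcomod_data, _) cat)
     (comodules G A C) (F1 G A C) (G1 G A C)"
  unfolding adjoint_pair_def
proof (intro conjI F1_functor G1_functor
    exI[of _ "\<lambda>M N h. \<lambda>\<alpha>\<in>carrier G. \<lambda>m\<in>carrier (gmod M \<alpha>). Mu \<alpha> (h (sum_incl (carrier G) (gmod M) \<alpha> m))"] ballI,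
    unfold gcomodules_simps comodules_simps mem_Collect_eq F1_simps G1_simps)
  fix X :: "('g, 'r, 'c, ('g, 'v) univ) gcomod_data" and Y :: "('g, 'r, 'c, ('g, 'v) univ) comod_data"
  assume X: "right_gcomodule G A C X" and Y: "right_comodule G A C Y"
  show "bij_betw (\<lambda>h. \<lambda>\<alpha>\<in>carrier G. \<lambda>m\<in>carrier (gmod X \<alpha>). Mu \<alpha> (h (sum_incl (carrier G) (gmod X) \<alpha> m)))
    (Hom (comodules G A C) (F1_obj G A C X) Y) (Hom (gcomodules G A C) X (G1_obj G A C Y))"
    by (rule F1_G1_bij[OF X Y])
next
  fix X X' :: "('g, 'r, 'c, ('g, 'v) univ) gcomod_data" and Y Y' :: "('g, 'r, 'c, ('g, 'v) univ) comod_data"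
    and f g h
  assume X: "right_gcomodule G A C X" and X': "right_gcomodule G A C X'"
    and Y: "right_comodule G A C Y" and Y': "right_comodule G A C Y'"
    and f: "f \<in> Hom (gcomodules G A C) X' X" and g: "g \<in> Hom (comodules G A C) Y Y'"
    and h: "h \<in> Hom (comodules G A C) (F1_obj G A C X) Y"
  interpret X: universe_gcomodule G A C X by (rule universe_gcomoduleI[OF X])
  interpret X': universe_gcomodule G A C X' by (rule universe_gcomoduleI[OF X'])
  interpret Y: universe_comodule G A C Y by (rule universe_comoduleI[OF Y])
  have f': "gcomod_map G A C X' X f" and h': "comod_map G A C (F1_obj G A C X) Y h"
    using f h by (simp_all add: Hom_gcomodules_iff Hom_comodules_iff X X' Y X.F1_comodule)
  note f_map = gcomod_map_rmod_map[OF f']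
  have f_closed: "f \<alpha> m \<in> carrier (gmod X \<alpha>)" if "\<alpha> \<in> carrier G" "m \<in> carrier (gmod X' \<alpha>)" for \<alpha> m
    by (rule rmod_mapD(5)[OF f_map[OF that(1)] that(2)])
  have h_closed: "h x \<in> carrier (cmod Y)" if "x \<in> carrier X.family.S" for x
    using rmod_mapD(5)[OF comod_map_rmod_map[OF h']] that by simp
  show "(\<lambda>\<alpha>\<in>carrier G. \<lambda>m\<in>carrier (gmod X' \<alpha>).
        Mu \<alpha> (compose (carrier (cmod (F1_obj G A C X'))) g
          (compose (carrier (cmod (F1_obj G A C X'))) h
            (\<lambda>x\<in>carrier X'.family.S. sum_map (carrier G) f x)) (X'.incl \<alpha> m)))
    = (\<lambda>\<alpha>\<in>carrier G. compose (carrier (gmod X' \<alpha>))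
        ((\<lambda>\<alpha>\<in>carrier G. \<lambda>x\<in>Mu \<alpha> ` carrier (cmod Y). Mu \<alpha> (g (Y.unMu \<alpha> x))) \<alpha>)
        ((\<lambda>\<alpha>\<in>carrier G. compose (carrier (gmod X' \<alpha>))
          ((\<lambda>\<alpha>\<in>carrier G. \<lambda>m\<in>carrier (gmod X \<alpha>). Mu \<alpha> (h (X.incl \<alpha> m))) \<alpha>) (f \<alpha>)) \<alpha>))"
    by (auto simp: compose_def X'.family.incl_closed X.family.incl_closed f_closed h_closed Y.unMu_Mu
        sum_map_incl[OF X'.family.module_family_axioms X.family.module_family_axioms f_map] intro!: restrict_ext)
qed

text \<open>
  The inverse sends \<open>g : N \<rightarrow> F\<^sub>1(M)\<close> to the maps \<open>proj\<^sub>\<alpha> \<circ> g \<circ> \<mu>\<^sub>\<alpha>\<^sup>-\<^sup>1\<close>. Finiteness of \<open>G\<close> makes the tuple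
  \<open>(h\<^sub>\<alpha>(\<mu>\<^sub>\<alpha>(n)))\<^sub>\<alpha>\<close> an element of the direct sum.
\<close>

lemma G1_F1_bij:
  assumes fin: "finite (carrier G)" and N: "right_comodule G A C N" and M: "right_gcomodule G A C M"
  shows "bij_betw (\<lambda>h. \<lambda>n\<in>carrier (cmod N). Fam (\<lambda>\<alpha>\<in>carrier G. h \<alpha> (Mu \<alpha> n)))
    (Hom (gcomodules G A C) (G1_obj G A C N) M) (Hom (comodules G A C) N (F1_obj G A C M))"
proof -
  interpret M: universe_gcomodule G A C M by (rule universe_gcomoduleI[OF M])
  interpret N: universe_comodule G A C N by (rule universe_comoduleI[OF N])
  let ?phi = "\<lambda>h. \<lambda>n\<in>carrier (cmod N). Fam (\<lambda>\<alpha>\<in>carrier G. h \<alpha> (Mu \<alpha> n))"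
  let ?psi = "\<lambda>g. \<lambda>\<alpha>\<in>carrier G. \<lambda>x\<in>Mu \<alpha> ` carrier (cmod N). unFam (g (N.unMu \<alpha> x)) \<alpha>"
  have Hom1: "g \<in> Hom (comodules G A C) N (F1_obj G A C M) \<longleftrightarrow>
      g \<in> extensional (carrier (cmod N)) \<and> comod_map G A C N (F1_obj G A C M) g" for g
    by (simp add: Hom_comodules_iff M.F1_comodule N)
  have Hom2: "h \<in> Hom (gcomodules G A C) (G1_obj G A C N) M \<longleftrightarrow> h \<in> extensional (carrier G) \<and>
      (\<forall>\<alpha>\<in>carrier G. h \<alpha> \<in> extensional (Mu \<alpha> ` carrier (cmod N))) \<and> gcomod_map G A C (G1_obj G A C N) M h" for h
    by (simp add: Hom_gcomodules_iff N.G1_gcomodule M N.carrier_copy)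
  show ?thesis
  proof (rule bij_betwI[where g = ?psi]; (intro Pi_I)?)
    fix h assume h: "h \<in> Hom (gcomodules G A C) (G1_obj G A C N) M"
    then have h': "gcomod_map G A C (G1_obj G A C N) M h" by (simp add: Hom2)
    have l: "family_from G A C N M (\<lambda>\<alpha> n. h \<alpha> (Mu \<alpha> n))"
      by (rule family_from_comp_gcomod_map[OF N.Mu_family h'])
    have "comod_map G A C N (F1_obj G A C M) (\<lambda>n. Fam (\<lambda>\<alpha>\<in>carrier G. h \<alpha> (Mu \<alpha> n)))"
    proof (rule M.comod_map_to_F1I[OF fin N M.family.tuple_map[OF fin N.cmod_module family_from_rmod_map[OF l]]])
      show "family_from G A C N M (\<lambda>\<alpha> n. unFam (Fam (\<lambda>\<alpha>\<in>carrier G. h \<alpha> (Mu \<alpha> n))) \<alpha>)"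
        by (rule family_from_cong[OF l]) simp
    qed
    then have "comod_map G A C N (F1_obj G A C M) (?phi h)"
      by (rule comod_map_cong) simp
    then show "?phi h \<in> Hom (comodules G A C) N (F1_obj G A C M)"
      by (simp add: Hom1)
    have "?psi (?phi h) \<alpha> = h \<alpha>" if "\<alpha> \<in> carrier G" for \<alpha>
      using h that by (intro extensionalityI[of _ "Mu \<alpha> ` carrier (cmod N)"]) (auto simp: Hom2 N.unMu_Mu)
    then show "?psi (?phi h) = h"
      using h by (intro extensionalityI[of _ "carrier G"]) (auto simp: Hom2)
  next
    fix g assume g: "g \<in> Hom (comodules G A C) N (F1_obj G A C M)"
    then have g': "comod_map G A C N (F1_obj G A C M) g" by (simp add: Hom1)
    have "gcomod_map G A C (G1_obj G A C N) M (\<lambda>\<alpha> x. unFam (g (N.unMu \<alpha> x)) \<alpha>)"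
      by (rule family_to_comp_family_from[OF N.unMu_family comod_map_comp_family_from[OF g' M.proj_family]])
    then have "gcomod_map G A C (G1_obj G A C N) M (?psi g)"
      by (rule gcomod_map_cong) (simp add: N.carrier_copy)
    then show "?psi g \<in> Hom (gcomodules G A C) (G1_obj G A C N) M"
      by (simp add: Hom2)
    have "?phi (?psi g) n = g n" if n: "n \<in> carrier (cmod N)" for n
    proof -
      have "g n \<in> carrier M.family.S"
        using rmod_mapD(5)[OF comod_map_rmod_map[OF g'] n] by simp
      then obtain y where y: "g n = Fam y" "y \<in> (\<Pi>\<^sub>E \<alpha>\<in>carrier G. carrier (gmod M \<alpha>))"
        by (rule M.family.carrier_sum_modE)
      then have "(\<lambda>\<alpha>\<in>carrier G. ?psi g \<alpha> (Mu \<alpha> n)) = y"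
        by (intro extensionalityI[of _ "carrier G"]) (use n in \<open>auto simp: N.unMu_Mu PiE_iff\<close>)
      then show ?thesis
        using n y(1) by simp
    qed
    then show "?phi (?psi g) = g"
      using g by (intro extensionalityI[of _ "carrier (cmod N)"]) (auto simp: Hom1)
  qed
qed

text \<open>
  For naturality, both sides send \<open>n\<close> to the tuple of the \<open>g\<^sub>\<alpha>(h\<^sub>\<alpha>(\<mu>\<^sub>\<alpha>(f(n))))\<close>.
\<close>

lemma G1_F1_adjoint:
  assumes fin: "finite (carrier G)"
  shows "adjoint_pair (comodules G A C)
     (gcomodules G A C :: (('g, 'r, 'c, ('g, 'v) univ) gcomod_data, _) cat) (G1 G A C) (F1 G A C)"
  unfolding adjoint_pair_def
proof (intro conjI F1_functor G1_functor
    exI[of _ "\<lambda>N M h. \<lambda>n\<in>carrier (cmod N). Fam (\<lambda>\<alpha>\<in>carrier G. h \<alpha> (Mu \<alpha> n))"] ballI,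
    unfold gcomodules_simps comodules_simps mem_Collect_eq F1_simps G1_simps)
  fix X :: "('g, 'r, 'c, ('g, 'v) univ) comod_data" and Y :: "('g, 'r, 'c, ('g, 'v) univ) gcomod_data"
  assume X: "right_comodule G A C X" and Y: "right_gcomodule G A C Y"
  show "bij_betw (\<lambda>h. \<lambda>n\<in>carrier (cmod X). Fam (\<lambda>\<alpha>\<in>carrier G. h \<alpha> (Mu \<alpha> n)))
    (Hom (gcomodules G A C) (G1_obj G A C X) Y) (Hom (comodules G A C) X (F1_obj G A C Y))"
    by (rule G1_F1_bij[OF fin X Y])
next
  fix X X' :: "('g, 'r, 'c, ('g, 'v) univ) comod_data" and Y Y' :: "('g, 'r, 'c, ('g, 'v) univ) gcomod_data"
    and f g h
  assume X: "right_comodule G A C X" and X': "right_comodule G A C X'"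
    and Y: "right_gcomodule G A C Y" and Y': "right_gcomodule G A C Y'"
    and f: "f \<in> Hom (comodules G A C) X' X" and g: "g \<in> Hom (gcomodules G A C) Y Y'"
    and h: "h \<in> Hom (gcomodules G A C) (G1_obj G A C X) Y"
  interpret X: universe_comodule G A C X by (rule universe_comoduleI[OF X])
  interpret X': universe_comodule G A C X' by (rule universe_comoduleI[OF X'])
  interpret Y: universe_gcomodule G A C Y by (rule universe_gcomoduleI[OF Y])
  have f': "comod_map G A C X' X f" and h': "gcomod_map G A C (G1_obj G A C X) Y h"
    using f h by (simp_all add: Hom_gcomodules_iff Hom_comodules_iff X X' Y X.G1_gcomodule)
  have f_closed: "f n \<in> carrier (cmod X)" if "n \<in> carrier (cmod X')" for n
    by (rule rmod_mapD(5)[OF comod_map_rmod_map[OF f'] that])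
  have h_map: "rmod_map A (cmod X) Y.family.S (\<lambda>n. Fam (\<lambda>\<alpha>\<in>carrier G. h \<alpha> (Mu \<alpha> n)))"
    by (rule Y.family.tuple_map[OF fin X.cmod_module
          family_from_rmod_map[OF family_from_comp_gcomod_map[OF X.Mu_family h']]])
  show "(\<lambda>n\<in>carrier (cmod X'). Fam (\<lambda>\<alpha>\<in>carrier G.
        (\<lambda>\<alpha>\<in>carrier G. compose (carrier (gmod (G1_obj G A C X') \<alpha>)) (g \<alpha>)
          ((\<lambda>\<alpha>\<in>carrier G. compose (carrier (gmod (G1_obj G A C X') \<alpha>)) (h \<alpha>)
            ((\<lambda>\<alpha>\<in>carrier G. \<lambda>x\<in>Mu \<alpha> ` carrier (cmod X'). Mu \<alpha> (f (X'.unMu \<alpha> x))) \<alpha>)) \<alpha>)) \<alpha> (Mu \<alpha> n)))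
    = compose (carrier (cmod X')) (\<lambda>x\<in>carrier Y.family.S. sum_map (carrier G) g x)
        (compose (carrier (cmod X')) (\<lambda>n\<in>carrier (cmod X). Fam (\<lambda>\<alpha>\<in>carrier G. h \<alpha> (Mu \<alpha> n))) f)"
    using rmod_mapD(5)[OF h_map]
    by (auto simp: compose_def f_closed X'.carrier_copy X'.unMu_Mu sum_map_def intro!: restrict_ext)
qed

end

theorem proposition1p1:
  fixes G :: "('g, 'gz) monoid_scheme" and A :: "('r, 's) ring_scheme"
    and C :: "('g, 'r, 'c) coring_data"
  assumes "group_coring G A C"
  shows "adjoint_pair
           (gcomodules G A C :: (('g, 'r, 'c, ('g, 'v) univ) gcomod_data, _) cat)
           (comodules G A C) (F1 G A C) (G1 G A C)
       \<and> (finite (carrier G) \<longrightarrow>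
           frobenius_pair
             (gcomodules G A C :: (('g, 'r, 'c, ('g, 'v) univ) gcomod_data, _) cat)
             (comodules G A C) (F1 G A C) (G1 G A C))"
proof -
  interpret group_coring G A C by fact
  show ?thesis
    unfolding frobenius_pair_def by (intro conjI impI F1_G1_adjoint G1_F1_adjoint)
qed

end
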